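(* Let $u:\mathbb{R}\to\mathbb{C}$ be an $l$-periodic, twice continuously differentiable $n$-gap potential (in the sense defined in the context). Then the periodic Cauchy problem for the nonlinear Schrödinger equation $$i v_t+v_{xx}+2|v|^2v=0,\qquad v(x,0)=u(x),\quad x\in\mathbb{R},$$ in the class of functions $v(x,t)$ that are $l$-periodic in $x$, twice continuously differentiable in $x$ and continuously differentiable in $t$, is uniquely solvable. Moreover, for every fixed $t$ the solution $v(\cdot,t)$ is an $l$-periodic $n$-gap potential.
   Context: For an $l$-periodic, twice continuously differentiable function $v:\mathbb{R}\to\mathbb{C}$ consider the Dirac-type system $J\frac{dy}{dx}+Q(x)y=zy$, $z\in\mathbb{C}$, where $J=\begin{pmatrix}i&0\\0&-i\end{pmatrix}$ and $Q(x)=\begin{pmatrix}0& i v(x)\\ i\overline{v(x)}&0\end{pmatrix}$. Let $\Phi(x,z)$ be its fundamental matrix solution with $\Phi(0,z)=I$, and call $\Phi(z)=\Phi(l,z)$ the monodromy matrix of $v$; its entries $\Phi_{ik}(z)$ are entire functions of $z$. Associate with $v$ the entire functions $f=\frac{1}{2i}(\Phi_{11}-\Phi_{22})$, $\psi=\Phi_{12}$, $\varphi=\Phi_{21}$. The periodic potential $v$ is called finite-gap if there exist an entire function $h(z)$ and polynomials $\tilde f_0,\tilde\psi_0,\tilde\varphi_0$, with $\tilde f_0$ monic, such that $f=\tilde f_0h$, $\psi=\tilde\psi_0 h$, $\varphi=\tilde\varphi_0 h$; it is called $n$-gap if moreover $\deg\tilde f_0=n+1$. *)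

theory Defs
  imports "HOL-Analysis.Analysis" "HOL-Computational_Algebra.Polynomial"
begin

text \<open>2x2 complex matrices are complex^2^2; index 0 corresponds to the paper's index 1,
  index 1 to the paper's index 2.\<close>

definition J_mat :: "complex^2^2" where
  "J_mat = (\<chi> i j. if i = j then (if i = 0 then \<i> else - \<i>) else 0)"

definition Q_mat :: "(real \<Rightarrow> complex) \<Rightarrow> real \<Rightarrow> complex^2^2" where
  "Q_mat v x = (\<chi> i j. if i = 0 \<and> j = 1 then \<i> * v x
                        else if i = 1 \<and> j = 0 then \<i> * cnj (v x) else 0)"

definition is_fundamental :: "(real \<Rightarrow> complex) \<Rightarrow> complex \<Rightarrow> (real \<Rightarrow> complex^2^2) \<Rightarrow> bool" where
  "is_fundamental v z Y \<longleftrightarrow> Y 0 = mat 1 \<and>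
     (\<forall>x. \<exists>D. (Y has_vector_derivative D) (at x) \<and>
               J_mat ** D + Q_mat v x ** Y x = mat z ** Y x)"

definition fundamental :: "(real \<Rightarrow> complex) \<Rightarrow> complex \<Rightarrow> real \<Rightarrow> complex^2^2" where
  "fundamental v z = (THE Y. is_fundamental v z Y)"

definition monodromy :: "real \<Rightarrow> (real \<Rightarrow> complex) \<Rightarrow> complex \<Rightarrow> complex^2^2" where
  "monodromy l v z = fundamental v z l"

definition f_fun :: "real \<Rightarrow> (real \<Rightarrow> complex) \<Rightarrow> complex \<Rightarrow> complex" where
  "f_fun l v z = (monodromy l v z $ 0 $ 0 - monodromy l v z $ 1 $ 1) / (2 * \<i>)"

definition psi_fun :: "real \<Rightarrow> (real \<Rightarrow> complex) \<Rightarrow> complex \<Rightarrow> complex" where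
  "psi_fun l v z = monodromy l v z $ 0 $ 1"

definition phi_fun :: "real \<Rightarrow> (real \<Rightarrow> complex) \<Rightarrow> complex \<Rightarrow> complex" where
  "phi_fun l v z = monodromy l v z $ 1 $ 0"

definition periodic_C2 :: "real \<Rightarrow> (real \<Rightarrow> complex) \<Rightarrow> bool" where
  "periodic_C2 l u \<longleftrightarrow> (\<forall>x. u (x + l) = u x) \<and>
     (\<exists>u' u''. (\<forall>x. (u has_vector_derivative u' x) (at x) \<and>
                     (u' has_vector_derivative u'' x) (at x)) \<and> continuous_on UNIV u'')"

definition n_gap :: "real \<Rightarrow> nat \<Rightarrow> (real \<Rightarrow> complex) \<Rightarrow> bool" where
  "n_gap l n v \<longleftrightarrow> periodic_C2 l v \<and>
     (\<exists>h f0 psi0 phi0. h holomorphic_on UNIV \<and> lead_coeff f0 = 1 \<and> degree f0 = n + 1 \<and>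
        (\<forall>z. f_fun l v z = poly f0 z * h z \<and> psi_fun l v z = poly psi0 z * h z \<and>
             phi_fun l v z = poly phi0 z * h z))"

definition nls_solution :: "real \<Rightarrow> (real \<Rightarrow> complex) \<Rightarrow> (real \<Rightarrow> real \<Rightarrow> complex) \<Rightarrow> bool" where
  "nls_solution l u v \<longleftrightarrow>
     (\<forall>x t. v (x + l) t = v x t) \<and> (\<forall>x. v x 0 = u x) \<and>
     (\<exists>vx vxx vt.
        (\<forall>x t. ((\<lambda>y. v y t) has_vector_derivative vx x t) (at x) \<and>
               ((\<lambda>y. vx y t) has_vector_derivative vxx x t) (at x) \<and>
               ((\<lambda>s. v x s) has_vector_derivative vt x t) (at t) \<and>
               \<i> * vt x t + vxx x t + 2 * (of_real (cmod (v x t)))\<^sup>2 * v x t = 0) \<and>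
        continuous_on UNIV (\<lambda>(x, t). v x t) \<and>
        continuous_on UNIV (\<lambda>(x, t). vx x t) \<and>
        continuous_on UNIV (\<lambda>(x, t). vxx x t) \<and>
        continuous_on UNIV (\<lambda>(x, t). vt x t))"

end

theory Submission
  imports Defs "HOL-Complex_Analysis.Complex_Analysis"
begin

text \<open>With \<open>Y\<close> the fundamental solution and \<open>P\<close> the polynomial part of the traceless monodromy matrix,
  \<open>L = Y P Y\<^sup>-\<^sup>1\<close> solves the Lax equation \<open>L' = [U, L]\<close> in \<open>x\<close>. It is entire in \<open>z\<close>, and since
  \<open>h L\<close> is the traceless monodromy matrix with base point \<open>x\<close>, comparison with the large-\<open>z\<close>
  asymptotics on expanding squares and Liouville's theorem show that \<open>L\<close> is polynomial in \<open>z\<close>. The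
  potential is one of its coefficients, so the \<open>x\<close>-evolution of the potential is a finite system of
  ordinary differential equations with a polynomial right-hand side.

  The Lax equation \<open>L_t = [V, L]\<close> in the time variable is a second such system. It has a global
  solution because \<open>- det L\<close> is conserved, which for real \<open>z\<close> is a sum of squares. The two vector fields commute, hence
  the solution with the given initial \<open>L\<close> satisfies both equations, and the zero-curvature equation
  read off its coefficients is the nonlinear Schroedinger equation. The monodromy matrix evolves by
  conjugation with the same matrices as \<open>L\<close>, so the common factor \<open>h\<close> does not change.
  Uniqueness is a Gronwall estimate for the \<open>L\<^sup>2\<close> norm of the difference of two solutions.\<close>

section \<open>Ordinary differential equations in Banach spaces\<close>

text \<open>The factor \<open>h\<close> may have zeros, so \<open>L\<close> is never obtained by
  dividing the monodromy matrix by \<open>h\<close>. It is built from the polynomials, and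
  \<open>h\<close> leaves the growth estimate through multiplication by \<open>f = f0 h\<close>.
  This requires a lower bound for \<open>f\<close>, available on squares of half-side (k + 1/2) pi /
  l, where |f| is comparable to exp(|Im z| l).

  The potential has only two derivatives, so the Lax equation is not expanded into differential
  polynomials of \<open>u\<close>; the coefficients of \<open>L\<close> are the unknowns instead.

  The x-equation is at first known only at time 0. Carrying it along the time flow amounts to
  differentiating that flow with respect to its initial value. For fields with a uniform quadratic
  remainder this follows from Gronwall estimates alone. The same lemma, applied to the state
  enlarged by a column of the linear problem, gives the evolution of the monodromy matrix.\<close>

lemma antiderivative_exists:
  fixes f :: "real \<Rightarrow> 'a::banach"
  assumes "continuous_on UNIV f"
  shows "\<exists>F. F 0 = 0 \<and> (\<forall>t. (F has_vector_derivative f t) (at t))"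
proof -
  define F where "F t = (if t \<ge> 0 then integral {0..t} f else - integral {t..0} f)" for t
  have int: "f integrable_on {a..b}" for a b :: real
    by (rule integrable_continuous_real) (rule continuous_on_subset[OF assms], simp)
  have "(F has_vector_derivative f t) (at t)" for t
  proof -
    define c where "c = \<bar>t\<bar> + 1"
    have F: "F s = integral {-c..s} f - integral {-c..0} f" if "s \<in> {-c<..<c}" for s
    proof (cases "s \<ge> 0")
      case True
      then have "integral {-c..0} f + integral {0..s} f = integral {-c..s} f"
        using that by (intro Henstock_Kurzweil_Integration.integral_combine int) (auto simp: c_def)
      then show ?thesis using True by (simp add: F_def algebra_simps)
    next
      case False
      then have "integral {-c..s} f + integral {s..0} f = integral {-c..0} f"
        using that by (intro Henstock_Kurzweil_Integration.integral_combine int) (auto simp: c_def)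
      then show ?thesis using False by (simp add: F_def algebra_simps)
    qed
    have t: "t \<in> {-c<..<c}" by (auto simp: c_def)
    have "((\<lambda>u. integral {-c..u} f) has_vector_derivative f t) (at t within {-c..c})"
      using t by (intro integral_has_vector_derivative continuous_on_subset[OF assms]) auto
    then have "((\<lambda>u. integral {-c..u} f) has_vector_derivative f t) (at t)"
      using t by (simp add: at_within_Icc_at)
    then have "((\<lambda>u. integral {-c..u} f - integral {-c..0} f) has_vector_derivative f t) (at t)"
      by (auto intro!: derivative_eq_intros)
    then show ?thesis
      by (rule has_vector_derivative_transform_within_open[OF _ _ t]) (use F in auto)
  qed
  then show ?thesis by (intro exI[of _ F]) (simp add: F_def)
qed

lemma has_vector_derivative_reflect:
  assumes "(w has_vector_derivative w') (at (- s))"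
  shows "((\<lambda>s. w (- s)) has_vector_derivative - w') (at s)"
proof -
  have "(uminus has_vector_derivative - 1) (at s)"
    by (auto intro!: derivative_eq_intros)
  from vector_diff_chain_at[OF this assms] show ?thesis by (simp add: o_def)
qed

lemma vector_derivative_bound_nonneg:
  fixes w :: "real \<Rightarrow> 'a::real_normed_vector" and \<phi> :: "real \<Rightarrow> real"
  assumes "0 \<le> t"
    and "\<And>s. 0 \<le> s \<Longrightarrow> s \<le> t \<Longrightarrow> (w has_vector_derivative w' s) (at s)"
    and "\<And>s. 0 \<le> s \<Longrightarrow> s \<le> t \<Longrightarrow> (\<phi> has_real_derivative \<phi>' s) (at s)"
    and "\<And>s. 0 \<le> s \<Longrightarrow> s \<le> t \<Longrightarrow> norm (w' s) \<le> \<phi>' s"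
  shows "norm (w t - w 0) \<le> \<phi> t - \<phi> 0"
proof (cases "t = 0")
  case False
  show ?thesis
  proof (rule differentiable_bound_general[where f' = w' and \<phi>' = \<phi>'])
    show "continuous_on {0..t} w"
      using assms(2) has_vector_derivative_continuous continuous_at_imp_continuous_on
      by (metis atLeastAtMost_iff)
    show "continuous_on {0..t} \<phi>"
      using assms(3) by (meson DERIV_isCont atLeastAtMost_iff continuous_at_imp_continuous_on)
  qed (use assms False in \<open>auto simp: has_real_derivative_iff_has_vector_derivative\<close>)
qed simp

lemma vector_derivative_bound_abs:
  fixes w :: "real \<Rightarrow> 'a::real_normed_vector" and \<phi> :: "real \<Rightarrow> real"
  assumes t: "\<bar>t\<bar> \<le> T"
    and w: "\<And>s. \<bar>s\<bar> \<le> T \<Longrightarrow> (w has_vector_derivative w' s) (at s)"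
    and \<phi>: "\<And>s. 0 \<le> s \<Longrightarrow> s \<le> T \<Longrightarrow> (\<phi> has_real_derivative \<phi>' s) (at s)"
    and b: "\<And>s. \<bar>s\<bar> \<le> T \<Longrightarrow> norm (w' s) \<le> \<phi>' \<bar>s\<bar>"
  shows "norm (w t - w 0) \<le> \<phi> \<bar>t\<bar> - \<phi> 0"
proof (cases "t \<ge> 0")
  case True
  have "norm (w t - w 0) \<le> \<phi> t - \<phi> 0"
  proof (rule vector_derivative_bound_nonneg[OF True, where w' = w' and \<phi>' = \<phi>'])
    fix s assume s: "0 \<le> s" "s \<le> t"
    then have s': "\<bar>s\<bar> \<le> T" "0 \<le> s" "s \<le> T" using t by auto
    show "(w has_vector_derivative w' s) (at s)" "(\<phi> has_real_derivative \<phi>' s) (at s)"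
      using w \<phi> s' by blast+
    show "norm (w' s) \<le> \<phi>' s" using b[OF s'(1)] s by simp
  qed
  then show ?thesis using True by simp
next
  case False
  have "norm (w (- \<bar>t\<bar>) - w (- 0)) \<le> \<phi> \<bar>t\<bar> - \<phi> 0"
  proof (rule vector_derivative_bound_nonneg[where w = "\<lambda>s. w (- s)" and w' = "\<lambda>s. - w' (- s)" and \<phi>' = \<phi>'])
    fix s assume s: "0 \<le> s" "s \<le> \<bar>t\<bar>"
    show "((\<lambda>s. w (- s)) has_vector_derivative - w' (- s)) (at s)"
      by (rule has_vector_derivative_reflect) (use s t in \<open>auto intro!: w\<close>)
    show "(\<phi> has_real_derivative \<phi>' s) (at s)" using s t by (intro \<phi>) auto
    show "norm (- w' (- s)) \<le> \<phi>' s" using b[of "- s"] s t by auto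
  qed auto
  then show ?thesis using False by simp
qed

text \<open>Let m be the maximum of the norm weighted by exp(-2K|s|). Integrating the hypothesis
  against this weight gives m <= X + m/2 with X = norm (e 0) + c T, hence m <= 2X. The doubled
  exponent and the factor 2 pay for this absorption.\<close>

lemma gronwall:
  fixes e :: "real \<Rightarrow> 'a::real_normed_vector"
  assumes K: "K > 0" and c: "c \<ge> 0" and t: "\<bar>t\<bar> \<le> T"
    and e: "\<And>s. \<bar>s\<bar> \<le> T \<Longrightarrow> (e has_vector_derivative e' s) (at s)"
    and b: "\<And>s. \<bar>s\<bar> \<le> T \<Longrightarrow> norm (e' s) \<le> K * norm (e s) + c"
  shows "norm (e t) \<le> 2 * (norm (e 0) + c * T) * exp (2 * K * T)"
proof -
  have T: "T \<ge> 0" using t by auto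
  define g where "g s = norm (e s) * exp (- (2 * K * \<bar>s\<bar>))" for s
  have "continuous_on {-T..T} e"
    using e has_vector_derivative_continuous continuous_at_imp_continuous_on
    by (metis abs_le_iff atLeastAtMost_iff minus_le_iff)
  then have "continuous_on {-T..T} g"
    unfolding g_def by (intro continuous_intros)
  then obtain s0 where s0: "s0 \<in> {-T..T}" "\<And>s. s \<in> {-T..T} \<Longrightarrow> g s \<le> g s0"
    using continuous_attains_sup[of "{-T..T}" g] T by auto
  define m where "m = g s0"
  have m: "norm (e s) \<le> m * exp (2 * K * \<bar>s\<bar>)" if "\<bar>s\<bar> \<le> T" for s
  proof -
    have "g s \<le> m" unfolding m_def using that by (intro s0) auto
    then show ?thesis by (simp add: g_def exp_minus field_simps)
  qed
  have m0: "m \<ge> 0" by (simp add: m_def g_def)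
  have *: "norm (e t) \<le> norm (e 0) + m / 2 * exp (2 * K * \<bar>t\<bar>) + c * T" if t: "\<bar>t\<bar> \<le> T" for t
  proof -
    define \<phi> where "\<phi> s = m / 2 * exp (2 * K * s) + c * s" for s
    have "norm (e t - e 0) \<le> \<phi> \<bar>t\<bar> - \<phi> 0"
    proof (rule vector_derivative_bound_abs[OF t e, where \<phi>' = "\<lambda>s. K * (m * exp (2 * K * s)) + c"])
      show "(\<phi> has_real_derivative K * (m * exp (2 * K * s)) + c) (at s)" for s
        unfolding \<phi>_def by (auto intro!: derivative_eq_intros)
      fix s assume s: "\<bar>s\<bar> \<le> T"
      have "norm (e' s) \<le> K * norm (e s) + c" by (rule b[OF s])
      also have "\<dots> \<le> K * (m * exp (2 * K * \<bar>s\<bar>)) + c"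
        using m[OF s] K by (intro add_right_mono mult_left_mono) auto
      finally show "norm (e' s) \<le> K * (m * exp (2 * K * \<bar>s\<bar>)) + c" .
    qed auto
    moreover have "\<phi> \<bar>t\<bar> \<le> m / 2 * exp (2 * K * \<bar>t\<bar>) + c * T"
      unfolding \<phi>_def using c t by (simp add: mult_left_mono)
    moreover have "\<phi> 0 \<ge> 0" using m0 by (simp add: \<phi>_def)
    ultimately show ?thesis using norm_triangle_sub[of "e t" "e 0"] by linarith
  qed
  define X where "X = norm (e 0) + c * T"
  have X0: "X \<ge> 0" using c T by (simp add: X_def)
  have "m \<le> X + m / 2"
  proof -
    have le: "exp (- (2 * K * \<bar>s0\<bar>)) \<le> 1" using K by simp
    have "m = norm (e s0) * exp (- (2 * K * \<bar>s0\<bar>))" by (simp add: m_def g_def)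
    also have "\<dots> \<le> (X + m / 2 * exp (2 * K * \<bar>s0\<bar>)) * exp (- (2 * K * \<bar>s0\<bar>))"
      using *[of s0] s0(1) by (intro mult_right_mono) (auto simp: X_def algebra_simps abs_le_iff)
    also have "\<dots> = X * exp (- (2 * K * \<bar>s0\<bar>)) + m / 2"
      by (simp add: exp_minus field_simps)
    also have "\<dots> \<le> X + m / 2" using mult_left_mono[OF le X0] by simp
    finally show ?thesis .
  qed
  then have "m \<le> 2 * X" by simp
  have "norm (e t) \<le> m * exp (2 * K * \<bar>t\<bar>)" by (rule m[OF t])
  also have "\<dots> \<le> 2 * X * exp (2 * K * T)"
    using \<open>m \<le> 2 * X\<close> m0 t K by (intro mult_mono) auto
  finally show ?thesis by (simp add: X_def)
qed

lemma geometric_limit: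
  fixes a :: "nat \<Rightarrow> 'a::banach"
  assumes "\<And>k. norm (a (Suc k) - a k) \<le> C / 2 ^ k"
  shows "a \<longlonglongrightarrow> lim a" and "norm (a k - lim a) \<le> 2 * C / 2 ^ k"
proof -
  have C: "C \<ge> 0" using order_trans[OF norm_ge_zero assms[of 0]] by simp
  \<comment> \<open>The partial sum of the geometric series is kept exactly, since the bound 2C/2^k
    alone is not inductive in \<open>d\<close>.\<close>
  have *: "norm (a (k + d) - a k) \<le> 2 * C / 2 ^ k - 2 * C / 2 ^ (k + d)" for k d
  proof (induction d)
    case (Suc d)
    have "norm (a (k + Suc d) - a k) \<le> norm (a (Suc (k + d)) - a (k + d)) + norm (a (k + d) - a k)"
      using norm_triangle_ineq[of "a (Suc (k + d)) - a (k + d)" "a (k + d) - a k"] by simp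
    also have "\<dots> \<le> C / 2 ^ (k + d) + (2 * C / 2 ^ k - 2 * C / 2 ^ (k + d))"
      by (intro add_mono assms Suc.IH)
    finally show ?case by (simp add: field_simps)
  qed simp
  have bd: "norm (a n - a k) \<le> 2 * C / 2 ^ k" if "k \<le> n" for k n
  proof -
    have "0 \<le> 2 * C / 2 ^ n" using C by simp
    then show ?thesis using *[of k "n - k"] that by simp
  qed
  have lim0: "(\<lambda>k. 2 * C / 2 ^ k) \<longlonglongrightarrow> 0" by real_asymp
  have "Cauchy a"
  proof (rule CauchyI')
    fix e :: real assume "e > 0"
    with lim0 have "eventually (\<lambda>k. 2 * C / 2 ^ k < e) sequentially"
      by (rule order_tendstoD)
    then obtain M where M: "\<And>k. k \<ge> M \<Longrightarrow> 2 * C / 2 ^ k < e"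
      by (auto simp: eventually_sequentially)
    show "\<exists>M. \<forall>m\<ge>M. \<forall>n>m. dist (a m) (a n) < e"
    proof (intro exI allI impI)
      fix m n assume "M \<le> m" "m < n"
      then have "norm (a n - a m) < e" using bd[of m n] M[of m] by linarith
      then show "dist (a m) (a n) < e" by (simp add: dist_norm norm_minus_commute)
    qed
  qed
  then show 1: "a \<longlonglongrightarrow> lim a"
    using Cauchy_convergent convergent_LIMSEQ_iff by blast
  have "(\<lambda>n. norm (a n - a k)) \<longlonglongrightarrow> norm (lim a - a k)"
    by (intro tendsto_intros 1)
  then have "norm (lim a - a k) \<le> 2 * C / 2 ^ k"
    by (rule tendsto_upperbound) (auto simp: eventually_sequentially intro!: exI[of _ k] bd)
  then show "norm (a k - lim a) \<le> 2 * C / 2 ^ k" by (simp add: norm_minus_commute)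
qed

text \<open>The Lipschitz constant may grow with \<open>T\<close> but is valid for all states, so
  the iterates converge on every interval [-T, T] and no local solutions have to be continued.
  Continuity is asked for along curves, the form in which the iteration uses it.\<close>

lemma picard_global:
  fixes G :: "real \<Rightarrow> 'a::banach \<Rightarrow> 'a"
  assumes cont: "\<And>y. continuous_on UNIV y \<Longrightarrow> continuous_on UNIV (\<lambda>t. G t (y t))"
    and lip: "\<And>T. \<exists>K. \<forall>t x y. \<bar>t\<bar> \<le> T \<longrightarrow> norm (G t x - G t y) \<le> K * norm (x - y)"
  shows "\<exists>y. y 0 = y0 \<and> (\<forall>t. (y has_vector_derivative G t (y t)) (at t))"
proof -
  define I where "I f = (SOME F. F 0 = 0 \<and> (\<forall>t. (F has_vector_derivative f t) (at t)))"
    for f :: "real \<Rightarrow> 'a"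
  have I: "I f 0 = 0" "(I f has_vector_derivative f t) (at t)" if "continuous_on UNIV f" for f t
    using someI_ex[OF antiderivative_exists[OF that]] by (auto simp: I_def)
  define Y where "Y = rec_nat (\<lambda>_. y0) (\<lambda>_ p t. y0 + I (\<lambda>s. G s (p s)) t)"
  have Y0: "Y 0 = (\<lambda>_. y0)" and YS: "Y (Suc k) = (\<lambda>t. y0 + I (\<lambda>s. G s (Y k s)) t)" for k
    by (auto simp: Y_def)
  have Yc: "continuous_on UNIV (Y k)" for k
  proof (induction k)
    case (Suc k)
    have "(Y (Suc k) has_vector_derivative G t (Y k t)) (at t)" for t
      unfolding YS by (auto intro!: derivative_eq_intros I cont Suc)
    then show ?case
      by (meson continuous_at_imp_continuous_on has_vector_derivative_continuous)
  qed (simp add: Y0)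
  have Yd: "(Y (Suc k) has_vector_derivative G t (Y k t)) (at t)" for k t
    unfolding YS by (auto intro!: derivative_eq_intros I cont Yc)
  have Yi: "Y k 0 = y0" for k
    by (cases k) (auto simp: Y0 YS I(1)[OF cont[OF Yc]])
  define y where "y t = lim (\<lambda>k. Y k t)" for t
  have main: "(y has_vector_derivative G t (y t)) (at t)" for t
  proof -
    define T where "T = \<bar>t\<bar> + 1"
    obtain K0 where K0: "\<And>t x y. \<bar>t\<bar> \<le> T \<Longrightarrow> norm (G t x - G t y) \<le> K0 * norm (x - y)"
      using lip[of T] by blast
    define K where "K = max K0 1"
    have K: "norm (G t x - G t y) \<le> K * norm (x - y)" if "\<bar>t\<bar> \<le> T" for t x y
      using K0[OF that] by (rule order_trans) (auto simp: K_def intro!: mult_right_mono)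
    have Kp: "K > 0" by (simp add: K_def)
    have "compact ((\<lambda>s. Y 1 s - Y 0 s) ` {-T..T})"
      by (intro compact_continuous_image continuous_intros continuous_on_subset[OF Yc]) auto
    then obtain M where "M > 0" and M': "\<forall>x\<in>(\<lambda>s. Y 1 s - Y 0 s) ` {-T..T}. norm x \<le> M"
      using compact_imp_bounded bounded_pos by metis
    have M: "norm (Y 1 s - Y 0 s) \<le> M" if "\<bar>s\<bar> \<le> T" for s
      using M' that by (auto simp: abs_le_iff)
    \<comment> \<open>Relative to the weight exp(2K|s|) one iteration halves the increment, whatever
      the length of the interval.\<close>
    have step: "norm (Y (Suc k) s - Y k s) \<le> M / 2 ^ k * exp (2 * K * \<bar>s\<bar>)" if "\<bar>s\<bar> \<le> T" for k s
      using that
    proof (induction k arbitrary: s)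
      case 0
      have "norm (Y 1 s - Y 0 s) \<le> M * 1" using M[OF 0] by simp
      also have "\<dots> \<le> M * exp (2 * K * \<bar>s\<bar>)" using Kp \<open>M > 0\<close> by (intro mult_left_mono) auto
      finally show ?case by simp
    next
      case (Suc k)
      define w where "w s = Y (Suc (Suc k)) s - Y (Suc k) s" for s
      define \<phi> where "\<phi> s = M / 2 ^ k / 2 * exp (2 * K * s)" for s
      have "norm (w s - w 0) \<le> \<phi> \<bar>s\<bar> - \<phi> 0"
      proof (rule vector_derivative_bound_abs[OF Suc.prems, where \<phi>' = "\<lambda>s. K * (M / 2 ^ k * exp (2 * K * s))"])
        show "(w has_vector_derivative G s (Y (Suc k) s) - G s (Y k s)) (at s)" for s
          unfolding w_def by (intro derivative_intros Yd)
        show "(\<phi> has_real_derivative K * (M / 2 ^ k * exp (2 * K * s))) (at s)" for s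
          unfolding \<phi>_def by (auto intro!: derivative_eq_intros)
        fix s assume s: "\<bar>s\<bar> \<le> T"
        have "norm (G s (Y (Suc k) s) - G s (Y k s)) \<le> K * norm (Y (Suc k) s - Y k s)"
          by (rule K[OF s])
        also have "\<dots> \<le> K * (M / 2 ^ k * exp (2 * K * \<bar>s\<bar>))"
          using Suc.IH[OF s] Kp by (intro mult_left_mono) auto
        finally show "norm (G s (Y (Suc k) s) - G s (Y k s)) \<le> K * (M / 2 ^ k * exp (2 * K * \<bar>s\<bar>))" .
      qed
      moreover have "w 0 = 0" by (simp add: w_def Yi)
      moreover have "\<phi> 0 \<ge> 0" using \<open>M > 0\<close> by (simp add: \<phi>_def)
      ultimately have "norm (w s) \<le> \<phi> \<bar>s\<bar>" by simp
      then show ?case by (simp add: w_def \<phi>_def field_simps)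
    qed
    define C where "C = M * exp (2 * K * T)"
    have step': "norm (Y (Suc k) s - Y k s) \<le> C / 2 ^ k" if "\<bar>s\<bar> \<le> T" for k s
    proof -
      have "norm (Y (Suc k) s - Y k s) \<le> M / 2 ^ k * exp (2 * K * \<bar>s\<bar>)" by (rule step[OF that])
      also have "\<dots> \<le> M / 2 ^ k * exp (2 * K * T)"
        using that Kp \<open>M > 0\<close> by (intro mult_left_mono) auto
      finally show ?thesis by (simp add: C_def)
    qed
    have lim: "(\<lambda>k. Y k s) \<longlonglongrightarrow> y s" and err: "norm (Y k s - y s) \<le> 2 * C / 2 ^ k"
      if "\<bar>s\<bar> \<le> T" for k s
      using geometric_limit[OF step'[OF that]] by (auto simp: y_def)
    have l0: "(\<lambda>n. K * (2 * C / 2 ^ n)) \<longlonglongrightarrow> 0" by real_asymp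
    \<comment> \<open>The limit is taken in the derivatives: those of the iterates converge
      uniformly on [-T, T], so the limit is differentiable with the desired derivative. Afterwards
      \<open>g\<close> is recognised as \<open>y\<close>.\<close>
    have "\<exists>g. \<forall>x\<in>{-T..T}. (\<lambda>n. Y (Suc n) x) \<longlonglongrightarrow> g x \<and>
            (g has_derivative (\<lambda>h. h *\<^sub>R G x (y x))) (at x within {-T..T})"
    proof (rule has_derivative_sequence[where f' = "\<lambda>n x h. h *\<^sub>R G x (Y n x)"])
      show "(Y (Suc n) has_derivative (\<lambda>h. h *\<^sub>R G x (Y n x))) (at x within {-T..T})" for n x
        by (rule has_derivative_at_withinI[OF Yd[unfolded has_vector_derivative_def]])
      fix e :: real assume "e > 0"
      with l0 have "eventually (\<lambda>n. K * (2 * C / 2 ^ n) < e) sequentially"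
        by (rule order_tendstoD)
      then show "\<forall>\<^sub>F n in sequentially. \<forall>x\<in>{-T..T}. \<forall>h. norm (h *\<^sub>R G x (Y n x) - h *\<^sub>R G x (y x)) \<le> e * norm h"
      proof eventually_elim
        case (elim n)
        show ?case
        proof (intro ballI allI)
          fix x h assume "x \<in> {-T..T}"
          then have x: "\<bar>x\<bar> \<le> T" by auto
          have "norm (G x (Y n x) - G x (y x)) \<le> K * norm (Y n x - y x)" by (rule K[OF x])
          also have "\<dots> \<le> K * (2 * C / 2 ^ n)" using err[OF x] Kp by (intro mult_left_mono) auto
          also have "\<dots> \<le> e" using elim by simp
          finally have "norm (G x (Y n x) - G x (y x)) * \<bar>h\<bar> \<le> e * \<bar>h\<bar>"
            by (intro mult_right_mono) auto
          then show "norm (h *\<^sub>R G x (Y n x) - h *\<^sub>R G x (y x)) \<le> e * norm h"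
            by (simp flip: scaleR_diff_right add: mult.commute)
        qed
      qed
    next
      show "0 \<in> {-T..T}" by (auto simp: T_def)
      show "(\<lambda>n. Y (Suc n) 0) \<longlonglongrightarrow> y0" by (simp add: Yi)
    qed simp
    then obtain g where g': "\<forall>x\<in>{-T..T}. (\<lambda>n. Y (Suc n) x) \<longlonglongrightarrow> g x \<and>
        (g has_derivative (\<lambda>h. h *\<^sub>R G x (y x))) (at x within {-T..T})" by blast
    then have g: "(\<lambda>n. Y (Suc n) x) \<longlonglongrightarrow> g x"
      "(g has_derivative (\<lambda>h. h *\<^sub>R G x (y x))) (at x within {-T..T})" if "\<bar>x\<bar> \<le> T" for x
      using that by (auto simp: abs_le_iff)
    have gy: "g x = y x" if "\<bar>x\<bar> \<le> T" for x
      using LIMSEQ_unique[OF g(1)[OF that] LIMSEQ_Suc[OF lim[OF that]]] .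
    have "(g has_vector_derivative G t (y t)) (at t)"
      using g(2)[of t] at_within_Icc_at[of "-T" t T] by (auto simp: has_vector_derivative_def T_def)
    then show ?thesis
      by (rule has_vector_derivative_transform_within_open[where S = "{-T<..<T}"])
        (auto simp: T_def intro!: gy)
  qed
  have "y 0 = y0" by (simp add: y_def Yi)
  with main show ?thesis by blast
qed

text \<open>The Lipschitz bound concerns only the two given curves, so the lemma also applies to a
  field that is merely locally Lipschitz, once both curves are known to stay in a ball.\<close>

lemma lipschitz_ode_unique:
  fixes G :: "real \<Rightarrow> 'a::real_normed_vector \<Rightarrow> 'a"
  assumes lip: "\<And>T. \<exists>K. \<forall>t. \<bar>t\<bar> \<le> T \<longrightarrow> norm (G t (x t) - G t (y t)) \<le> K * norm (x t - y t)"
    and x: "\<And>t. (x has_vector_derivative G t (x t)) (at t)"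
    and y: "\<And>t. (y has_vector_derivative G t (y t)) (at t)"
    and "x 0 = y 0"
  shows "x t = y t"
proof -
  obtain K where K: "\<And>s. \<bar>s\<bar> \<le> \<bar>t\<bar> \<Longrightarrow> norm (G s (x s) - G s (y s)) \<le> K * norm (x s - y s)"
    using lip[of "\<bar>t\<bar>"] by blast
  have "norm (x t - y t) \<le> 2 * (norm (x 0 - y 0) + 0 * \<bar>t\<bar>) * exp (2 * max K 1 * \<bar>t\<bar>)"
  proof (rule gronwall[where e' = "\<lambda>s. G s (x s) - G s (y s)"])
    fix s assume s: "\<bar>s\<bar> \<le> \<bar>t\<bar>"
    show "((\<lambda>t. x t - y t) has_vector_derivative G s (x s) - G s (y s)) (at s)"
      by (intro derivative_intros x y)
    have "K * norm (x s - y s) \<le> max K 1 * norm (x s - y s)" by (intro mult_right_mono) auto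
    then show "norm (G s (x s) - G s (y s)) \<le> max K 1 * norm (x s - y s) + 0"
      using K[OF s] by linarith
  qed auto
  then show ?thesis using assms(4) by simp
qed

section \<open>The linear systems\<close>

text \<open>One column of Y' = W Y for the traceless W = ((a, b), (c, - a)). Vanishing trace makes
  the Wronskian constant and lets the adjugate replace the inverse below.\<close>

definition sol2 :: "(real \<Rightarrow> complex) \<Rightarrow> (real \<Rightarrow> complex) \<Rightarrow> (real \<Rightarrow> complex) \<Rightarrow>
    (real \<Rightarrow> complex) \<Rightarrow> (real \<Rightarrow> complex) \<Rightarrow> bool" where
  "sol2 a b c p q \<longleftrightarrow> (\<forall>t. (p has_vector_derivative a t * p t + b t * q t) (at t) \<and>
     (q has_vector_derivative c t * p t - a t * q t) (at t))"

text \<open>The Lax equation \<open>L' = [W, L]\<close> with \<open>W = ((a, b), (c, - a))\<close> and \<open>L = ((i f, g), (h, - i f))\<close>.\<close>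

definition sol3 :: "(real \<Rightarrow> complex) \<Rightarrow> (real \<Rightarrow> complex) \<Rightarrow> (real \<Rightarrow> complex) \<Rightarrow>
    (real \<Rightarrow> complex) \<Rightarrow> (real \<Rightarrow> complex) \<Rightarrow> (real \<Rightarrow> complex) \<Rightarrow> bool" where
  "sol3 a b c f g h \<longleftrightarrow> (\<forall>t. (f has_vector_derivative - \<i> * (b t * h t - c t * g t)) (at t) \<and>
     (g has_vector_derivative 2 * a t * g t - 2 * \<i> * b t * f t) (at t) \<and>
     (h has_vector_derivative 2 * \<i> * c t * f t - 2 * a t * h t) (at t))"

definition field2 :: "complex \<Rightarrow> complex \<Rightarrow> complex \<Rightarrow> complex \<times> complex \<Rightarrow> complex \<times> complex" where
  "field2 a b c y = (a * fst y + b * snd y, c * fst y - a * snd y)"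

lemma linear_field2: "linear (field2 a b c)"
  by (rule linearI) (auto simp: field2_def algebra_simps scaleR_conv_of_real)

lemma norm_Pair_sum: "norm (x, y) \<le> norm x + norm y"
  by (simp add: norm_Pair sqrt_sum_squares_le_sum)

lemma norm_field2:
  assumes "norm a \<le> M" "norm b \<le> M" "norm c \<le> M"
  shows "norm (field2 a b c y) \<le> 4 * M * norm y"
proof -
  have M: "M \<ge> 0" using assms(1) norm_ge_zero order_trans by blast
  have f: "norm (fst y) \<le> norm y" "norm (snd y) \<le> norm y"
    using norm_fst_le[of "fst y" "snd y"] norm_snd_le[of "snd y" "fst y"] by simp_all
  have "norm (d * e) \<le> M * norm y" if "norm d \<le> M" "norm e \<le> norm y" for d e :: complex
    unfolding norm_mult using that M by (intro mult_mono) auto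
  note this[OF _ f(1)] this[OF _ f(2)]
  note * = this(1)[OF assms(1)] this(2)[OF assms(2)] this(1)[OF assms(3)] this(2)[OF assms(1)]
  have "norm (field2 a b c y) \<le> norm (a * fst y + b * snd y) + norm (c * fst y - a * snd y)"
    unfolding field2_def by (rule norm_Pair_sum)
  also have "\<dots> \<le> norm (a * fst y) + norm (b * snd y) + (norm (c * fst y) + norm (a * snd y))"
    by (intro add_mono norm_triangle_ineq norm_triangle_ineq4)
  also have "\<dots> \<le> 4 * M * norm y" using * by linarith
  finally show ?thesis .
qed

lemma continuous_bounded_abs:
  fixes a :: "real \<Rightarrow> 'a::real_normed_vector"
  assumes "continuous_on UNIV a"
  shows "\<exists>M. \<forall>t. \<bar>t\<bar> \<le> T \<longrightarrow> norm (a t) \<le> M"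
proof -
  have "compact (a ` {-T..T})"
    by (intro compact_continuous_image continuous_on_subset[OF assms]) auto
  then obtain M where "\<forall>x\<in>a ` {-T..T}. norm x \<le> M"
    using compact_imp_bounded bounded_iff by metis
  then have "norm (a t) \<le> M" if "\<bar>t\<bar> \<le> T" for t using that by (auto simp: abs_le_iff)
  then show ?thesis by blast
qed

lemma continuous_bounded_abs3:
  fixes a b c :: "real \<Rightarrow> 'a::real_normed_vector"
  assumes "continuous_on UNIV a" "continuous_on UNIV b" "continuous_on UNIV c"
  obtains M where "M > 0" "\<And>t. \<bar>t\<bar> \<le> T \<Longrightarrow> norm (a t) \<le> M" "\<And>t. \<bar>t\<bar> \<le> T \<Longrightarrow> norm (b t) \<le> M"
    "\<And>t. \<bar>t\<bar> \<le> T \<Longrightarrow> norm (c t) \<le> M"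
proof -
  obtain A B C where "\<forall>t. \<bar>t\<bar> \<le> T \<longrightarrow> norm (a t) \<le> A" "\<forall>t. \<bar>t\<bar> \<le> T \<longrightarrow> norm (b t) \<le> B"
    "\<forall>t. \<bar>t\<bar> \<le> T \<longrightarrow> norm (c t) \<le> C"
    using continuous_bounded_abs[of a T] continuous_bounded_abs[of b T] continuous_bounded_abs[of c T] assms
    by blast
  then show ?thesis by (intro that[of "max 1 (max A (max B C))"]) (auto simp: le_max_iff_disj)
qed

lemma sol2_iff_field2:
  "sol2 a b c p q \<longleftrightarrow> (\<forall>t. ((\<lambda>t. (p t, q t)) has_vector_derivative field2 (a t) (b t) (c t) (p t, q t)) (at t))"
proof
  assume "sol2 a b c p q"
  then show "\<forall>t. ((\<lambda>t. (p t, q t)) has_vector_derivative field2 (a t) (b t) (c t) (p t, q t)) (at t)"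
    by (auto simp: sol2_def field2_def intro!: has_vector_derivative_Pair)
next
  assume *: "\<forall>t. ((\<lambda>t. (p t, q t)) has_vector_derivative field2 (a t) (b t) (c t) (p t, q t)) (at t)"
  then show "sol2 a b c p q"
    using bounded_linear.has_vector_derivative[OF bounded_linear_fst *[rule_format]]
      bounded_linear.has_vector_derivative[OF bounded_linear_snd *[rule_format]]
    by (auto simp: sol2_def field2_def)
qed

text \<open>The forcing terms serve the equation for the derivative of a solution with respect to
  the spectral parameter.\<close>

lemma sol2_forced_exists:
  fixes a b c r s :: "real \<Rightarrow> complex"
  assumes "continuous_on UNIV a" "continuous_on UNIV b" "continuous_on UNIV c"
    "continuous_on UNIV r" "continuous_on UNIV s"
  shows "\<exists>p q. p 0 = p0 \<and> q 0 = q0 \<and> (\<forall>t. (p has_vector_derivative a t * p t + b t * q t + r t) (at t) \<and>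
     (q has_vector_derivative c t * p t - a t * q t + s t) (at t))"
proof -
  define G where "G t y = field2 (a t) (b t) (c t) y + (r t, s t)" for t and y :: "complex \<times> complex"
  have "\<exists>y. y 0 = (p0, q0) \<and> (\<forall>t. (y has_vector_derivative G t (y t)) (at t))"
  proof (rule picard_global)
    fix y :: "real \<Rightarrow> complex \<times> complex"
    assume "continuous_on UNIV y"
    then show "continuous_on UNIV (\<lambda>t. G t (y t))"
      unfolding G_def field2_def by (intro continuous_intros assms)
  next
    fix T :: real
    obtain M where "M > 0" and M: "\<And>t. \<bar>t\<bar> \<le> T \<Longrightarrow> norm (a t) \<le> M" "\<And>t. \<bar>t\<bar> \<le> T \<Longrightarrow> norm (b t) \<le> M"
      "\<And>t. \<bar>t\<bar> \<le> T \<Longrightarrow> norm (c t) \<le> M"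
      by (rule continuous_bounded_abs3[where T = T, OF assms(1-3)]) blast
    have "norm (G t x - G t y) \<le> 4 * M * norm (x - y)" if "\<bar>t\<bar> \<le> T" for t x y
      using norm_field2[OF M[OF that], of "x - y"] by (simp add: G_def linear_diff[OF linear_field2])
    then show "\<exists>K. \<forall>t x y. \<bar>t\<bar> \<le> T \<longrightarrow> norm (G t x - G t y) \<le> K * norm (x - y)" by blast
  qed
  then obtain y where y: "y 0 = (p0, q0)" "\<And>t. (y has_vector_derivative G t (y t)) (at t)" by blast
  show ?thesis
    using bounded_linear.has_vector_derivative[OF bounded_linear_fst y(2)]
      bounded_linear.has_vector_derivative[OF bounded_linear_snd y(2)] y(1)
    by (intro exI[of _ "\<lambda>t. fst (y t)"] exI[of _ "\<lambda>t. snd (y t)"]) (simp add: G_def field2_def)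
qed

lemma sol2_exists:
  assumes "continuous_on UNIV a" "continuous_on UNIV b" "continuous_on UNIV c"
  shows "\<exists>p q. sol2 a b c p q \<and> p 0 = p0 \<and> q 0 = q0"
  using sol2_forced_exists[OF assms continuous_on_const[of UNIV 0] continuous_on_const[of UNIV 0], of p0 q0]
  by (auto simp: sol2_def)

lemma sol2_unique:
  assumes "continuous_on UNIV a" "continuous_on UNIV b" "continuous_on UNIV c"
    and "sol2 a b c p q" "sol2 a b c p' q'" "p 0 = p' 0" "q 0 = q' 0"
  shows "p t = p' t" "q t = q' t"
proof -
  have "(p t, q t) = (p' t, q' t)"
  proof (rule lipschitz_ode_unique[where G = "\<lambda>t. field2 (a t) (b t) (c t)"])
    fix T :: real
    obtain M where "M > 0" and M: "\<And>t. \<bar>t\<bar> \<le> T \<Longrightarrow> norm (a t) \<le> M" "\<And>t. \<bar>t\<bar> \<le> T \<Longrightarrow> norm (b t) \<le> M"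
      "\<And>t. \<bar>t\<bar> \<le> T \<Longrightarrow> norm (c t) \<le> M"
      by (rule continuous_bounded_abs3[where T = T, OF assms(1-3)]) blast
    then show "\<exists>K. \<forall>t. \<bar>t\<bar> \<le> T \<longrightarrow> norm (field2 (a t) (b t) (c t) (p t, q t) - field2 (a t) (b t) (c t) (p' t, q' t))
        \<le> K * norm ((p t, q t) - (p' t, q' t))"
      by (intro exI[of _ "4 * M"]) (auto simp: linear_diff[OF linear_field2, symmetric] simp del: diff_Pair intro!: norm_field2)
  qed (use assms in \<open>auto simp: sol2_iff_field2\<close>)
  then show "p t = p' t" "q t = q' t" by auto
qed

lemma sol3_unique:
  assumes "continuous_on UNIV a" "continuous_on UNIV b" "continuous_on UNIV c"
    and s: "sol3 a b c f g h" "sol3 a b c f' g' h'" and "f 0 = f' 0" "g 0 = g' 0" "h 0 = h' 0"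
  shows "f t = f' t \<and> g t = g' t \<and> h t = h' t"
proof -
  define G where "G t y = (- \<i> * (b t * snd (snd y) - c t * fst (snd y)),
      2 * a t * fst (snd y) - 2 * \<i> * b t * fst y, 2 * \<i> * c t * fst y - 2 * a t * snd (snd y))" for t and y :: "complex \<times> complex \<times> complex"
  have "(f t, g t, h t) = (f' t, g' t, h' t)"
  proof (rule lipschitz_ode_unique[where G = G])
    fix T :: real
    obtain M where "M > 0" and M: "\<And>t. \<bar>t\<bar> \<le> T \<Longrightarrow> norm (a t) \<le> M" "\<And>t. \<bar>t\<bar> \<le> T \<Longrightarrow> norm (b t) \<le> M"
      "\<And>t. \<bar>t\<bar> \<le> T \<Longrightarrow> norm (c t) \<le> M"
      by (rule continuous_bounded_abs3[where T = T, OF assms(1-3)]) blast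
    have bnd: "norm (G t y) \<le> 10 * M * norm y" if "\<bar>t\<bar> \<le> T" for t y
    proof -
      have f: "norm (fst y) \<le> norm y" "norm (fst (snd y)) \<le> norm y" "norm (snd (snd y)) \<le> norm y"
        using norm_fst_le[of "fst y" "snd y"] norm_snd_le[of "snd y" "fst y"]
          norm_fst_le[of "fst (snd y)" "snd (snd y)"] norm_snd_le[of "snd (snd y)" "fst (snd y)"] 
        by auto
      have "norm (d * e) \<le> M * norm y" if "norm d \<le> M" "norm e \<le> norm y" for d e :: complex
        unfolding norm_mult using that \<open>M > 0\<close> by (intro mult_mono) auto
      note * = this[OF M(1)[OF that]] this[OF M(2)[OF that]] this[OF M(3)[OF that]]
      have "norm (G t y) \<le> norm (- \<i> * (b t * snd (snd y) - c t * fst (snd y))) +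
        (norm (2 * a t * fst (snd y) - 2 * \<i> * b t * fst y) + norm (2 * \<i> * c t * fst y - 2 * a t * snd (snd y)))"
        unfolding G_def by (intro order_trans[OF norm_Pair_sum] add_left_mono norm_Pair_sum)
      also have "\<dots> \<le> (norm (b t * snd (snd y)) + norm (c t * fst (snd y))) +
        ((2 * norm (a t * fst (snd y)) + 2 * norm (b t * fst y)) + (2 * norm (c t * fst y) + 2 * norm (a t * snd (snd y))))"
      proof (intro add_mono)
        show "norm (- \<i> * (b t * snd (snd y) - c t * fst (snd y))) \<le> norm (b t * snd (snd y)) + norm (c t * fst (snd y))"
          using norm_triangle_ineq4[of "b t * snd (snd y)" "c t * fst (snd y)"] by (simp add: norm_mult)
        show "norm (2 * a t * fst (snd y) - 2 * \<i> * b t * fst y) \<le> 2 * norm (a t * fst (snd y)) + 2 * norm (b t * fst y)"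
          using norm_triangle_ineq4[of "2 * a t * fst (snd y)" "2 * \<i> * b t * fst y"] by (simp add: norm_mult)
        show "norm (2 * \<i> * c t * fst y - 2 * a t * snd (snd y)) \<le> 2 * norm (c t * fst y) + 2 * norm (a t * snd (snd y))"
          using norm_triangle_ineq4[of "2 * \<i> * c t * fst y" "2 * a t * snd (snd y)"] by (simp add: norm_mult)
      qed
      also have "\<dots> \<le> 10 * M * norm y"
        using *(1)[OF f(2)] *(1)[OF f(3)] *(2)[OF f(3)] *(2)[OF f(1)] *(3)[OF f(2)] *(3)[OF f(1)] by linarith
      finally show ?thesis .
    qed
    have lin: "G t x - G t y = G t (x - y)" for t x y
      by (auto simp: G_def algebra_simps)
    show "\<exists>K. \<forall>t. \<bar>t\<bar> \<le> T \<longrightarrow> norm (G t (f t, g t, h t) - G t (f' t, g' t, h' t))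
        \<le> K * norm ((f t, g t, h t) - (f' t, g' t, h' t))"
      unfolding lin using bnd by blast
  qed (use assms in \<open>auto simp: sol3_def G_def intro!: has_vector_derivative_Pair\<close>)
  then show ?thesis by auto
qed

lemma const_of_zero_vector_derivative:
  fixes w :: "real \<Rightarrow> 'a::real_normed_vector"
  assumes "\<And>t. (w has_vector_derivative 0) (at t)"
  shows "w t = w s"
proof -
  have "norm ((\<lambda>r. w (r + s)) (t - s) - (\<lambda>r. w (r + s)) 0) \<le> (\<lambda>_. 0) \<bar>t - s\<bar> - (\<lambda>_. 0) 0"
  proof (rule vector_derivative_bound_abs[where w' = "\<lambda>_. 0" and \<phi>' = "\<lambda>_. 0"])
    fix r
    have "((\<lambda>r. r + s) has_vector_derivative 1) (at r)" by (auto intro!: derivative_eq_intros)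
    from vector_diff_chain_at[OF this assms] show "((\<lambda>r. w (r + s)) has_vector_derivative 0) (at r)"
      by (simp add: o_def)
  qed auto
  then show ?thesis by simp
qed

lemma sol2_wronskian:
  assumes "sol2 a b c p q" "sol2 a b c p' q'"
  shows "p t * q' t - p' t * q t = p s * q' s - p' s * q s"
proof (rule const_of_zero_vector_derivative[of "\<lambda>t. p t * q' t - p' t * q t"])
  fix t
  show "((\<lambda>t. p t * q' t - p' t * q t) has_vector_derivative 0) (at t)"
    using assms unfolding sol2_def
    by (auto intro!: derivative_eq_intros simp: algebra_simps)
qed

text \<open>If (p, q) is a column for W, then (- cnj q, cnj p) is one for minus the conjugate
  transpose of W. For the Zakharov--Shabat matrix this operation only conjugates \<open>z\<close>,
  so it produces the second column of the fundamental matrix from the first.\<close>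

lemma sol2_adjoint:
  assumes "sol2 a b c p q"
  shows "sol2 (\<lambda>t. - cnj (a t)) (\<lambda>t. - cnj (c t)) (\<lambda>t. - cnj (b t)) (\<lambda>t. - cnj (q t)) (\<lambda>t. cnj (p t))"
proof -
  have p: "((\<lambda>t. cnj (p t)) has_vector_derivative cnj (a t * p t + b t * q t)) (at t)"
    and q: "((\<lambda>t. cnj (q t)) has_vector_derivative cnj (c t * p t - a t * q t)) (at t)" for t
    using assms unfolding sol2_def
    by (blast intro: bounded_linear.has_vector_derivative[OF bounded_linear_cnj])+
  show ?thesis unfolding sol2_def
    using p has_vector_derivative_minus[OF q] by (auto simp: algebra_simps)
qed

lemma sol2_combine:
  assumes "sol2 a b c p q" "sol2 a b c p' q'"
  shows "sol2 a b c (\<lambda>t. d * p t + e * p' t) (\<lambda>t. d * q t + e * q' t)"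
  using assms unfolding sol2_def
  by (auto intro!: derivative_eq_intros simp: algebra_simps)

text \<open>With \<open>Y = ((p, p'), (q, q'))\<close> and \<open>L = ((i f, g), (h, - i f))\<close>, these are the entries of
  \<open>Y L adj(Y)\<close>.\<close>

definition conjF :: "complex \<Rightarrow> complex \<Rightarrow> complex \<Rightarrow> complex \<Rightarrow> complex \<Rightarrow> complex \<Rightarrow> complex \<Rightarrow> complex" where
  "conjF p q p' q' f g h = f * (p * q' + p' * q) - \<i> * h * p' * q' + \<i> * g * p * q"
definition conjG :: "complex \<Rightarrow> complex \<Rightarrow> complex \<Rightarrow> complex \<Rightarrow> complex \<Rightarrow> complex \<Rightarrow> complex \<Rightarrow> complex" where
  "conjG p q p' q' f g h = - 2 * \<i> * f * p * p' - h * p' * p' + g * p * p"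
definition conjH :: "complex \<Rightarrow> complex \<Rightarrow> complex \<Rightarrow> complex \<Rightarrow> complex \<Rightarrow> complex \<Rightarrow> complex \<Rightarrow> complex" where
  "conjH p q p' q' f g h = 2 * \<i> * f * q * q' + h * q' * q' - g * q * q"

lemmas conj_defs = conjF_def conjG_def conjH_def

text \<open>For traceless W, adj(W Y) = - adj(Y) W. Hence Y L adj(Y) with constant L solves the Lax
  equation, for any value of det Y.\<close>

lemma sol3_conj:
  assumes "sol2 a b c p q" "sol2 a b c p' q'"
  shows "sol3 a b c (\<lambda>t. conjF (p t) (q t) (p' t) (q' t) f g h) (\<lambda>t. conjG (p t) (q t) (p' t) (q' t) f g h)
     (\<lambda>t. conjH (p t) (q t) (p' t) (q' t) f g h)"
  using assms unfolding sol2_def sol3_def conj_defs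
  by (auto intro!: derivative_eq_intros simp: algebra_simps)

lemma conj_scale:
  "conjF p q p' q' (k * f) (k * g) (k * h) = k * conjF p q p' q' f g h"
  "conjG p q p' q' (k * f) (k * g) (k * h) = k * conjG p q p' q' f g h"
  "conjH p q p' q' (k * f) (k * g) (k * h) = k * conjH p q p' q' f g h"
  by (simp_all add: conj_defs algebra_simps)

section \<open>The Zakharov--Shabat system\<close>

text \<open>The Dirac system solved for the derivative, that is, multiplied by the inverse - J of
  J.\<close>

definition zs :: "(real \<Rightarrow> complex) \<Rightarrow> complex \<Rightarrow> (real \<Rightarrow> complex) \<Rightarrow> (real \<Rightarrow> complex) \<Rightarrow> bool" where
  "zs u z = sol2 (\<lambda>_. - \<i> * z) (\<lambda>x. - u x) (\<lambda>x. cnj (u x))"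

definition y11 :: "(real \<Rightarrow> complex) \<Rightarrow> complex \<Rightarrow> real \<Rightarrow> complex" where
  "y11 u z = (SOME p. \<exists>q. zs u z p q \<and> p 0 = 1 \<and> q 0 = 0)"

definition y21 :: "(real \<Rightarrow> complex) \<Rightarrow> complex \<Rightarrow> real \<Rightarrow> complex" where
  "y21 u z = (SOME q. zs u z (y11 u z) q \<and> y11 u z 0 = 1 \<and> q 0 = 0)"

text \<open>Defining the second column by conjugating the first makes the reality symmetry of the
  fundamental matrix true by definition; that it solves the system is
  \<open>sol2_adjoint\<close>.\<close>

definition y12 :: "(real \<Rightarrow> complex) \<Rightarrow> complex \<Rightarrow> real \<Rightarrow> complex" where
  "y12 u z x = - cnj (y21 u (cnj z) x)"

definition y22 :: "(real \<Rightarrow> complex) \<Rightarrow> complex \<Rightarrow> real \<Rightarrow> complex" where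
  "y22 u z x = cnj (y11 u (cnj z) x)"

lemma zs_continuous:
  assumes "continuous_on UNIV u"
  shows "continuous_on UNIV (\<lambda>x. - u x)" "continuous_on UNIV (\<lambda>x. cnj (u x))"
    "continuous_on UNIV (\<lambda>_::real. - \<i> * z)"
  by (intro continuous_intros assms)+

lemma zs_column1:
  assumes u: "continuous_on UNIV u"
  shows "zs u z (y11 u z) (y21 u z)" "y11 u z 0 = 1" "y21 u z 0 = 0"
proof -
  have "\<exists>p q. zs u z p q \<and> p 0 = 1 \<and> q 0 = 0"
    unfolding zs_def by (rule sol2_exists) (intro continuous_intros assms)+
  then have "\<exists>q. zs u z (y11 u z) q \<and> y11 u z 0 = 1 \<and> q 0 = 0"
    unfolding y11_def by (rule someI_ex)
  then have "zs u z (y11 u z) (y21 u z) \<and> y11 u z 0 = 1 \<and> y21 u z 0 = 0"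
    unfolding y21_def by (rule someI_ex)
  then show "zs u z (y11 u z) (y21 u z)" "y11 u z 0 = 1" "y21 u z 0 = 0" by auto
qed

lemma zs_column2:
  assumes u: "continuous_on UNIV u"
  shows "zs u z (y12 u z) (y22 u z)" "y12 u z 0 = 0" "y22 u z 0 = 1"
  using sol2_adjoint[OF zs_column1(1)[OF u, of "cnj z", unfolded zs_def]] zs_column1(2,3)[OF u]
  by (simp_all add: zs_def y12_def[abs_def] y22_def[abs_def])

lemma zs_unique:
  assumes u: "continuous_on UNIV u" and s: "zs u z p q"
  shows "p x = p 0 * y11 u z x + q 0 * y12 u z x" "q x = p 0 * y21 u z x + q 0 * y22 u z x"
proof -
  note c = sol2_combine[OF zs_column1(1)[OF u, unfolded zs_def] zs_column2(1)[OF u, unfolded zs_def], of z "p 0" "q 0"]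
  show "p x = p 0 * y11 u z x + q 0 * y12 u z x" "q x = p 0 * y21 u z x + q 0 * y22 u z x"
    using sol2_unique[OF zs_continuous(3,1,2)[OF u] s[unfolded zs_def] c, of x] zs_column1[OF u] zs_column2[OF u]
    by auto
qed

lemma zs_det:
  assumes "continuous_on UNIV u"
  shows "y11 u z x * y22 u z x - y12 u z x * y21 u z x = 1"
  using sol2_wronskian[OF zs_column1(1)[OF assms, unfolded zs_def] zs_column2(1)[OF assms, unfolded zs_def], where s = 0 and t = x]
    zs_column1[OF assms] zs_column2[OF assms] by auto

lemma y_symmetry:
  "cnj (y11 u (cnj z) x) = y22 u z x" "cnj (y22 u (cnj z) x) = y11 u z x"
  "cnj (y12 u (cnj z) x) = - y21 u z x" "cnj (y21 u (cnj z) x) = - y12 u z x"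
  by (auto simp: y12_def y22_def)

section \<open>The matrix-valued fundamental solution and its scalar columns\<close>

text \<open>The definitions index by 0 and 1, the general facts about the type \<open>2\<close> by 1
  and 2; in this type 2 and 0 are the same element.\<close>

lemma zero_eq_two: "(0::2) = 2"
  by simp

lemma UNIV_index2: "(UNIV::2 set) = {0, 1}"
  unfolding UNIV_2 zero_eq_two by auto

lemma forall_index2: "(\<forall>i::2. P i) \<longleftrightarrow> P 0 \<and> P 1"
  unfolding forall_2 zero_eq_two by auto

lemma sum_index2: "sum f (UNIV::2 set) = f 0 + f 1"
  unfolding UNIV_index2 by simp

text \<open>Avoids the infix for vector components, which is ambiguous with the one for formal power series.\<close>

abbreviation entry :: "complex^2^2 \<Rightarrow> 2 \<Rightarrow> 2 \<Rightarrow> complex" where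
  "entry A i j \<equiv> vec_nth (vec_nth A i) j"

text \<open>A bounded linear map assembling a matrix from its entries. It carries derivatives of the
  entries over to a derivative of the matrix.\<close>

definition mat2 :: "complex \<times> complex \<times> complex \<times> complex \<Rightarrow> complex^2^2" where
  "mat2 y = (\<chi> i j. if i = 0 then (if j = 0 then fst y else fst (snd y))
     else (if j = 0 then fst (snd (snd y)) else snd (snd (snd y))))"

lemma bounded_linear_mat2: "bounded_linear mat2"
  unfolding linear_conv_bounded_linear[symmetric]
  by (rule linearI) (auto simp: mat2_def vec_eq_iff)

lemma is_fundamental_iff:
  "is_fundamental u z Y \<longleftrightarrow>
     zs u z (\<lambda>x. entry (Y x) 0 0) (\<lambda>x. entry (Y x) 1 0) \<and> zs u z (\<lambda>x. entry (Y x) 0 1) (\<lambda>x. entry (Y x) 1 1) \<and>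
     entry (Y 0) 0 0 = 1 \<and> entry (Y 0) 1 0 = 0 \<and> entry (Y 0) 0 1 = 0 \<and> entry (Y 0) 1 1 = 1"
proof -
  have eq: "J_mat ** D + Q_mat u x ** Y x = mat z ** Y x \<longleftrightarrow>
      (\<forall>j. entry D 0 j = - \<i> * z * entry (Y x) 0 j - u x * entry (Y x) 1 j \<and>
           entry D 1 j = cnj (u x) * entry (Y x) 0 j + \<i> * z * entry (Y x) 1 j)" for D x
  proof -
    have 1: "\<i> * d + \<i> * a * b = e \<longleftrightarrow> d = - (\<i> * e) - a * b" for a b d e :: complex
    proof
      assume h: "\<i> * d + \<i> * a * b = e"
      show "d = - (\<i> * e) - a * b" unfolding h[symmetric] by (simp add: ring_distribs mult.assoc)
    next
      assume h: "d = - (\<i> * e) - a * b" 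
      show "\<i> * d + \<i> * a * b = e" unfolding h by (simp add: ring_distribs mult.assoc)
    qed
    have 2: "\<i> * a * b + - \<i> * d = e \<longleftrightarrow> d = a * b + \<i> * e" for a b d e :: complex
    proof
      assume h: "\<i> * a * b + - \<i> * d = e"
      show "d = a * b + \<i> * e" unfolding h[symmetric] by (simp add: ring_distribs mult.assoc)
    next
      assume h: "d = a * b + \<i> * e"
      show "\<i> * a * b + - \<i> * d = e" unfolding h by (simp add: ring_distribs mult.assoc)
    qed
    have "J_mat ** D + Q_mat u x ** Y x = mat z ** Y x \<longleftrightarrow>
      (\<forall>j. \<i> * entry D 0 j + \<i> * u x * entry (Y x) 1 j = z * entry (Y x) 0 j \<and>
           \<i> * cnj (u x) * entry (Y x) 0 j + - \<i> * entry D 1 j = z * entry (Y x) 1 j)"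
      by (simp add: vec_eq_iff forall_index2 matrix_matrix_mult_def sum_index2 J_mat_def Q_mat_def mat_def)
        (auto simp: add.commute)
    then show ?thesis unfolding 1 2 by (simp add: mult.assoc)
  qed
  have init: "Y 0 = mat 1 \<longleftrightarrow> entry (Y 0) 0 0 = 1 \<and> entry (Y 0) 1 0 = 0 \<and> entry (Y 0) 0 1 = 0 \<and> entry (Y 0) 1 1 = 1"
    by (auto simp: vec_eq_iff forall_index2 mat_def)
  have der: "(\<exists>D. (Y has_vector_derivative D) (at x) \<and> J_mat ** D + Q_mat u x ** Y x = mat z ** Y x) \<longleftrightarrow>
     (\<forall>j. ((\<lambda>x. entry (Y x) 0 j) has_vector_derivative - \<i> * z * entry (Y x) 0 j - u x * entry (Y x) 1 j) (at x) \<and>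
          ((\<lambda>x. entry (Y x) 1 j) has_vector_derivative cnj (u x) * entry (Y x) 0 j + \<i> * z * entry (Y x) 1 j) (at x))" for x
  proof
    assume "\<exists>D. (Y has_vector_derivative D) (at x) \<and> J_mat ** D + Q_mat u x ** Y x = mat z ** Y x"
    then obtain D where D: "(Y has_vector_derivative D) (at x)" and e: "J_mat ** D + Q_mat u x ** Y x = mat z ** Y x"
      by blast
    have "((\<lambda>x. entry (Y x) i j) has_vector_derivative entry D i j) (at x)" for i j
      by (intro bounded_linear.has_vector_derivative[OF bounded_linear_vec_nth] D)
    then show "\<forall>j. ((\<lambda>x. entry (Y x) 0 j) has_vector_derivative - \<i> * z * entry (Y x) 0 j - u x * entry (Y x) 1 j) (at x) \<and>
          ((\<lambda>x. entry (Y x) 1 j) has_vector_derivative cnj (u x) * entry (Y x) 0 j + \<i> * z * entry (Y x) 1 j) (at x)"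
      using e[unfolded eq] by metis
  next
    assume *: "\<forall>j. ((\<lambda>x. entry (Y x) 0 j) has_vector_derivative - \<i> * z * entry (Y x) 0 j - u x * entry (Y x) 1 j) (at x) \<and>
          ((\<lambda>x. entry (Y x) 1 j) has_vector_derivative cnj (u x) * entry (Y x) 0 j + \<i> * z * entry (Y x) 1 j) (at x)"
    define d where "d = (- \<i> * z * entry (Y x) 0 0 - u x * entry (Y x) 1 0, - \<i> * z * entry (Y x) 0 1 - u x * entry (Y x) 1 1,
      cnj (u x) * entry (Y x) 0 0 + \<i> * z * entry (Y x) 1 0, cnj (u x) * entry (Y x) 0 1 + \<i> * z * entry (Y x) 1 1)"
    have "((\<lambda>x. (entry (Y x) 0 0, entry (Y x) 0 1, entry (Y x) 1 0, entry (Y x) 1 1)) has_vector_derivative d) (at x)"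
      unfolding d_def using * by (intro has_vector_derivative_Pair) blast+
    from bounded_linear.has_vector_derivative[OF bounded_linear_mat2 this]
    have "((\<lambda>x. mat2 (entry (Y x) 0 0, entry (Y x) 0 1, entry (Y x) 1 0, entry (Y x) 1 1)) has_vector_derivative mat2 d) (at x)" .
    also have "(\<lambda>x. mat2 (entry (Y x) 0 0, entry (Y x) 0 1, entry (Y x) 1 0, entry (Y x) 1 1)) = Y"
      by (auto simp: mat2_def vec_eq_iff forall_index2 fun_eq_iff)
    finally have "(Y has_vector_derivative mat2 d) (at x)" .
    moreover have "J_mat ** mat2 d + Q_mat u x ** Y x = mat z ** Y x"
      unfolding eq by (auto simp: forall_index2 mat2_def d_def)
    ultimately show "\<exists>D. (Y has_vector_derivative D) (at x) \<and> J_mat ** D + Q_mat u x ** Y x = mat z ** Y x"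
      by blast
  qed
  show ?thesis
    unfolding is_fundamental_def der init by (auto simp: zs_def sol2_def forall_index2)
qed

lemma fundamental_entries:
  assumes u: "continuous_on UNIV u"
  shows "entry (fundamental u z x) 0 0 = y11 u z x" "entry (fundamental u z x) 0 1 = y12 u z x"
    "entry (fundamental u z x) 1 0 = y21 u z x" "entry (fundamental u z x) 1 1 = y22 u z x"
proof -
  define Y where "Y x = mat2 (y11 u z x, y12 u z x, y21 u z x, y22 u z x)" for x
  have e: "entry (Y x) 0 0 = y11 u z x" "entry (Y x) 0 1 = y12 u z x" "entry (Y x) 1 0 = y21 u z x" "entry (Y x) 1 1 = y22 u z x" for x
    by (auto simp: Y_def mat2_def)
  have Y: "is_fundamental u z Y"
    unfolding is_fundamental_iff e using zs_column1[OF u] zs_column2[OF u] by simp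
  have "fundamental u z = Y"
    unfolding fundamental_def
  proof (rule the_equality)
    fix X assume "is_fundamental u z X"
    then have X: "zs u z (\<lambda>x. entry (X x) 0 0) (\<lambda>x. entry (X x) 1 0)" "zs u z (\<lambda>x. entry (X x) 0 1) (\<lambda>x. entry (X x) 1 1)"
     "entry (X 0) 0 0 = 1" "entry (X 0) 1 0 = 0" "entry (X 0) 0 1 = 0" "entry (X 0) 1 1 = 1"
      by (auto simp: is_fundamental_iff)
    have "entry (X x) 0 0 = y11 u z x \<and> entry (X x) 1 0 = y21 u z x \<and> entry (X x) 0 1 = y12 u z x \<and>
        entry (X x) 1 1 = y22 u z x" for x
      using zs_unique[OF u X(1), of x] zs_unique[OF u X(2), of x] unfolding X(3-6) by simp
    then show "X = Y"
      by (simp add: fun_eq_iff vec_eq_iff forall_index2 e)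
  qed (rule Y)
  then show "entry (fundamental u z x) 0 0 = y11 u z x" "entry (fundamental u z x) 0 1 = y12 u z x"
    "entry (fundamental u z x) 1 0 = y21 u z x" "entry (fundamental u z x) 1 1 = y22 u z x"
    by (simp_all add: e)
qed

lemma gap_functions:
  assumes "continuous_on UNIV u"
  shows "f_fun l u z = (y11 u z l - y22 u z l) / (2 * \<i>)" "psi_fun l u z = y12 u z l" "phi_fun l u z = y21 u z l"
  by (simp_all add: f_fun_def psi_fun_def phi_fun_def monodromy_def fundamental_entries[OF assms])

text \<open>A translate by the period is again a solution, hence a combination of the columns, with
  coefficients read off at 0. In matrix form, Y(x + l) = Y(x) Y(l).\<close>

lemma zs_shift_period:
  assumes u: "continuous_on UNIV u" and per: "\<And>x. u (x + l) = u x"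
  shows "y11 u z (x + l) = y11 u z l * y11 u z x + y21 u z l * y12 u z x"
    "y21 u z (x + l) = y11 u z l * y21 u z x + y21 u z l * y22 u z x"
    "y12 u z (x + l) = y12 u z l * y11 u z x + y22 u z l * y12 u z x"
    "y22 u z (x + l) = y12 u z l * y21 u z x + y22 u z l * y22 u z x"
proof -
  have shift: "zs u z (\<lambda>x. p (x + l)) (\<lambda>x. q (x + l))" if "zs u z p q" for p q
  proof -
    have s: "((\<lambda>x. x + l) has_vector_derivative 1) (at x)" for x
      by (auto intro!: derivative_eq_intros)
    have "((\<lambda>x. w (x + l)) has_vector_derivative w') (at x)" if "(w has_vector_derivative w') (at (x + l))"
      for w w' and x
      using vector_diff_chain_at[OF s that] by (simp add: o_def)
    note w = this
    have "(p has_vector_derivative - \<i> * z * p y + - u y * q y) (at y)"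
      "(q has_vector_derivative cnj (u y) * p y - - \<i> * z * q y) (at y)" for y
      using that by (auto simp: zs_def sol2_def)
    then show ?thesis using w[of p _ x for x] w[of q _ x for x] unfolding zs_def sol2_def
      by (metis per)
  qed
  show "y11 u z (x + l) = y11 u z l * y11 u z x + y21 u z l * y12 u z x"
    "y21 u z (x + l) = y11 u z l * y21 u z x + y21 u z l * y22 u z x"
    "y12 u z (x + l) = y12 u z l * y11 u z x + y22 u z l * y12 u z x"
    "y22 u z (x + l) = y12 u z l * y21 u z x + y22 u z l * y22 u z x"
    using zs_unique[OF u shift[OF zs_column1(1)[OF u, of z]], of x]
      zs_unique[OF u shift[OF zs_column2(1)[OF u, of z]], of x]
    by auto
qed

section \<open>Growth over one period and holomorphy in the spectral parameter\<close>

text \<open>The potential enters through an anti-hermitian matrix, so it drops out of the derivative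
  of |p|^2 + |q|^2, which is 2 Im z (|p|^2 - |q|^2). The growth rate is therefore independent of
  \<open>u\<close>.\<close>

lemma zs_energy:
  assumes "zs u z p q" "s \<le> t"
  shows "(norm (p t))\<^sup>2 + (norm (q t))\<^sup>2 \<le> exp (2 * \<bar>Im z\<bar> * (t - s)) * ((norm (p s))\<^sup>2 + (norm (q s))\<^sup>2)"
proof -
  define E where "E t = inner (p t) (p t) + inner (q t) (q t)" for t
  define E' where "E' t = 2 * Im z * ((norm (p t))\<^sup>2 - (norm (q t))\<^sup>2)" for t
  have E: "E t = (norm (p t))\<^sup>2 + (norm (q t))\<^sup>2" for t by (simp add: E_def dot_square_norm)
  have dE: "(E has_real_derivative E' t) (at t)" for t
  proof -
    have p: "(p has_vector_derivative - \<i> * z * p t - u t * q t) (at t)"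
      and q: "(q has_vector_derivative cnj (u t) * p t + \<i> * z * q t) (at t)"
      using assms(1) by (auto simp: zs_def sol2_def)
    note bounded_bilinear.has_vector_derivative[OF bounded_bilinear_inner p p]
      bounded_bilinear.has_vector_derivative[OF bounded_bilinear_inner q q]
    from has_vector_derivative_add[OF this]
    show ?thesis
      unfolding has_real_derivative_iff_has_vector_derivative E_def[abs_def]
      by (rule has_vector_derivative_eq_rhs)
        (simp add: E'_def inner_complex_def cmod_power2, simp add: algebra_simps power2_eq_square)
  qed
  define g where "g t = E t * exp (- (2 * \<bar>Im z\<bar> * t))" for t
  have "g t \<le> g s"
  proof (rule DERIV_nonpos_imp_nonincreasing[OF assms(2)])
    fix x
    have "(g has_real_derivative (E' x - 2 * \<bar>Im z\<bar> * E x) * exp (- (2 * \<bar>Im z\<bar> * x))) (at x)"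
      unfolding g_def by (auto intro!: derivative_eq_intros dE simp: algebra_simps)
    moreover have "E' x \<le> 2 * \<bar>Im z\<bar> * E x"
    proof -
      have "Im z * ((norm (p x))\<^sup>2 - (norm (q x))\<^sup>2) \<le> \<bar>Im z\<bar> * \<bar>(norm (p x))\<^sup>2 - (norm (q x))\<^sup>2\<bar>"
        by (metis abs_ge_self abs_mult)
      also have "\<dots> \<le> \<bar>Im z\<bar> * E x" by (intro mult_left_mono) (auto simp: E abs_le_iff)
      finally show ?thesis by (simp add: E'_def)
    qed
    ultimately show "\<exists>y. (g has_real_derivative y) (at x) \<and> y \<le> 0"
      by (intro exI[of _ "(E' x - 2 * \<bar>Im z\<bar> * E x) * exp (- (2 * \<bar>Im z\<bar> * x))"])
        (simp add: mult_nonpos_nonneg)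
  qed
  then have "E t \<le> E s * exp (- (2 * \<bar>Im z\<bar> * s)) * exp (2 * \<bar>Im z\<bar> * t)"
    by (simp add: g_def exp_minus field_simps)
  also have "\<dots> = exp (2 * \<bar>Im z\<bar> * (t - s)) * E s"
    by (simp add: exp_add[symmetric] exp_diff exp_minus field_simps)
  finally show ?thesis by (simp add: E)
qed

lemma zs_energy_unit:
  assumes "zs u z p q" "s \<le> t" "(norm (p s))\<^sup>2 + (norm (q s))\<^sup>2 = 1"
  shows "norm (p t) \<le> exp (\<bar>Im z\<bar> * (t - s))" "norm (q t) \<le> exp (\<bar>Im z\<bar> * (t - s))"
proof -
  have "(norm (p t))\<^sup>2 + (norm (q t))\<^sup>2 \<le> (exp (\<bar>Im z\<bar> * (t - s)))\<^sup>2"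
    using zs_energy[OF assms(1,2)] assms(3) by (simp add: exp_double[symmetric] algebra_simps)
  then have "(norm (p t))\<^sup>2 \<le> (exp (\<bar>Im z\<bar> * (t - s)))\<^sup>2" "(norm (q t))\<^sup>2 \<le> (exp (\<bar>Im z\<bar> * (t - s)))\<^sup>2"
    by (smt (verit) zero_le_power2)+
  then show "norm (p t) \<le> exp (\<bar>Im z\<bar> * (t - s))" "norm (q t) \<le> exp (\<bar>Im z\<bar> * (t - s))"
    by (auto intro: power2_le_imp_le)
qed

text \<open>The quantities on the left are entries of the traceless part of the monodromy matrix with
  base point \<open>x\<close>, whose columns are transported over exactly one period.\<close>

lemma monodromy_at_bound:
  assumes u: "continuous_on UNIV u" and per: "\<And>x. u (x + l) = u x" and l: "l > 0"
  shows "norm (conjF (y11 u z x) (y21 u z x) (y12 u z x) (y22 u z x) (f_fun l u z) (psi_fun l u z) (phi_fun l u z)) \<le> exp (\<bar>Im z\<bar> * l)"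
    (is "norm ?F \<le> _")
    "norm (conjG (y11 u z x) (y21 u z x) (y12 u z x) (y22 u z x) (f_fun l u z) (psi_fun l u z) (phi_fun l u z)) \<le> exp (\<bar>Im z\<bar> * l)"
    (is "norm ?G \<le> _")
proof -
  note c = sol2_combine[OF zs_column1(1)[OF u, of z, unfolded zs_def] zs_column2(1)[OF u, of z, unfolded zs_def], folded zs_def]
  \<comment> \<open>The coefficients are the entries of adj(Y(x)), so (\<open>m1\<close>,
    \<open>m2\<close>) and (\<open>n1\<close>, \<open>n2\<close>) are the columns of Y(t) Y(x)^(-1),
    the solution normalised at \<open>x\<close> instead of 0.\<close>
  define m1 where "m1 t = y22 u z x * y11 u z t + - y21 u z x * y12 u z t" for t
  define m2 where "m2 t = y22 u z x * y21 u z t + - y21 u z x * y22 u z t" for t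
  define n1 where "n1 t = - y12 u z x * y11 u z t + y11 u z x * y12 u z t" for t
  define n2 where "n2 t = - y12 u z x * y21 u z t + y11 u z x * y22 u z t" for t
  have m: "zs u z m1 m2" and n: "zs u z n1 n2"
    unfolding m1_def[abs_def] m2_def[abs_def] n1_def[abs_def] n2_def[abs_def] by (rule c)+
  have ini: "m1 x = 1" "m2 x = 0" "n1 x = 0" "n2 x = 1"
    using zs_det[OF u, of z x] by (auto simp: m1_def m2_def n1_def n2_def algebra_simps)
  have b: "norm (m1 (x + l)) \<le> exp (\<bar>Im z\<bar> * l)" "norm (m2 (x + l)) \<le> exp (\<bar>Im z\<bar> * l)"
      "norm (n1 (x + l)) \<le> exp (\<bar>Im z\<bar> * l)" "norm (n2 (x + l)) \<le> exp (\<bar>Im z\<bar> * l)"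
    using zs_energy_unit[OF m, of x "x + l"] zs_energy_unit[OF n, of x "x + l"] ini l by auto
  have e: "?F = (m1 (x + l) - n2 (x + l)) / (2 * \<i>)"
    "?G = n1 (x + l)"
    unfolding conj_defs gap_functions[OF u] m1_def m2_def n1_def n2_def zs_shift_period[OF u per]
    by (simp_all add: field_simps)
  show "norm ?F \<le> exp (\<bar>Im z\<bar> * l)"
    using b(1,4) norm_triangle_ineq4[of "m1 (x + l)" "n2 (x + l)"] by (simp add: e norm_divide norm_mult)
  show "norm ?G \<le> exp (\<bar>Im z\<bar> * l)" using b by (simp add: e)
qed

lemma quadratic_remainder_has_derivative:
  fixes f :: "'a::real_normed_vector \<Rightarrow> 'b::real_normed_vector"
  assumes D: "bounded_linear D" and d: "d > 0"
    and b: "\<And>y. norm (y - x) \<le> d \<Longrightarrow> norm (f y - f x - D (y - x)) \<le> C * (norm (y - x))\<^sup>2"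
  shows "(f has_derivative D) (at x)"
  unfolding has_derivative_at_alt
proof (intro conjI D allI impI)
  fix e :: real assume e: "e > 0"
  define r where "r = min d (e / (\<bar>C\<bar> + 1))"
  have "norm (f y - f x - D (y - x)) \<le> e * norm (y - x)" if y: "norm (y - x) < r" for y
  proof -
    have "norm (f y - f x - D (y - x)) \<le> C * (norm (y - x))\<^sup>2"
      using y by (intro b) (simp add: r_def)
    also have "\<dots> \<le> (\<bar>C\<bar> + 1) * norm (y - x) * norm (y - x)"
      unfolding power2_eq_square mult.assoc[symmetric] by (intro mult_right_mono) auto
    also have "\<dots> \<le> e * norm (y - x)"
    proof (intro mult_right_mono)
      have "norm (y - x) \<le> e / (\<bar>C\<bar> + 1)" using y by (simp add: r_def)
      then show "(\<bar>C\<bar> + 1) * norm (y - x) \<le> e" by (simp add: field_simps)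
    qed auto
    finally show ?thesis .
  qed
  moreover have "r > 0" using d e by (simp add: r_def)
  ultimately show "\<exists>d>0. \<forall>y. norm (y - x) < d \<longrightarrow> norm (f y - f x - D (y - x)) \<le> e * norm (y - x)"
    by blast
qed

text \<open>The candidate derivative solves the system differentiated formally in \<open>z\<close>,
  with zero initial data. Gronwall's inequality is applied twice: first the difference of the
  solutions at \<open>w\<close> and \<open>z0\<close> is O(|w - z0|), and with this as forcing term
  the remainder after the candidate is O(|w - z0|^2).\<close>

lemma zs_column1_has_field_derivative:
  assumes u: "continuous_on UNIV u"
  shows "\<exists>d. ((\<lambda>z. y11 u z x) has_field_derivative d) (at z0)"
    "\<exists>d. ((\<lambda>z. y21 u z x) has_field_derivative d) (at z0)"
proof -
  define T where "T = \<bar>x\<bar>"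
  define Y where "Y w t = (y11 u w t, y21 u w t)" for w t
  obtain M where M: "M > 0" "\<And>t. \<bar>t\<bar> \<le> T \<Longrightarrow> norm (u t) \<le> M"
    by (rule continuous_bounded_abs3[where T = T, OF u u u]) blast
  define N where "N = M + norm z0 + 1"
  have "norm (u t) \<le> N" if "\<bar>t\<bar> \<le> T" for t
    using M(2)[OF that] norm_ge_zero[of z0] unfolding N_def by linarith
  then have N: "N > 0" "\<And>t. \<bar>t\<bar> \<le> T \<Longrightarrow> norm (- u t) \<le> N" "\<And>t. \<bar>t\<bar> \<le> T \<Longrightarrow> norm (cnj (u t)) \<le> N"
    using M(1) by (simp_all add: N_def add_pos_nonneg)
  have Nz: "norm (- \<i> * w) \<le> N" if "norm (w - z0) \<le> 1" for w
    using norm_triangle_sub[of w z0] that M(1) by (simp add: N_def norm_mult)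
  have pd: "(y11 u w has_vector_derivative - \<i> * w * y11 u w t - u t * y21 u w t) (at t)"
    and qd: "(y21 u w has_vector_derivative cnj (u t) * y11 u w t + \<i> * w * y21 u w t) (at t)" for w t
    using zs_column1(1)[OF u, of w] by (auto simp: zs_def sol2_def)
  have yc: "continuous_on UNIV (y11 u w)" "continuous_on UNIV (y21 u w)" for w
    using has_vector_derivative_continuous[OF pd] has_vector_derivative_continuous[OF qd]
    by (simp_all add: continuous_on_eq_continuous_at)
  have Yc: "continuous_on UNIV (Y z0)"
    unfolding Y_def by (intro continuous_intros yc)
  obtain B where B: "B > 0" "\<And>t. \<bar>t\<bar> \<le> T \<Longrightarrow> norm (Y z0 t) \<le> B"
    by (rule continuous_bounded_abs3[where T = T, OF Yc Yc Yc]) blast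
  \<comment> \<open>The forcing (- i y11, i y21) is the \<open>z\<close>-derivative of the
    coefficient matrix applied to the column.\<close>
  have "\<exists>p q. p 0 = 0 \<and> q 0 = 0 \<and> (\<forall>t. (p has_vector_derivative - \<i> * z0 * p t + - u t * q t + - \<i> * y11 u z0 t) (at t) \<and>
     (q has_vector_derivative cnj (u t) * p t - - \<i> * z0 * q t + \<i> * y21 u z0 t) (at t))"
    by (rule sol2_forced_exists) (intro continuous_intros u yc)+
  then obtain p q where p0: "p 0 = 0" "q 0 = 0"
    and wp: "\<And>t. (p has_vector_derivative - \<i> * z0 * p t + - u t * q t + - \<i> * y11 u z0 t) (at t)"
    and wq: "\<And>t. (q has_vector_derivative cnj (u t) * p t - - \<i> * z0 * q t + \<i> * y21 u z0 t) (at t)"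
    by blast
  define K where "K = 4 * N"
  have K: "K > 0" using N(1) by (simp add: K_def)
  define C1 where "C1 = 2 * (4 * B * T) * exp (2 * K * T)"
  have D: "norm (y11 u w t - y11 u z0 t, y21 u w t - y21 u z0 t) \<le> C1 * norm (w - z0)"
    if w: "norm (w - z0) \<le> 1" and t: "\<bar>t\<bar> \<le> T" for w t
  proof -
    define D where "D t = (y11 u w t - y11 u z0 t, y21 u w t - y21 u z0 t)" for t
    have "norm (D t) \<le> 2 * (norm (D 0) + (4 * norm (w - z0) * B) * T) * exp (2 * K * T)"
    proof (rule gronwall[OF K _ t])
      fix s assume s: "\<bar>s\<bar> \<le> T"
      let ?D' = "field2 (- \<i> * w) (- u s) (cnj (u s)) (D s) + field2 (- \<i> * (w - z0)) 0 0 (Y z0 s)"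
      show "(D has_vector_derivative ?D') (at s)"
      proof (rule has_vector_derivative_eq_rhs)
        show "(D has_vector_derivative
          (- \<i> * w * y11 u w s - u s * y21 u w s - (- \<i> * z0 * y11 u z0 s - u s * y21 u z0 s),
           cnj (u s) * y11 u w s + \<i> * w * y21 u w s - (cnj (u s) * y11 u z0 s + \<i> * z0 * y21 u z0 s))) (at s)"
          unfolding D_def by (intro has_vector_derivative_Pair has_vector_derivative_diff pd qd)
      qed (simp add: field2_def D_def Y_def algebra_simps)
      have "norm ?D' \<le> norm (field2 (- \<i> * w) (- u s) (cnj (u s)) (D s)) + norm (field2 (- \<i> * (w - z0)) 0 0 (Y z0 s))"
        by (rule norm_triangle_ineq)
      also have "\<dots> \<le> 4 * N * norm (D s) + 4 * norm (w - z0) * norm (Y z0 s)"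
        by (intro add_mono norm_field2 Nz[OF w] N s) (auto simp: norm_mult)
      also have "\<dots> \<le> K * norm (D s) + 4 * norm (w - z0) * B"
        unfolding K_def using B(2)[OF s] by (intro add_left_mono mult_left_mono) auto
      finally show "norm ?D' \<le> K * norm (D s) + 4 * norm (w - z0) * B" .
    qed (use B(1) in auto)
    also have "D 0 = 0" using zs_column1[OF u] by (simp add: D_def zero_prod_def)
    finally show ?thesis by (simp add: D_def C1_def algebra_simps)
  qed
  have C1: "C1 \<ge> 0" using B(1) by (simp add: C1_def T_def)
  define C2 where "C2 = 2 * (4 * C1 * T) * exp (2 * K * T)"
  have E: "norm (y11 u w x - y11 u z0 x - (w - z0) * p x, y21 u w x - y21 u z0 x - (w - z0) * q x)
      \<le> C2 * (norm (w - z0))\<^sup>2" if w: "norm (w - z0) \<le> 1" for w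
  proof -
    define D where "D t = (y11 u w t - y11 u z0 t, y21 u w t - y21 u z0 t)" for t
    define E where "E t = (y11 u w t - y11 u z0 t - (w - z0) * p t, y21 u w t - y21 u z0 t - (w - z0) * q t)" for t
    have "norm (E x) \<le> 2 * (norm (E 0) + (4 * norm (w - z0) * (C1 * norm (w - z0))) * T) * exp (2 * K * T)"
    proof (rule gronwall[OF K])
      show "\<bar>x\<bar> \<le> T" by (simp add: T_def)
      show "0 \<le> 4 * norm (w - z0) * (C1 * norm (w - z0))" using C1 by simp
      fix s assume s: "\<bar>s\<bar> \<le> T"
      let ?E' = "field2 (- \<i> * z0) (- u s) (cnj (u s)) (E s) + field2 (- \<i> * (w - z0)) 0 0 (D s)"
      show "(E has_vector_derivative ?E') (at s)"
      proof (rule has_vector_derivative_eq_rhs)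
        show "(E has_vector_derivative
          (- \<i> * w * y11 u w s - u s * y21 u w s - (- \<i> * z0 * y11 u z0 s - u s * y21 u z0 s)
              - (w - z0) * (- \<i> * z0 * p s + - u s * q s + - \<i> * y11 u z0 s),
           cnj (u s) * y11 u w s + \<i> * w * y21 u w s - (cnj (u s) * y11 u z0 s + \<i> * z0 * y21 u z0 s)
              - (w - z0) * (cnj (u s) * p s - - \<i> * z0 * q s + \<i> * y21 u z0 s))) (at s)"
          unfolding E_def by (intro has_vector_derivative_Pair has_vector_derivative_diff
            has_vector_derivative_mult_right pd qd wp wq)
      qed (simp add: field2_def D_def E_def algebra_simps)
      have "norm ?E' \<le> norm (field2 (- \<i> * z0) (- u s) (cnj (u s)) (E s)) + norm (field2 (- \<i> * (w - z0)) 0 0 (D s))"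
        by (rule norm_triangle_ineq)
      also have "\<dots> \<le> 4 * N * norm (E s) + 4 * norm (w - z0) * norm (D s)"
        by (intro add_mono norm_field2 Nz N s) (auto simp: norm_mult)
      also have "\<dots> \<le> K * norm (E s) + 4 * norm (w - z0) * (C1 * norm (w - z0))"
        unfolding K_def using D[OF w s] by (intro add_left_mono mult_left_mono) (auto simp: D_def)
      finally show "norm ?E' \<le> K * norm (E s) + 4 * norm (w - z0) * (C1 * norm (w - z0))" .
    qed
    also have "E 0 = 0" using zs_column1[OF u] by (simp add: E_def zero_prod_def p0)
    finally show ?thesis by (simp add: E_def C2_def algebra_simps power2_eq_square)
  qed
  have "((\<lambda>z. y11 u z x) has_derivative (\<lambda>h. p x * h)) (at z0)"
  proof (rule quadratic_remainder_has_derivative[where d = 1 and C = C2])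
    fix w assume "norm (w - z0) \<le> 1"
    note E[OF this]
    then show "norm (y11 u w x - y11 u z0 x - p x * (w - z0)) \<le> C2 * (norm (w - z0))\<^sup>2"
      by (rule order_trans[rotated]) (simp add: mult.commute norm_fst_le)
  qed (auto intro: bounded_linear_mult_right)
  then show "\<exists>d. ((\<lambda>z. y11 u z x) has_field_derivative d) (at z0)"
    by (auto simp: has_field_derivative_def intro!: exI[of _ "p x"])
  have "((\<lambda>z. y21 u z x) has_derivative (\<lambda>h. q x * h)) (at z0)"
  proof (rule quadratic_remainder_has_derivative[where d = 1 and C = C2])
    fix w assume "norm (w - z0) \<le> 1"
    note E[OF this]
    then show "norm (y21 u w x - y21 u z0 x - q x * (w - z0)) \<le> C2 * (norm (w - z0))\<^sup>2"
      by (rule order_trans[rotated]) (simp add: mult.commute norm_snd_le)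
  qed (auto intro: bounded_linear_mult_right)
  then show "\<exists>d. ((\<lambda>z. y21 u z x) has_field_derivative d) (at z0)"
    by (auto simp: has_field_derivative_def intro!: exI[of _ "q x"])
qed

lemma zs_holomorphic:
  assumes u: "continuous_on UNIV u"
  shows "(\<lambda>z. y11 u z x) holomorphic_on UNIV" "(\<lambda>z. y21 u z x) holomorphic_on UNIV"
    "(\<lambda>z. y12 u z x) holomorphic_on UNIV" "(\<lambda>z. y22 u z x) holomorphic_on UNIV"
proof -
  show 1: "(\<lambda>z. y11 u z x) holomorphic_on UNIV" and 2: "(\<lambda>z. y21 u z x) holomorphic_on UNIV"
    using zs_column1_has_field_derivative[OF u] by (auto simp: holomorphic_on_open)
  have "cnj \<circ> (\<lambda>z. y11 u z x) \<circ> cnj holomorphic_on UNIV" "cnj \<circ> (\<lambda>z. y21 u z x) \<circ> cnj holomorphic_on UNIV"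
    by (intro holomorphic_on_compose_cnj_cnj holomorphic_on_subset[OF 1] holomorphic_on_subset[OF 2]; simp)+
  then show "(\<lambda>z. y12 u z x) holomorphic_on UNIV" "(\<lambda>z. y22 u z x) holomorphic_on UNIV"
    by (auto simp: y12_def y22_def o_def intro!: holomorphic_on_minus)
qed

section \<open>Behaviour of the monodromy matrix for large z\<close>

text \<open>The off-diagonal part of the potential is removed to leading order in \<open>1/z\<close> by passing from
  \<open>p\<close> to \<open>p - i u q / (2 z)\<close>.\<close>

lemma y11_asymptotics:
  assumes u': "\<And>x. (u has_vector_derivative u' x) (at x)" "continuous_on UNIV u'" and l: "l > 0"
  shows "\<exists>C>0. \<forall>z. z \<noteq> 0 \<longrightarrow> norm (y11 u z l - exp (- \<i> * z * l)) \<le> C / norm z * exp (\<bar>Im z\<bar> * l)"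
proof -
  have u: "continuous_on UNIV u"
    using u'(1) has_vector_derivative_continuous continuous_at_imp_continuous_on by blast
  obtain M where M: "M > 0" "\<And>t. \<bar>t\<bar> \<le> l \<Longrightarrow> norm (u t) \<le> M" "\<And>t. \<bar>t\<bar> \<le> l \<Longrightarrow> norm (u' t) \<le> M"
    by (rule continuous_bounded_abs3[where T = l, OF u u'(2) u]) blast
  define K where "K = (M + M * M) / 2"
  have K: "K > 0" using M by (simp add: K_def add_pos_pos)
  have "norm (y11 u z l - exp (- \<i> * z * l)) \<le> (K * l + M / 2) / norm z * exp (\<bar>Im z\<bar> * l)" if z: "z \<noteq> 0" for z
  proof -
    define p q where "p = y11 u z" and "q = y21 u z"
    define b where "b = Im z"
    have pd: "(p has_vector_derivative - \<i> * z * p t - u t * q t) (at t)"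
      and qd: "(q has_vector_derivative cnj (u t) * p t + \<i> * z * q t) (at t)" for t
      using zs_column1(1)[OF u, of z] by (auto simp: zs_def sol2_def p_def q_def)
    have pb: "norm (p t) \<le> exp (\<bar>b\<bar> * t)" and qb: "norm (q t) \<le> exp (\<bar>b\<bar> * t)" if "t \<ge> 0" for t
      using zs_energy_unit[OF zs_column1(1)[OF u] that, of z] zs_column1[OF u] by (auto simp: p_def q_def b_def)
    define k where "k = \<i> / (2 * z)"
    define w where "w t = exp (\<i> * z * of_real t) * (p t - k * u t * q t)" for t :: real
    define w' where "w' t = - (exp (\<i> * z * of_real t) * (k * (u' t * q t + u t * cnj (u t) * p t)))" for t :: real
    \<comment> \<open>In the derivative of \<open>w\<close> the term in u q, the only one not small
      in 1/z, has the factor 1 + 2 i z k. The choice of \<open>k\<close> makes it vanish.\<close>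
    have ek: "\<i> * z * k = - 1/2" using z by (simp add: k_def)
    have wd: "(w has_vector_derivative w' t) (at t)" for t
    proof -
      have e: "((\<lambda>t. exp (\<i> * z * of_real t)) has_vector_derivative \<i> * z * exp (\<i> * z * of_real t)) (at t)"
        by (auto intro!: derivative_eq_intros has_vector_derivative_real_field)
      have "(w has_vector_derivative exp (\<i> * z * of_real t) *
            (- \<i> * z * p t - u t * q t - (k * u t * (cnj (u t) * p t + \<i> * z * q t) + k * u' t * q t)) +
          \<i> * z * exp (\<i> * z * of_real t) * (p t - k * u t * q t)) (at t)"
        unfolding w_def
        by (intro has_vector_derivative_mult has_vector_derivative_diff has_vector_derivative_mult_right e pd qd u')
      also have "exp (\<i> * z * of_real t) *
            (- \<i> * z * p t - u t * q t - (k * u t * (cnj (u t) * p t + \<i> * z * q t) + k * u' t * q t)) +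
          \<i> * z * exp (\<i> * z * of_real t) * (p t - k * u t * q t) =
          w' t - exp (\<i> * z * of_real t) * u t * q t * (1 + 2 * (\<i> * z * k))"
        unfolding w'_def by (simp add: algebra_simps)
      finally show ?thesis unfolding ek by simp
    qed
    have nexp: "norm (exp (\<i> * z * of_real t)) = exp (- b * t)" for t by (simp add: b_def)
    have kn: "norm k = 1 / (2 * norm z)" by (simp add: k_def norm_divide norm_mult)
    \<comment> \<open>The product exp(- b s) exp(|b| s) is largest at s = l. Multiplied back by
      exp(b l), it becomes exp(|b| l).\<close>
    define c where "c = K / norm z * exp ((\<bar>b\<bar> - b) * l)"
    have "norm (w l - w 0) \<le> c * l - c * 0"
    proof (rule vector_derivative_bound_nonneg[where w' = w' and \<phi>' = "\<lambda>_. c"])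
      fix s assume s: "0 \<le> s" "s \<le> l"
      then have s': "\<bar>s\<bar> \<le> l" by simp
      have "norm (u' s * q s + u s * cnj (u s) * p s) \<le> M * exp (\<bar>b\<bar> * s) + M * M * exp (\<bar>b\<bar> * s)"
        by (intro order_trans[OF norm_triangle_ineq] add_mono)
          (use M s' pb[OF s(1)] qb[OF s(1)] in \<open>auto simp: norm_mult intro!: mult_mono\<close>)
      also have "\<dots> = 2 * K * exp (\<bar>b\<bar> * s)" by (simp add: K_def algebra_simps)
      finally have *: "norm (u' s * q s + u s * cnj (u s) * p s) \<le> 2 * K * exp (\<bar>b\<bar> * s)" .
      have "norm (w' s) = exp (- b * s) * (1 / (2 * norm z) * norm (u' s * q s + u s * cnj (u s) * p s))"
        by (simp only: w'_def norm_minus_cancel norm_mult[of "exp _"] norm_mult[of k] nexp kn)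
      also have "\<dots> \<le> exp (- b * s) * (1 / (2 * norm z) * (2 * K * exp (\<bar>b\<bar> * s)))"
        by (intro mult_left_mono *) auto
      also have "\<dots> = K / norm z * exp ((\<bar>b\<bar> - b) * s)"
        by (simp add: exp_add[symmetric] algebra_simps)
      also have "\<dots> \<le> c"
        unfolding c_def using K s by (intro mult_left_mono) (auto intro!: mult_left_mono)
      finally show "norm (w' s) \<le> c" .
    qed (use l wd in \<open>auto intro!: derivative_eq_intros\<close>)
    moreover have "w 0 = 1" using zs_column1[OF u] by (simp add: w_def p_def q_def)
    ultimately have wl: "norm (w l - 1) \<le> c * l" by simp
    have "p l - exp (- \<i> * z * l) = exp (- \<i> * z * l) * (w l - 1) + k * u l * q l"
      by (simp add: w_def algebra_simps exp_minus)
    then have "norm (p l - exp (- \<i> * z * l)) \<le> norm (exp (- \<i> * z * l)) * norm (w l - 1) + norm k * norm (u l) * norm (q l)"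
      by (metis norm_mult norm_triangle_ineq)
    also have "\<dots> \<le> exp (b * l) * (c * l) + 1 / (2 * norm z) * M * exp (\<bar>b\<bar> * l)"
      using wl M(1) M(2)[of l] qb[of l] l by (intro add_mono mult_mono) (auto simp: b_def kn)
    also have "\<dots> = (K * l + M / 2) / norm z * exp (\<bar>b\<bar> * l)"
    proof -
      have "exp (b * l) * (c * l) = K * l / norm z * (exp (b * l) * exp ((\<bar>b\<bar> - b) * l))"
        by (simp add: c_def)
      also have "exp (b * l) * exp ((\<bar>b\<bar> - b) * l) = exp (\<bar>b\<bar> * l)"
        by (simp add: exp_add[symmetric] algebra_simps)
      finally show ?thesis using z by (simp add: field_simps)
    qed
    finally show ?thesis by (simp add: p_def b_def)
  qed
  moreover have "K * l + M / 2 > 0" using K M(1) l by (simp add: add_pos_pos)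
  ultimately show ?thesis by blast
qed

text \<open>A lower bound for 2 |sin(z l)|. On the vertical sides exp(2 i z l) is a negative real
  number, so the two exponentials add up; on the horizontal sides one of them dominates as soon as
  |Im z| l >= 1.\<close>

lemma exp_difference_lower:
  assumes l: "l > 0" and r: "r = (real k + 1 / 2) * pi / l" "r \<ge> 1 / l"
    and z: "\<bar>Re z\<bar> = r \<or> \<bar>Im z\<bar> = r"
  shows "exp (\<bar>Im z\<bar> * l) / 2 \<le> norm (exp (- \<i> * z * l) - exp (\<i> * z * l))"
proof (cases "\<bar>Re z\<bar> = r")
  case True
  have "cos (2 * (Re z * l)) = -1 \<and> sin (2 * (Re z * l)) = 0"
  proof -
    have e: "2 * (r * l) = 2 * real k * pi + pi" using l by (simp add: r field_simps)
    have "cos (2 * (r * l)) = -1" "sin (2 * (r * l)) = 0"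
      unfolding e by (simp_all add: cos_2npi sin_2npi)
    then show ?thesis using True by (cases "Re z \<ge> 0") auto
  qed
  then have e: "exp (2 * \<i> * z * l) = - exp (- (2 * Im z * l))"
    by (simp add: complex_eq_iff Re_exp Im_exp algebra_simps)
  have "exp (- \<i> * z * l) - exp (\<i> * z * l) = exp (- \<i> * z * l) * (1 - exp (2 * \<i> * z * l))"
    by (simp add: algebra_simps exp_add[symmetric])
  then have "norm (exp (- \<i> * z * l) - exp (\<i> * z * l)) = exp (Im z * l) * norm (1 + complex_of_real (exp (- (2 * Im z * l))))"
    unfolding e by (simp add: norm_mult)
  also have "1 + complex_of_real (exp (- (2 * Im z * l))) = complex_of_real (1 + exp (- (2 * Im z * l)))" by simp
  also have "norm \<dots> = 1 + exp (- (2 * Im z * l))"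
    unfolding norm_of_real by (simp add: add_nonneg_nonneg)
  also have "exp (Im z * l) * \<dots> = exp (Im z * l) + exp (- Im z * l)"
    by (simp add: algebra_simps exp_add[symmetric])
  also have "\<dots> \<ge> exp (\<bar>Im z\<bar> * l)" by (cases "Im z \<ge> 0") auto
  finally show ?thesis using exp_ge_zero[of "\<bar>Im z\<bar> * l"] by linarith
next
  case False
  with z have "\<bar>Im z\<bar> = r" by auto
  then have "\<bar>Im z\<bar> * l \<ge> 1" using r(2) l by (simp add: field_simps)
  then have "exp (\<bar>Im z\<bar> * l) \<ge> 2" using exp_ge_add_one_self[of "\<bar>Im z\<bar> * l"] by linarith
  moreover have "exp (- (\<bar>Im z\<bar> * l)) \<le> 1" using l by simp
  ultimately have "exp (\<bar>Im z\<bar> * l) / 2 \<le> exp (\<bar>Im z\<bar> * l) - exp (- (\<bar>Im z\<bar> * l))" by linarith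
  also have "\<dots> \<le> \<bar>exp (Im z * l) - exp (- Im z * l)\<bar>" by (cases "Im z \<ge> 0") auto
  also have "\<dots> = \<bar>norm (exp (- \<i> * z * l)) - norm (exp (\<i> * z * l))\<bar>" by simp
  also have "\<dots> \<le> norm (exp (- \<i> * z * l) - exp (\<i> * z * l))" by (rule norm_triangle_ineq3)
  finally show ?thesis .
qed

lemma f_fun_lower:
  assumes u': "\<And>x. (u has_vector_derivative u' x) (at x)" "continuous_on UNIV u'" and l: "l > 0"
  shows "\<exists>R>0. \<forall>k z r. r = (real k + 1 / 2) * pi / l \<longrightarrow> r \<ge> R \<longrightarrow> \<bar>Re z\<bar> = r \<or> \<bar>Im z\<bar> = r \<longrightarrow>
     exp (\<bar>Im z\<bar> * l) / 8 \<le> norm (f_fun l u z)"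
proof -
  have u: "continuous_on UNIV u"
    using u'(1) has_vector_derivative_continuous continuous_at_imp_continuous_on by blast
  obtain C where C: "C > 0" "\<And>z. z \<noteq> 0 \<Longrightarrow> norm (y11 u z l - exp (- \<i> * z * l)) \<le> C / norm z * exp (\<bar>Im z\<bar> * l)"
    using y11_asymptotics[OF assms] by blast
  \<comment> \<open>Beyond 16 C each diagonal entry is within e/16 of its exponential. The
    difference of the exponentials is at least e/2, which leaves 3e/8 and, after division by 2, more
    than e/8.\<close>
  define R where "R = max (1 / l) (16 * C)"
  have "exp (\<bar>Im z\<bar> * l) / 8 \<le> norm (f_fun l u z)"
    if r: "r = (real k + 1 / 2) * pi / l" "r \<ge> R" and z: "\<bar>Re z\<bar> = r \<or> \<bar>Im z\<bar> = r" for r k z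
  proof -
    have rz: "r \<le> norm z" using z abs_Re_le_cmod[of z] abs_Im_le_cmod[of z] by auto
    have "r > 0" using r C(1) by (auto simp: R_def)
    then have z0: "z \<noteq> 0" "norm z > 0" using rz by auto
    define e where "e = exp (\<bar>Im z\<bar> * l)"
    have d1: "norm (y11 u z l - exp (- \<i> * z * l)) \<le> C / norm z * e" using C(2)[OF z0(1)] by (simp add: e_def)
    have "y22 u z l - exp (\<i> * z * l) = cnj (y11 u (cnj z) l - exp (- \<i> * cnj z * l))"
      by (simp add: y22_def exp_cnj)
    then have d2: "norm (y22 u z l - exp (\<i> * z * l)) \<le> C / norm z * e"
      using C(2)[of "cnj z"] z0 by (simp only: complex_mod_cnj e_def) simp
    have "C / norm z \<le> 1 / 16"
      using r(2) rz z0 C(1) by (simp add: R_def field_simps)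
    then have "C / norm z * e \<le> 1 / 16 * e" by (intro mult_right_mono) (auto simp: e_def)
    moreover have "e / 2 \<le> norm (exp (- \<i> * z * l) - exp (\<i> * z * l))"
      unfolding e_def using r by (intro exp_difference_lower[OF l r(1) _ z]) (auto simp: R_def)
    moreover have "norm (exp (- \<i> * z * l) - exp (\<i> * z * l)) \<le>
       norm (y11 u z l - y22 u z l) + norm (y11 u z l - exp (- \<i> * z * l)) + norm (y22 u z l - exp (\<i> * z * l))"
    proof -
      have "exp (- \<i> * z * l) - exp (\<i> * z * l) = ((y11 u z l - y22 u z l) - (y11 u z l - exp (- \<i> * z * l))) + (y22 u z l - exp (\<i> * z * l))"
        by simp
      then show ?thesis
        by (metis (no_types, lifting) add_right_mono norm_triangle_ineq norm_triangle_ineq4 order_trans)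
    qed
    ultimately have "3 / 8 * e \<le> norm (y11 u z l - y22 u z l)" using d1 d2 by linarith
    moreover have "norm (f_fun l u z) = norm (y11 u z l - y22 u z l) / 2"
      by (simp add: gap_functions[OF u] norm_divide norm_mult)
    moreover have "e \<ge> 0" by (simp add: e_def)
    ultimately show ?thesis unfolding e_def[symmetric] by linarith
  qed
  moreover have "R > 0" using C(1) by (auto simp: R_def less_max_iff_disj)
  ultimately show ?thesis by blast
qed

section \<open>Polynomials\<close>

lemma poly_map_cnj: "poly (map_poly cnj p) z = cnj (poly p (cnj z))"
  by (induction p) (auto simp: map_poly_pCons)

lemma degree_map_poly_cnj: "degree (map_poly cnj p) = degree p"
  by (rule degree_map_poly) simp

lemma lead_coeff_map_poly_cnj: "lead_coeff (map_poly cnj p) = cnj (lead_coeff p)"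
  by (simp add: degree_map_poly_cnj coeff_map_poly)

lemma poly_eq_zero_of_infinite_roots:
  fixes p :: "complex poly"
  assumes "infinite S" "\<And>z. z \<in> S \<Longrightarrow> poly p z = 0"
  shows "p = 0"
proof (rule ccontr)
  assume "p \<noteq> 0"
  then have "finite {z. poly p z = 0}" by (rule poly_roots_finite)
  with assms show False by (meson finite_subset mem_Collect_eq subsetI)
qed

lemma poly_norm_bound:
  fixes p :: "complex poly"
  shows "\<exists>C>0. \<forall>z. norm (poly p z) \<le> C * (1 + norm z) ^ degree p"
proof -
  define C where "C = 1 + (\<Sum>i\<le>degree p. norm (coeff p i))"
  have "norm (poly p z) \<le> C * (1 + norm z) ^ degree p" for z
  proof -
    have "norm (poly p z) \<le> (\<Sum>i\<le>degree p. norm (coeff p i * z ^ i))"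
      unfolding poly_altdef by (rule norm_sum)
    also have "\<dots> \<le> (\<Sum>i\<le>degree p. norm (coeff p i) * (1 + norm z) ^ degree p)"
    proof (intro sum_mono)
      fix i assume "i \<in> {..degree p}"
      then have "norm z ^ i \<le> (1 + norm z) ^ i" "(1 + norm z) ^ i \<le> (1 + norm z) ^ degree p"
        by (auto intro!: power_mono power_increasing)
      then show "norm (coeff p i * z ^ i) \<le> norm (coeff p i) * (1 + norm z) ^ degree p"
        by (auto simp: norm_mult norm_power intro!: mult_left_mono)
    qed
    also have "\<dots> = (\<Sum>i\<le>degree p. norm (coeff p i)) * (1 + norm z) ^ degree p"
      by (simp add: sum_distrib_right)
    also have "\<dots> \<le> C * (1 + norm z) ^ degree p" unfolding C_def by (intro mult_right_mono) auto
    finally show ?thesis .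
  qed
  moreover have "C > 0" unfolding C_def by (intro add_pos_nonneg sum_nonneg) auto
  ultimately show ?thesis by blast
qed

section \<open>Coefficients from values, and from growth on squares\<close>

lemma poly_eq_sum_monom:
  fixes c :: "nat \<Rightarrow> complex"
  shows "poly (\<Sum>i\<le>N. monom (c i) i) z = (\<Sum>i\<le>N. c i * z ^ i)"
    "k \<le> N \<Longrightarrow> coeff (\<Sum>i\<le>N. monom (c i) i) k = c k" "degree (\<Sum>i\<le>N. monom (c i) i) \<le> N"
  by (auto simp: poly_sum poly_monom coeff_sum intro!: degree_sum_le order_trans[OF degree_monom_le])

text \<open>Lagrange interpolation at \<open>0, \<dots>, N\<close>. It transfers bounds and derivatives from values to
  coefficients.\<close>

lemma coefficient_functional:
  "\<exists>\<gamma>. \<forall>c :: nat \<Rightarrow> complex. \<forall>k\<le>N. c k = (\<Sum>m\<le>N. \<gamma> k m * (\<Sum>i\<le>N. c i * of_nat m ^ i))"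
proof -
  define L where "L m = (\<Prod>j\<in>{..N} - {m}. smult (inverse (of_nat m - of_nat j)) [:- of_nat j, 1 :: complex:])"
    for m :: nat
  have L: "poly (L m) (of_nat k) = (if k = m then 1 else 0 :: complex)" if "k \<le> N" "m \<le> N" for k m
  proof (cases "k = m")
    case True
    have "poly (smult (inverse (of_nat m - of_nat j)) [:- of_nat j, 1 :: complex:]) (of_nat m) = 1"
      if "j \<noteq> m" for j
    proof -
      have "of_nat m - of_nat j \<noteq> (0 :: complex)" using that by simp
      then show ?thesis by (simp add: divide_simps flip: right_diff_distrib divide_inverse)
    qed
    then show ?thesis unfolding L_def poly_prod True by (simp del: poly_smult)
  next
    case False
    then show ?thesis using that by (auto simp: L_def poly_prod)
  qed
  have dL: "degree (L m) \<le> N" if "m \<le> N" for m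
  proof -
    have "degree (L m) \<le> (\<Sum>j\<in>{..N} - {m}. degree (smult (inverse (of_nat m - of_nat j)) [:- of_nat j, 1 :: complex:]))"
      unfolding L_def by (rule order_trans[OF degree_prod_sum_le]) (auto simp: o_def)
    also have "\<dots> \<le> (\<Sum>j\<in>{..N} - {m}. 1)"
      by (intro sum_mono order_trans[OF degree_smult_le]) auto
    also have "\<dots> = N" using that by simp
    finally show ?thesis .
  qed
  have "c k = (\<Sum>m\<le>N. coeff (L m) k * (\<Sum>i\<le>N. c i * of_nat m ^ i))" if "k \<le> N" for c :: "nat \<Rightarrow> complex" and k
  proof -
    define p where "p = (\<Sum>i\<le>N. monom (c i) i)"
    define s where "s = (\<Sum>m\<le>N. smult (poly p (of_nat m)) (L m))"
    have "p - s = 0"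
    proof (rule ccontr)
      assume nz: "p - s \<noteq> 0"
      have "poly s (of_nat k) = poly p (of_nat k)" if "k \<le> N" for k
      proof -
        have "poly s (of_nat k) = (\<Sum>m\<le>N. if k = m then poly p (of_nat m) else 0)"
          unfolding s_def poly_sum using that by (intro sum.cong) (auto simp: L)
        then show ?thesis using that by simp
      qed
      then have "of_nat ` {..N} \<subseteq> {z. poly (p - s) z = 0}" by auto
      moreover have "finite {z. poly (p - s) z = 0}" by (rule poly_roots_finite[OF nz])
      ultimately have "card (of_nat ` {..N} :: complex set) \<le> card {z. poly (p - s) z = 0}"
        by (intro card_mono)
      also have "card (of_nat ` {..N} :: complex set) = N + 1"
        by (subst card_image) (auto simp: inj_on_def)
      finally have "N + 1 \<le> degree (p - s)"
        using card_poly_roots_bound[OF nz] by linarith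
      moreover have "degree s \<le> N" unfolding s_def
        by (intro degree_sum_le order_trans[OF degree_smult_le] dL) auto
      moreover have "degree p \<le> N" unfolding p_def by (rule poly_eq_sum_monom)
      ultimately show False using degree_diff_le[of p N s] by simp
    qed
    then have "coeff p k = coeff s k" by simp
    then show ?thesis
      unfolding s_def coeff_sum coeff_smult p_def poly_eq_sum_monom poly_eq_sum_monom(2)[OF that]
      using that by (simp add: mult.commute)
  qed
  then show ?thesis by (intro exI[of _ "\<lambda>k m. coeff (L m) k"]) blast
qed

lemma coefficients_unique:
  fixes c d :: "nat \<Rightarrow> complex"
  assumes "\<And>z. (\<Sum>i\<le>N. c i * z ^ i) = (\<Sum>i\<le>N. d i * z ^ i)" "k \<le> N"
  shows "c k = d k"
proof -
  obtain \<gamma> where \<gamma>: "\<And>c :: nat \<Rightarrow> complex. \<And>k. k \<le> N \<Longrightarrow> c k = (\<Sum>m\<le>N. \<gamma> k m * (\<Sum>i\<le>N. c i * of_nat m ^ i))"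
    using coefficient_functional[of N] by blast
  show ?thesis using \<gamma>[OF assms(2), of c] \<gamma>[OF assms(2), of d] unfolding assms(1) by simp
qed

lemma coefficients_has_vector_derivative:
  fixes c :: "real \<Rightarrow> nat \<Rightarrow> complex"
  assumes "\<And>m::nat. ((\<lambda>x. \<Sum>i\<le>N. c x i * of_nat m ^ i) has_vector_derivative (\<Sum>i\<le>N. d i * of_nat m ^ i)) (at x)"
    and "k \<le> N"
  shows "((\<lambda>x. c x k) has_vector_derivative d k) (at x)"
proof -
  obtain \<gamma> where \<gamma>: "\<And>c :: nat \<Rightarrow> complex. \<And>k. k \<le> N \<Longrightarrow> c k = (\<Sum>m\<le>N. \<gamma> k m * (\<Sum>i\<le>N. c i * of_nat m ^ i))"
    using coefficient_functional[of N] by blast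
  have "((\<lambda>x. \<Sum>m\<le>N. \<gamma> k m * (\<Sum>i\<le>N. c x i * of_nat m ^ i)) has_vector_derivative
      (\<Sum>m\<le>N. \<gamma> k m * (\<Sum>i\<le>N. d i * of_nat m ^ i))) (at x)"
    by (intro has_vector_derivative_sum has_vector_derivative_mult_right assms)
  moreover have "(\<lambda>x. \<Sum>m\<le>N. \<gamma> k m * (\<Sum>i\<le>N. c x i * of_nat m ^ i)) = (\<lambda>x. c x k)"
    using \<gamma>[OF assms(2), of "c _"] by simp
  moreover have "(\<Sum>m\<le>N. \<gamma> k m * (\<Sum>i\<le>N. d i * of_nat m ^ i)) = d k"
    using \<gamma>[OF assms(2), of d] by simp
  ultimately show ?thesis by simp
qed

text \<open>By the maximum principle a bound on the boundary of a square holds inside it. Every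
  large z lies in a square of comparable size, so the bound holds for all large z and Liouville's
  theorem applies.\<close>

lemma entire_bounded_on_squares_imp_polynomial:
  assumes hol: "g holomorphic_on UNIV" and l: "l > 0" and C: "C > 0"
    and b: "\<And>k z r. r = (real k + 1 / 2) * pi / l \<Longrightarrow> r \<ge> R \<Longrightarrow> \<bar>Re z\<bar> = r \<or> \<bar>Im z\<bar> = r \<Longrightarrow>
      norm (g z) \<le> C * (1 + norm z) ^ N"
  shows "\<exists>c. \<forall>z. g z = (\<Sum>k\<le>N. c k * z ^ k)"
proof -
  \<comment> \<open>|z| >= pi / l bounds the spacing of the squares by |z|, whence r <= 3 |z|. A
    boundary point then has modulus at most 6 |z|, and |z| >= 1 gives the factor 7.\<close>
  define A where "A = max R (max (pi / l) 1)"
  have "norm (g z) \<le> C * 7 ^ N * norm z ^ N" if z: "norm z \<ge> A" for z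
  proof -
    define k where "k = nat \<lceil>norm z * l / pi\<rceil>"
    define r where "r = (real k + 1 / 2) * pi / l"
    have nz: "norm z > 0" "norm z \<ge> 1" "norm z \<ge> R" "pi / l \<le> norm z" using z by (auto simp: A_def)
    have "norm z * l / pi \<ge> 0" using l by simp
    then have k: "norm z * l / pi \<le> real k" "real k \<le> norm z * l / pi + 1"
      unfolding k_def by linarith+
    have rz: "norm z \<le> r"
    proof -
      have "norm z * l \<le> real k * pi" using k(1) by (simp add: field_simps)
      also have "\<dots> \<le> (real k + 1/2) * pi" by simp
      finally show ?thesis using l by (simp add: r_def field_simps)
    qed
    have r3: "r \<le> 3 * norm z"
    proof -
      define s where "s = pi / l"
      have s: "s \<le> norm z" using nz(4) by (simp add: s_def)
      have "real k * pi / l \<le> (norm z * l / pi + 1) * pi / l" using k(2) l by (intro divide_right_mono mult_right_mono) auto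
      also have "\<dots> = norm z + s" using l by (simp add: s_def field_simps)
      finally have "real k * pi / l \<le> norm z + s" .
      moreover have "r = real k * pi / l + s / 2"
        using l by (simp add: r_def s_def add_divide_distrib ring_distribs)
      ultimately show ?thesis using nz(1) s by argo
    qed
    have r0: "r > 0" using rz nz(1) by linarith
    define S where "S = cbox (Complex (- r) (- r)) (Complex r r)"
    show ?thesis
    proof (rule maximum_modulus_frontier[where S = S and f = g and \<xi> = z])
      show "g holomorphic_on interior S" by (rule holomorphic_on_subset[OF hol]) auto
      show "continuous_on (closure S) g"
        by (rule continuous_on_subset[OF holomorphic_on_imp_continuous_on[OF hol]]) auto
      show "bounded S" by (simp add: S_def bounded_cbox)
      show "z \<in> S"
        using abs_Re_le_cmod[of z] abs_Im_le_cmod[of z] rz by (auto simp: S_def in_cbox_complex_iff)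
      fix w assume "w \<in> frontier S"
      then have w: "w \<in> cbox (Complex (- r) (- r)) (Complex r r)" "w \<notin> box (Complex (- r) (- r)) (Complex r r)"
        by (auto simp: S_def frontier_cbox)
      then have "\<bar>Re w\<bar> = r \<or> \<bar>Im w\<bar> = r" "\<bar>Re w\<bar> \<le> r" "\<bar>Im w\<bar> \<le> r"
        by (auto simp: in_cbox_complex_iff in_box_complex_iff)
      note w = this
      have "norm w \<le> 2 * r" using cmod_le[of w] w by linarith
      then have w7: "1 + norm w \<le> 7 * norm z" using r3 nz(2) by linarith
      have "norm (g w) \<le> C * (1 + norm w) ^ N"
        by (rule b[OF r_def _ w(1)]) (use nz rz in linarith)
      also have "\<dots> \<le> C * (7 * norm z) ^ N" using C w7 by (intro mult_left_mono power_mono) auto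
      finally show "norm (g w) \<le> C * 7 ^ N * norm z ^ N" by (simp add: power_mult_distrib)
    qed
  qed
  from Liouville_polynomial[OF hol this] show ?thesis
    by (intro exI[of _ "\<lambda>k. (deriv ^^ k) g 0 / fact k"]) blast
qed

section \<open>The polynomial solution of the Lax equation\<close>

lemma periodic_C2_continuous:
  assumes "periodic_C2 l u"
  obtains u' where "\<And>x. (u has_vector_derivative u' x) (at x)" "continuous_on UNIV u'" "continuous_on UNIV u"
proof -
  obtain u' u'' where d: "\<And>x. (u has_vector_derivative u' x) (at x)" "\<And>x. (u' has_vector_derivative u'' x) (at x)"
    using assms by (auto simp: periodic_C2_def)
  have "continuous_on UNIV u'" "continuous_on UNIV u"
    using has_vector_derivative_continuous[OF d(1)] has_vector_derivative_continuous[OF d(2)]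
    by (simp_all add: continuous_on_eq_continuous_at)
  with d(1) show ?thesis by (rule that)
qed

text \<open>\<open>F j x\<close> and \<open>G j x\<close> are the coefficients of \<open>z ^ (N - j)\<close> in the entries of
  \<open>L = Y P adj(Y)\<close>, where \<open>P\<close> consists of \<open>f0\<close>, \<open>psi0\<close>, \<open>phi0\<close> multiplied by the conjugate
  polynomial of \<open>f0\<close>. This factor makes \<open>L\<close> anti-hermitian for real \<open>z\<close> although \<open>f0\<close>, \<open>psi0\<close> and
  \<open>phi0\<close> may share nonreal zeros; it is divided out again at the end.\<close>

lemma gap_lax_coefficients:
  assumes l: "l > 0" and per: "periodic_C2 l u" and "h holomorphic_on UNIV"
    and f0: "lead_coeff f0 = 1" "degree f0 = n + 1"
    and gap: "\<And>z. f_fun l u z = poly f0 z * h z" "\<And>z. psi_fun l u z = poly psi0 z * h z"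
      "\<And>z. phi_fun l u z = poly phi0 z * h z"
    and N: "N = 2 * n + 2"
  obtains F :: "nat \<Rightarrow> real \<Rightarrow> real" and G :: "nat \<Rightarrow> real \<Rightarrow> complex" where
    "\<And>x. F 0 x = 1" "\<And>x. G 0 x = 0" "\<And>x. G 1 x = u x" "\<And>j x. j > N \<Longrightarrow> F j x = 0" "\<And>j x. j > N \<Longrightarrow> G j x = 0"
    "\<And>j x. F j (x + l) = F j x" "\<And>j x. G j (x + l) = G j x"
    "\<And>j x. (F j has_vector_derivative - 2 * Im (cnj (u x) * G j x)) (at x)"
    "\<And>j x. (G j has_vector_derivative - 2 * \<i> * G (j + 1) x + 2 * \<i> * u x * F j x) (at x)"
    "\<And>z :: complex. (\<Sum>j\<le>N. F j 0 * z ^ (N - j)) = poly (map_poly cnj f0) z * poly f0 z"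
    "\<And>z. (\<Sum>j\<le>N. G j 0 * z ^ (N - j)) = poly (map_poly cnj f0) z * poly psi0 z"
    "\<And>z. - (\<Sum>j\<le>N. cnj (G j 0) * z ^ (N - j)) = poly (map_poly cnj f0) z * poly phi0 z"
proof -
  define q where "q = map_poly cnj f0"
  have q: "poly q z = cnj (poly f0 (cnj z))" for z by (simp add: q_def poly_map_cnj)
  have dq: "degree q = n + 1" "lead_coeff q = 1"
    unfolding q_def by (simp only: degree_map_poly_cnj f0(2))
      (simp only: lead_coeff_map_poly_cnj f0(1) complex_cnj_one)
  obtain u' where u': "\<And>x. (u has_vector_derivative u' x) (at x)" "continuous_on UNIV u'"
    and u: "continuous_on UNIV u" by (rule periodic_C2_continuous[OF per]) blast
  have up: "\<And>x. u (x + l) = u x" using per by (simp add: periodic_C2_def)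
  have nz: "f0 \<noteq> 0" "q \<noteq> 0" using f0 dq by auto
  obtain R where R: "R > 0" "\<And>k z r. r = (real k + 1 / 2) * pi / l \<Longrightarrow> r \<ge> R \<Longrightarrow> \<bar>Re z\<bar> = r \<or> \<bar>Im z\<bar> = r \<Longrightarrow>
     exp (\<bar>Im z\<bar> * l) / 8 \<le> norm (f_fun l u z)"
    using f_fun_lower[OF u' l] by blast
  have gs: "cnj (f_fun l u (cnj z)) = f_fun l u z" "cnj (psi_fun l u (cnj z)) = - phi_fun l u z" for z
    by (simp_all add: gap_functions[OF u] y_symmetry divide_simps) (simp add: algebra_simps)
  \<comment> \<open>Checked at the real points (k + 1/2) pi / l, where \<open>f_fun\<close> and
    hence \<open>h\<close> do not vanish. The symmetry of the monodromy matrix gives two relations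
    between \<open>h\<close> and its conjugate there; cross-multiplied, they no longer contain
    either.\<close>
  have sym: "phi0 * q + map_poly cnj psi0 * f0 = 0"
  proof (rule poly_eq_zero_of_infinite_roots)
    define S where "S = (\<lambda>k. complex_of_real ((real k + 1 / 2) * pi / l)) ` {k. (real k + 1 / 2) * pi / l \<ge> R}"
    have "infinite {k::nat. (real k + 1 / 2) * pi / l \<ge> R}"
    proof -
      have "eventually (\<lambda>k::nat. (real k + 1 / 2) * pi / l \<ge> R) sequentially"
      proof -
        have "filterlim (\<lambda>k::nat. (real k + 1 / 2) * pi / l) at_top sequentially"
          using l by real_asymp
        then show ?thesis by (simp add: filterlim_at_top)
      qed
      then show ?thesis
        by (metis (mono_tags, lifting) eventually_sequentially infinite_nat_iff_unbounded_le mem_Collect_eq nat_le_linear)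
    qed
    moreover have "inj_on (\<lambda>k. complex_of_real ((real k + 1 / 2) * pi / l)) A" for A :: "nat set"
      using l by (auto simp: inj_on_def)
    ultimately show "infinite S" unfolding S_def by (simp add: finite_image_iff)
    fix z assume "z \<in> S"
    then obtain k where k: "z = complex_of_real ((real k + 1 / 2) * pi / l)" "(real k + 1 / 2) * pi / l \<ge> R"
      by (auto simp: S_def)
    then have zr: "cnj z = z" by simp
    have "exp (\<bar>Im z\<bar> * l) / 8 \<le> norm (f_fun l u z)"
      by (rule R(2)[OF refl k(2)]) (use k R(1) l in auto)
    then have "f_fun l u z \<noteq> 0" using exp_gt_zero[of "\<bar>Im z\<bar> * l"] by (smt (verit) divide_pos_pos norm_zero zero_less_numeral)
    then have hz: "h z \<noteq> 0" by (auto simp: gap)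
    have 1: "poly f0 z * h z = poly q z * cnj (h z)"
      using gs(1)[of z] by (simp add: gap zr q)
    have 2: "poly (map_poly cnj psi0) z * cnj (h z) = - (poly phi0 z * h z)"
      using gs(2)[of z] by (simp add: gap zr poly_map_cnj)
    have "(poly phi0 z * poly q z + poly (map_poly cnj psi0) z * poly f0 z) * (h z * cnj (h z)) =
        (poly phi0 z * h z) * (poly q z * cnj (h z)) + (poly (map_poly cnj psi0) z * cnj (h z)) * (poly f0 z * h z)"
      by (simp add: algebra_simps)
    also have "\<dots> = 0" unfolding 2 1 by simp
    finally show "poly (phi0 * q + map_poly cnj psi0 * f0) z = 0" using hz by simp
  qed
  have sym': "poly (map_poly cnj psi0) z * poly f0 z = - (poly q z * poly phi0 z)" for z
  proof -
    have "poly (phi0 * q + map_poly cnj psi0 * f0) z = 0" by (simp add: sym)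
    then show ?thesis by (simp add: add_eq_0_iff algebra_simps)
  qed
  define A where "A z = poly q z * poly f0 z" for z
  define B where "B z = poly q z * poly psi0 z" for z
  define D where "D z = poly q z * poly phi0 z" for z
  note ABD = A_def B_def D_def
  have sA: "cnj (A (cnj z)) = A z" and sB: "cnj (B (cnj z)) = - D z" and sD: "cnj (D (cnj z)) = - B z" for z
    using sym'[of z] sym'[of "cnj z", THEN arg_cong[where f = cnj]]
    by (simp_all add: ABD q poly_map_cnj mult_ac)
  define LF where "LF x z = conjF (y11 u z x) (y21 u z x) (y12 u z x) (y22 u z x) (A z) (B z) (D z)" for x z
  define LG where "LG x z = conjG (y11 u z x) (y21 u z x) (y12 u z x) (y22 u z x) (A z) (B z) (D z)" for x z
  define LH where "LH x z = conjH (y11 u z x) (y21 u z x) (y12 u z x) (y22 u z x) (A z) (B z) (D z)" for x z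
  note L_defs = LF_def LG_def LH_def
  have Lh: "h z * LF x z = poly q z * conjF (y11 u z x) (y21 u z x) (y12 u z x) (y22 u z x) (f_fun l u z) (psi_fun l u z) (phi_fun l u z)"
    "h z * LG x z = poly q z * conjG (y11 u z x) (y21 u z x) (y12 u z x) (y22 u z x) (f_fun l u z) (psi_fun l u z) (phi_fun l u z)" for x z
    unfolding L_defs ABD conj_scale[symmetric] gap by (simp_all add: mult_ac)
  have hol: "LF x holomorphic_on UNIV" "LG x holomorphic_on UNIV" for x
    unfolding LF_def[abs_def] LG_def[abs_def] ABD conj_defs by (intro holomorphic_intros zs_holomorphic u poly_holomorphic_on)+
  obtain C where C: "C > 0" "\<And>z. norm (poly (q * f0) z) \<le> C * (1 + norm z) ^ degree (q * f0)"
    using poly_norm_bound by blast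
  have dN: "degree (q * f0) = N"
    using f0 dq nz by (simp add: degree_mult_eq N)
  have lcN: "lead_coeff (q * f0) = 1"
    unfolding lead_coeff_mult f0(1) dq(2) by simp
  have "norm (LF x z) \<le> 8 * C * (1 + norm z) ^ N \<and> norm (LG x z) \<le> 8 * C * (1 + norm z) ^ N"
    if r: "r = (real k + 1 / 2) * pi / l" "r \<ge> R" "\<bar>Re z\<bar> = r \<or> \<bar>Im z\<bar> = r" for k z r x
  proof -
    define e where "e = exp (\<bar>Im z\<bar> * l)"
    have e: "e > 0" "e / 8 \<le> norm (f_fun l u z)" using R(2)[OF r] by (auto simp: e_def)
    \<comment> \<open>Multiplying \<open>X\<close> by f = f0 h, instead of dividing by
      \<open>h\<close>, keeps the estimate free of the zeros of \<open>h\<close>; the factor e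
      cancels, and the 8 is that of \<open>f_fun_lower\<close>.\<close>
    have *: "norm X \<le> 8 * C * (1 + norm z) ^ N" if X: "h z * X = poly q z * Y" "norm Y \<le> e" for X Y
    proof -
      have "norm X * (e / 8) \<le> norm X * norm (f_fun l u z)" using e by (intro mult_left_mono) auto
      also have "\<dots> = norm (h z * X) * norm (poly f0 z)" by (simp add: gap norm_mult mult_ac)
      also have "\<dots> = norm (poly (q * f0) z) * norm Y" by (simp only: X(1)) (simp add: norm_mult mult_ac)
      also have "\<dots> \<le> C * (1 + norm z) ^ N * e"
        using C X(2) e unfolding dN by (intro mult_mono) (auto intro!: mult_nonneg_nonneg less_imp_le)
      finally show ?thesis using e by (simp add: field_simps)
    qed
    show ?thesis
      using *[OF Lh(1)] *[OF Lh(2)] monodromy_at_bound[OF u up l, of z x] by (simp add: e_def)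
  qed
  note bound = this
  have "\<exists>c. \<forall>z. LF x z = (\<Sum>k\<le>N. c k * z ^ k)" "\<exists>c. \<forall>z. LG x z = (\<Sum>k\<le>N. c k * z ^ k)" for x
    using bound C(1)
    by (auto intro!: entire_bounded_on_squares_imp_polynomial[OF hol(1) l, of "8 * C" R]
        entire_bounded_on_squares_imp_polynomial[OF hol(2) l, of "8 * C" R])
  then obtain a0 b0 where ab0: "\<And>x z. LF x z = (\<Sum>k\<le>N. a0 x k * z ^ k)" "\<And>x z. LG x z = (\<Sum>k\<le>N. b0 x k * z ^ k)"
    by metis
  define a where "a x k = (if k \<le> N then a0 x k else 0)" for x k
  define b where "b x k = (if k \<le> N then b0 x k else 0)" for x k
  have ab: "LF x z = (\<Sum>k\<le>N. a x k * z ^ k)" "LG x z = (\<Sum>k\<le>N. b x k * z ^ k)" for x z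
    by (simp_all add: ab0 a_def b_def)
  \<comment> \<open>The Lax equation multiplies \<open>LG\<close> by z. Padding with a zero
    coefficient at N + 1 makes room for the resulting top term, and its vanishing is the information
    used in \<open>bN\<close>.\<close>
  have ab1: "LF x z = (\<Sum>k\<le>N+1. a x k * z ^ k)" "LG x z = (\<Sum>k\<le>N+1. b x k * z ^ k)" for x z
    by (simp_all add: ab0 a_def b_def)
  have Lsym: "cnj (LF x (cnj z)) = LF x z" "cnj (LG x (cnj z)) = - LH x z" for x z
    by (simp_all add: L_defs conj_defs y_symmetry sA sB sD algebra_simps)
  have LH: "LH x z = - (\<Sum>k\<le>N. cnj (b x k) * z ^ k)" for x z
  proof -
    have "LH x z = - cnj (LG x (cnj z))" by (simp add: Lsym)
    also have "\<dots> = - (\<Sum>k\<le>N. cnj (b x k) * z ^ k)" by (simp add: ab)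
    finally show ?thesis .
  qed
  have ar: "cnj (a x k) = a x k" for x k
  proof (cases "k \<le> N")
    case True
    have "(\<Sum>i\<le>N. cnj (a x i) * z ^ i) = (\<Sum>i\<le>N. a x i * z ^ i)" for z
      using Lsym(1)[of x z] by (simp add: ab)
    then show ?thesis by (rule coefficients_unique[OF _ True])
  qed (simp add: a_def)
  have lax: "sol3 (\<lambda>_. - \<i> * z) (\<lambda>x. - u x) (\<lambda>x. cnj (u x)) (\<lambda>x. LF x z) (\<lambda>x. LG x z) (\<lambda>x. LH x z)" for z
    unfolding L_defs by (intro sol3_conj zs_column1[OF u, unfolded zs_def] zs_column2[OF u, unfolded zs_def])
  have ad: "((\<lambda>x. a x k) has_vector_derivative \<i> * (cnj (u x) * b x k - u x * cnj (b x k))) (at x)" for k x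
  proof (cases "k \<le> N")
    case True
    show ?thesis
    proof (rule coefficients_has_vector_derivative[OF _ True])
      fix m :: nat
      have "((\<lambda>x. LF x (of_nat m)) has_vector_derivative - \<i> * (- u x * LH x (of_nat m) - cnj (u x) * LG x (of_nat m))) (at x)"
        using lax[of "of_nat m"] by (simp add: sol3_def)
      then show "((\<lambda>x. \<Sum>i\<le>N. a x i * of_nat m ^ i) has_vector_derivative
          (\<Sum>i\<le>N. \<i> * (cnj (u x) * b x i - u x * cnj (b x i)) * of_nat m ^ i)) (at x)"
        unfolding ab(1)[symmetric]
        by (rule has_vector_derivative_eq_rhs)
          (simp add: LH ab(2) sum_distrib_left sum_negf[symmetric] sum_subtractf[symmetric] sum.distrib[symmetric] algebra_simps)
    qed
  qed (simp add: a_def b_def)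
  have bd: "((\<lambda>x. b x k) has_vector_derivative - 2 * \<i> * (if k = 0 then 0 else b x (k - 1)) + 2 * \<i> * u x * a x k) (at x)"
    if k: "k \<le> N + 1" for k x
  proof (rule coefficients_has_vector_derivative[OF _ k])
    fix m :: nat
    have shift: "of_nat m * (\<Sum>i\<le>N. b x i * of_nat m ^ i) = (\<Sum>i\<le>N+1. (if i = 0 then 0 else b x (i - 1)) * of_nat m ^ i)"
      by (simp add: sum.atMost_Suc_shift sum_distrib_left mult_ac del: sum.atMost_Suc)
    have "((\<lambda>x. LG x (of_nat m)) has_vector_derivative 2 * (- \<i> * of_nat m) * LG x (of_nat m) - 2 * \<i> * - u x * LF x (of_nat m)) (at x)"
      using lax[of "of_nat m"] unfolding sol3_def by blast
    also have "2 * (- \<i> * of_nat m) * LG x (of_nat m) - 2 * \<i> * - u x * LF x (of_nat m) =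
       - 2 * \<i> * (of_nat m * (\<Sum>i\<le>N. b x i * of_nat m ^ i)) + 2 * \<i> * u x * (\<Sum>i\<le>N+1. a x i * of_nat m ^ i)"
      by (simp only: ab(2) ab1(1)) (simp add: algebra_simps)
    also have "\<dots> = (\<Sum>i\<le>N+1. (- 2 * \<i> * (if i = 0 then 0 else b x (i - 1)) + 2 * \<i> * u x * a x i) * of_nat m ^ i)"
      unfolding shift unfolding sum_distrib_left sum.distrib[symmetric] by (intro sum.cong) (auto simp: algebra_simps)
    finally show "((\<lambda>x. \<Sum>i\<le>N+1. b x i * of_nat m ^ i) has_vector_derivative
        (\<Sum>i\<le>N+1. (- 2 * \<i> * (if i = 0 then 0 else b x (i - 1)) + 2 * \<i> * u x * a x i) * of_nat m ^ i)) (at x)"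
      unfolding ab1(2)[symmetric] .
  qed
  have N0: "N \<noteq> 0" "1 \<le> N" by (simp_all add: N)
  \<comment> \<open>The coefficient at N + 1 is identically zero, while the recursion says that its
    derivative is - 2 i b x N.\<close>
  have bN: "b x N = 0" for x
  proof -
    have "((\<lambda>x. b x (N + 1)) has_vector_derivative - 2 * \<i> * b x N) (at x)"
      using bd[of "N + 1" x] by (simp add: a_def)
    moreover have "((\<lambda>x. b x (N + 1)) has_vector_derivative 0) (at x)" by (simp add: b_def)
    ultimately have "- 2 * \<i> * b x N = 0" by (rule vector_derivative_unique_at)
    then show ?thesis by simp
  qed
  have L0: "LF 0 z = poly q z * poly f0 z" "LG 0 z = poly q z * poly psi0 z" "LH 0 z = poly q z * poly phi0 z" for z
    using zs_column1[OF u] zs_column2[OF u] by (simp_all add: L_defs conj_defs flip: ABD)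
  have aN: "a x N = 1" for x
  proof -
    have "((\<lambda>x. a x N) has_vector_derivative 0) (at x)" for x using ad[of N x] by (simp add: bN)
    then have "a x N = a 0 N" by (rule const_of_zero_vector_derivative)
    also have "a 0 N = coeff (q * f0) N"
    proof (rule coefficients_unique[where N = N])
      fix z
      have "(\<Sum>i\<le>N. a 0 i * z ^ i) = poly (q * f0) z" by (simp add: L0 flip: ab)
      also have "\<dots> = (\<Sum>i\<le>N. coeff (q * f0) i * z ^ i)" unfolding poly_altdef dN ..
      finally show "(\<Sum>i\<le>N. a 0 i * z ^ i) = (\<Sum>i\<le>N. coeff (q * f0) i * z ^ i)" .
    qed simp
    also have "\<dots> = 1" using lcN dN by simp
    finally show ?thesis .
  qed
  \<comment> \<open>The same argument one degree lower: \<open>b x N\<close> vanishes identically,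
    so its derivative forces the next coefficient to be the potential. Here \<open>aN\<close> enters
    as normalisation.\<close>
  have bN1: "b x (N - 1) = u x" for x
  proof -
    have "((\<lambda>x. b x N) has_vector_derivative - 2 * \<i> * b x (N - 1) + 2 * \<i> * u x) (at x)"
      using bd[of N x] N0 by (simp add: aN)
    moreover have "((\<lambda>x. b x N) has_vector_derivative 0) (at x)" by (simp add: bN)
    ultimately have "- 2 * \<i> * b x (N - 1) + 2 * \<i> * u x = 0" by (rule vector_derivative_unique_at)
    then have "2 * \<i> * (u x - b x (N - 1)) = 0" by (simp add: algebra_simps)
    then show ?thesis by simp
  qed
  \<comment> \<open>The monodromy matrix is M = c I + h P, with c half its trace and P made of
    \<open>f0\<close>, \<open>psi0\<close>, \<open>phi0\<close>. It commutes with P, so M P adj(M) =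
    det(M) P = P, which is what Y(x + l) = Y(x) M requires.\<close>
  have Lper: "LF (x + l) z = LF x z" "LG (x + l) z = LG x z" for x z
  proof -
    define c where "c = (y11 u z l + y22 u z l) / 2"
    have y: "y11 u z l = c + \<i> * (poly f0 z * h z)" "y22 u z l = c - \<i> * (poly f0 z * h z)"
      "y12 u z l = poly psi0 z * h z" "y21 u z l = poly phi0 z * h z"
      using gap[of z] by (simp_all add: gap_functions[OF u] c_def field_simps)
    have d: "c * c + (poly f0 z * poly f0 z - poly psi0 z * poly phi0 z) * (h z * h z) = 1"
      using zs_det[OF u, of z l] unfolding y by (simp add: algebra_simps)
    have "LF (x + l) z = (c * c + (poly f0 z * poly f0 z - poly psi0 z * poly phi0 z) * (h z * h z)) * LF x z"
      "LG (x + l) z = (c * c + (poly f0 z * poly f0 z - poly psi0 z * poly phi0 z) * (h z * h z)) * LG x z"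
      unfolding L_defs ABD conj_defs zs_shift_period[OF u up] y by (simp_all add: algebra_simps)
    then show "LF (x + l) z = LF x z" "LG (x + l) z = LG x z" unfolding d by simp_all
  qed
  have abper: "a (x + l) k = a x k" "b (x + l) k = b x k" for x k
  proof -
    have *: "(\<Sum>i\<le>N. a (x + l) i * z ^ i) = (\<Sum>i\<le>N. a x i * z ^ i)"
      "(\<Sum>i\<le>N. b (x + l) i * z ^ i) = (\<Sum>i\<le>N. b x i * z ^ i)" for z
      by (simp_all add: Lper flip: ab)
    show "a (x + l) k = a x k" "b (x + l) k = b x k"
      using coefficients_unique[OF *(1)] coefficients_unique[OF *(2)] by (cases "k \<le> N"; simp add: a_def b_def)+
  qed
  \<comment> \<open>Indexing from the top degree downwards fixes the places of the leading entries
    1, 0 and \<open>u\<close>, and turns multiplication by z into the shift j + 1.\<close>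
  define F where "F j x = (if j \<le> N then Re (a x (N - j)) else 0)" for j x
  define G where "G j x = (if j \<le> N then b x (N - j) else 0)" for j x
  have Fa: "complex_of_real (F j x) = a x (N - j)" if "j \<le> N" for j x
    using ar[of x "N - j"] that by (simp add: F_def complex_eq_iff)
  have rev: "(\<Sum>j\<le>N. c (N - j) * z ^ (N - j)) = (\<Sum>k\<le>N. c k * z ^ k)" for c :: "nat \<Rightarrow> complex" and z
    by (rule sum.nat_diff_reindex[of "\<lambda>k. c k * z ^ k" "Suc N", unfolded lessThan_Suc_atMost, simplified])
  show ?thesis
  proof (rule that[of F G])
    show "F 0 x = 1" "G 0 x = 0" "G 1 x = u x" for x
      using N0 bN1[of x] by (simp_all add: F_def G_def aN bN)
    show "F j x = 0" "G j x = 0" if "j > N" for j x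
      using that by (simp_all add: F_def G_def)
    show "F j (x + l) = F j x" "G j (x + l) = G j x" for j x
      by (simp_all add: F_def G_def abper)
    show "(F j has_vector_derivative - 2 * Im (cnj (u x) * G j x)) (at x)" for j x
    proof (cases "j \<le> N")
      case True
      have "((\<lambda>x. Re (a x (N - j))) has_vector_derivative Re (\<i> * (cnj (u x) * b x (N - j) - u x * cnj (b x (N - j))))) (at x)"
        by (intro bounded_linear.has_vector_derivative[OF bounded_linear_Re] ad)
      then show ?thesis using True by (simp add: F_def[abs_def] G_def algebra_simps)
    qed (simp add: F_def[abs_def] G_def)
    show "(G j has_vector_derivative - 2 * \<i> * G (j + 1) x + 2 * \<i> * u x * F j x) (at x)" for j x
    proof (cases "j \<le> N")
      case True
      have "(if N - j = 0 then 0 else b x (N - j - 1)) = G (j + 1) x"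
        using True by (auto simp: G_def)
      then show ?thesis using bd[of "N - j" x] True Fa[OF True, of x] by (simp add: G_def[abs_def])
    qed (simp add: F_def G_def[abs_def])
    fix z :: complex
    have "(\<Sum>j\<le>N. F j 0 * z ^ (N - j)) = (\<Sum>j\<le>N. a 0 (N - j) * z ^ (N - j))"
      by (intro sum.cong) (auto simp: Fa)
    then show "(\<Sum>j\<le>N. F j 0 * z ^ (N - j)) = poly (map_poly cnj f0) z * poly f0 z"
      by (simp add: rev L0 flip: ab q_def)
    have "(\<Sum>j\<le>N. G j 0 * z ^ (N - j)) = (\<Sum>j\<le>N. b 0 (N - j) * z ^ (N - j))"
      by (intro sum.cong) (auto simp: G_def)
    then show "(\<Sum>j\<le>N. G j 0 * z ^ (N - j)) = poly (map_poly cnj f0) z * poly psi0 z"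
      by (simp add: rev L0 flip: ab q_def)
    have "(\<Sum>j\<le>N. cnj (G j 0) * z ^ (N - j)) = (\<Sum>j\<le>N. cnj (b 0 (N - j)) * z ^ (N - j))"
      by (intro sum.cong) (auto simp: G_def)
    then show "- (\<Sum>j\<le>N. cnj (G j 0) * z ^ (N - j)) = poly (map_poly cnj f0) z * poly phi0 z"
      using rev[of "\<lambda>k. cnj (b 0 k)" z] by (simp add: L0 flip: LH q_def)
  qed
qed

section \<open>Commuting flows\<close>

text \<open>Maps that are differentiable with a remainder that is quadratic uniformly on bounded sets;
  in infinite dimensions, bounded sets cannot be replaced by compact ones.\<close>

definition nice :: "('a::real_normed_vector \<Rightarrow> 'b::real_normed_vector) \<Rightarrow> ('a \<Rightarrow> 'a \<Rightarrow> 'b) \<Rightarrow> bool" where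
  "nice g D \<longleftrightarrow> (\<forall>y. bounded_linear (D y)) \<and> (\<forall>R. \<exists>K\<ge>0. \<forall>y y'. norm y \<le> R \<longrightarrow> norm y' \<le> R \<longrightarrow>
     norm (g y) \<le> K \<and> (\<forall>h. norm (D y h) \<le> K * norm h) \<and>
     norm (g y' - g y - D y (y' - y)) \<le> K * (norm (y' - y))\<^sup>2)"

lemma niceI:
  assumes "\<And>y. bounded_linear (D y)"
    and "\<And>R. R \<ge> 0 \<Longrightarrow> \<exists>K. \<forall>y y'. norm y \<le> R \<longrightarrow> norm y' \<le> R \<longrightarrow>
     norm (g y) \<le> K \<and> (\<forall>h. norm (D y h) \<le> K * norm h) \<and>
     norm (g y' - g y - D y (y' - y)) \<le> K * (norm (y' - y))\<^sup>2"
  shows "nice g D"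
  unfolding nice_def
proof (intro conjI allI assms(1))
  fix R :: real
  show "\<exists>K\<ge>0. \<forall>y y'. norm y \<le> R \<longrightarrow> norm y' \<le> R \<longrightarrow>
     norm (g y) \<le> K \<and> (\<forall>h. norm (D y h) \<le> K * norm h) \<and>
     norm (g y' - g y - D y (y' - y)) \<le> K * (norm (y' - y))\<^sup>2"
  proof (cases "R \<ge> 0")
    case True
    obtain K where K: "\<And>y y'. norm y \<le> R \<Longrightarrow> norm y' \<le> R \<Longrightarrow>
       norm (g y) \<le> K \<and> (\<forall>h. norm (D y h) \<le> K * norm h) \<and>
       norm (g y' - g y - D y (y' - y)) \<le> K * (norm (y' - y))\<^sup>2"
      using assms(2)[OF True] by blast
    have "0 \<le> norm (g 0)" by simp
    also have "\<dots> \<le> K" using K[of 0 0] True by simp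
    finally show ?thesis using K by blast
  next
    case False
    then have "\<not> norm y \<le> R" for y :: 'a using norm_ge_zero[of y] by linarith
    then show ?thesis by (intro exI[of _ 0]) auto
  qed
qed

text \<open>The Lipschitz bound comes from the remainder bound: in the ball norm (y' - y) <= 2 |R|,
  so the quadratic term is absorbed into a linear one and the constant becomes K (1 + 2
  |R|).\<close>

lemma niceE:
  assumes "nice g D"
  obtains K where "K \<ge> 0" "\<And>y. norm y \<le> R \<Longrightarrow> norm (g y) \<le> K"
    "\<And>y h. norm y \<le> R \<Longrightarrow> norm (D y h) \<le> K * norm h"
    "\<And>y y'. norm y \<le> R \<Longrightarrow> norm y' \<le> R \<Longrightarrow> norm (g y' - g y - D y (y' - y)) \<le> K * (norm (y' - y))\<^sup>2"
    "\<And>y y'. norm y \<le> R \<Longrightarrow> norm y' \<le> R \<Longrightarrow> norm (g y' - g y) \<le> K * norm (y' - y)"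
proof -
  obtain K where K: "K \<ge> 0" "\<And>y y'. norm y \<le> R \<Longrightarrow> norm y' \<le> R \<Longrightarrow>
       norm (g y) \<le> K \<and> (\<forall>h. norm (D y h) \<le> K * norm h) \<and>
       norm (g y' - g y - D y (y' - y)) \<le> K * (norm (y' - y))\<^sup>2"
    using assms unfolding nice_def by blast
  define L where "L = K * (1 + 2 * \<bar>R\<bar>)"
  have KL: "K \<le> L" using K(1) by (simp add: L_def algebra_simps)
  have lip: "norm (g y' - g y) \<le> L * norm (y' - y)" if "norm y \<le> R" "norm y' \<le> R" for y y'
  proof -
    have "norm (g y' - g y) \<le> norm (D y (y' - y)) + norm (g y' - g y - D y (y' - y))"
      using norm_triangle_ineq[of "D y (y' - y)" "g y' - g y - D y (y' - y)"] by simp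
    also have "\<dots> \<le> K * norm (y' - y) + K * (norm (y' - y) * norm (y' - y))"
      using K(2)[OF that] by (intro add_mono) (auto simp: power2_eq_square)
    also have "\<dots> \<le> K * norm (y' - y) + K * (2 * \<bar>R\<bar> * norm (y' - y))"
      using K(1) that norm_triangle_ineq4[of y' y] by (intro add_left_mono mult_left_mono mult_right_mono) auto
    finally show ?thesis by (simp add: L_def algebra_simps)
  qed
  show ?thesis
  proof (rule that[of L])
    show "L \<ge> 0" using K(1) KL by linarith
    fix y y' h :: 'a assume y: "norm y \<le> R"
    show "norm (g y) \<le> L" using K(2)[OF y y] KL by simp
    have "norm (D y h) \<le> K * norm h" using K(2)[OF y y] by simp
    also have "\<dots> \<le> L * norm h" using KL by (intro mult_right_mono) auto
    finally show "norm (D y h) \<le> L * norm h" .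
    assume y': "norm y' \<le> R"
    have "norm (g y' - g y - D y (y' - y)) \<le> K * (norm (y' - y))\<^sup>2" using K(2)[OF y y'] by simp
    also have "\<dots> \<le> L * (norm (y' - y))\<^sup>2" using KL by (intro mult_right_mono) auto
    finally show "norm (g y' - g y - D y (y' - y)) \<le> L * (norm (y' - y))\<^sup>2" .
    show "norm (g y' - g y) \<le> L * norm (y' - y)" by (rule lip[OF y y'])
  qed
qed

lemma nice_bounded_linear_derivative: "nice g D \<Longrightarrow> bounded_linear (D y)"
  by (simp add: nice_def)

lemma nice_has_derivative:
  assumes "nice g D"
  shows "(g has_derivative D y) (at y)"
proof -
  obtain K where K: "\<And>z z'. norm z \<le> norm y + 1 \<Longrightarrow> norm z' \<le> norm y + 1 \<Longrightarrow>
      norm (g z' - g z - D z (z' - z)) \<le> K * (norm (z' - z))\<^sup>2"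
    by (rule niceE[OF assms, of "norm y + 1"]) blast
  show ?thesis
  proof (rule quadratic_remainder_has_derivative[where d = 1 and C = K])
    fix y' assume "norm (y' - y) \<le> 1"
    then have "norm y' \<le> norm y + 1" using norm_triangle_sub[of y' y] by linarith
    then show "norm (g y' - g y - D y (y' - y)) \<le> K * (norm (y' - y))\<^sup>2" by (intro K) auto
  qed (use assms in \<open>auto intro: nice_bounded_linear_derivative\<close>)
qed

lemma nice_chain_vector_derivative:
  assumes "nice g D" "(w has_vector_derivative w') (at t)"
  shows "((\<lambda>t. g (w t)) has_vector_derivative D (w t) w') (at t)"
proof -
  have "((\<lambda>t. g (w t)) has_derivative (\<lambda>h. D (w t) (h *\<^sub>R w'))) (at t)"
    using diff_chain_at[OF assms(2)[unfolded has_vector_derivative_def] nice_has_derivative[OF assms(1), of "w t"]]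
    by (simp add: o_def)
  moreover have "(\<lambda>h. D (w t) (h *\<^sub>R w')) = (\<lambda>h. h *\<^sub>R D (w t) w')"
    using nice_bounded_linear_derivative[OF assms(1)] by (simp add: linear_cmul bounded_linear.linear)
  ultimately show ?thesis by (simp add: has_vector_derivative_def)
qed

lemma nice_continuous: "nice g D \<Longrightarrow> continuous_on UNIV g"
  by (meson continuous_at_imp_continuous_on has_derivative_continuous nice_has_derivative)

text \<open>Lets a derivative be left schematic, assembled by the rules below, and only then
  compared with a closed form.\<close>

lemma nice_cong: "nice g D \<Longrightarrow> (\<And>y h. D y h = D' y h) \<Longrightarrow> nice g D'"
  by (subgoal_tac "D = D'") auto

lemma nice_const: "nice (\<lambda>_. c) (\<lambda>_ _. 0)"
  by (rule niceI) (auto intro!: exI[of _ "norm c"])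

lemma nice_bounded_linear:
  assumes "bounded_linear g"
  shows "nice g (\<lambda>_. g)"
proof (rule niceI)
  interpret bounded_linear g by fact
  fix R :: real assume "R \<ge> 0"
  obtain K where K: "K > 0" "\<And>h. norm (g h) \<le> norm h * K" using pos_bounded by blast
  define L where "L = K * (R + 1)"
  have "K \<le> L" "K * R \<le> L" using K(1) \<open>R \<ge> 0\<close> by (simp_all add: L_def algebra_simps)
  then have "norm (g y) \<le> L" if "norm y \<le> R" for y
  proof -
    have "norm (g y) \<le> norm y * K" by (rule K(2))
    also have "\<dots> \<le> R * K" using that K(1) by (intro mult_right_mono) auto
    also have "\<dots> \<le> L" using \<open>K * R \<le> L\<close> by (simp add: mult.commute)
    finally show ?thesis .
  qed
  moreover have "norm (g h) \<le> L * norm h" for h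
    using K(2)[of h] mult_right_mono[OF \<open>K \<le> L\<close>, of "norm h"] by (simp add: mult.commute)
  moreover have "0 \<le> L" using K(1) \<open>K \<le> L\<close> by simp
  ultimately show "\<exists>K. \<forall>y y'. norm y \<le> R \<longrightarrow> norm y' \<le> R \<longrightarrow>
     norm (g y) \<le> K \<and> (\<forall>h. norm (g h) \<le> K * norm h) \<and> norm (g y' - g y - g (y' - y)) \<le> K * (norm (y' - y))\<^sup>2"
    by (intro exI[of _ L]) (simp add: diff)
qed (rule assms)

lemma nice_add:
  assumes "nice f Df" "nice g Dg"
  shows "nice (\<lambda>y. f y + g y) (\<lambda>y h. Df y h + Dg y h)"
proof (rule niceI)
  show "bounded_linear (\<lambda>h. Df y h + Dg y h)" for y
    using assms by (intro bounded_linear_add) (auto intro: nice_bounded_linear_derivative)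
  fix R :: real
  obtain K where K: "\<And>y. norm y \<le> R \<Longrightarrow> norm (f y) \<le> K"
    "\<And>y h. norm y \<le> R \<Longrightarrow> norm (Df y h) \<le> K * norm h"
    "\<And>y y'. norm y \<le> R \<Longrightarrow> norm y' \<le> R \<Longrightarrow> norm (f y' - f y - Df y (y' - y)) \<le> K * (norm (y' - y))\<^sup>2"
    by (rule niceE[OF assms(1), of R]) blast
  obtain L where L: "\<And>y. norm y \<le> R \<Longrightarrow> norm (g y) \<le> L"
    "\<And>y h. norm y \<le> R \<Longrightarrow> norm (Dg y h) \<le> L * norm h"
    "\<And>y y'. norm y \<le> R \<Longrightarrow> norm y' \<le> R \<Longrightarrow> norm (g y' - g y - Dg y (y' - y)) \<le> L * (norm (y' - y))\<^sup>2"
    by (rule niceE[OF assms(2), of R]) blast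
  have "norm (f y + g y) \<le> K + L" if "norm y \<le> R" for y
    using norm_triangle_mono[OF K(1)[OF that] L(1)[OF that]] .
  moreover have "norm (Df y h + Dg y h) \<le> (K + L) * norm h" if "norm y \<le> R" for y h
    using norm_triangle_mono[OF K(2)[OF that, of h] L(2)[OF that, of h]] by (simp add: algebra_simps)
  moreover have "norm (f y' + g y' - (f y + g y) - (Df y (y' - y) + Dg y (y' - y))) \<le> (K + L) * (norm (y' - y))\<^sup>2"
    if "norm y \<le> R" "norm y' \<le> R" for y y'
    using norm_triangle_mono[OF K(3)[OF that] L(3)[OF that]] by (simp add: algebra_simps)
  ultimately show "\<exists>K. \<forall>y y'. norm y \<le> R \<longrightarrow> norm y' \<le> R \<longrightarrow> norm (f y + g y) \<le> K \<and>
     (\<forall>h. norm (Df y h + Dg y h) \<le> K * norm h) \<and>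
     norm (f y' + g y' - (f y + g y) - (Df y (y' - y) + Dg y (y' - y))) \<le> K * (norm (y' - y))\<^sup>2"
    by blast
qed

lemma nice_linear_compose:
  assumes T: "bounded_linear T" and "nice g D"
  shows "nice (\<lambda>y. T (g y)) (\<lambda>y h. T (D y h))"
proof (rule niceI)
  interpret T: bounded_linear T by fact
  show "bounded_linear (\<lambda>h. T (D y h))" for y
    using bounded_linear_compose[OF T nice_bounded_linear_derivative[OF assms(2)]] .
  fix R :: real
  obtain K where K: "\<And>y. norm y \<le> R \<Longrightarrow> norm (g y) \<le> K"
    "\<And>y h. norm y \<le> R \<Longrightarrow> norm (D y h) \<le> K * norm h"
    "\<And>y y'. norm y \<le> R \<Longrightarrow> norm y' \<le> R \<Longrightarrow> norm (g y' - g y - D y (y' - y)) \<le> K * (norm (y' - y))\<^sup>2"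
    by (rule niceE[OF assms(2), of R]) blast
  obtain L where L: "L > 0" "\<And>h. norm (T h) \<le> norm h * L" using T.pos_bounded by blast
  have *: "norm (T x) \<le> K * L * c" if "norm x \<le> K * c" for x c
  proof -
    have "norm (T x) \<le> norm x * L" by (rule L(2))
    also have "\<dots> \<le> K * c * L" using that L(1) by (intro mult_right_mono) auto
    finally show ?thesis by (simp add: mult_ac)
  qed
  have "norm (T (g y)) \<le> K * L" if "norm y \<le> R" for y
    using *[of "g y" 1] K(1)[OF that] by simp
  moreover have "norm (T (g y') - T (g y) - T (D y (y' - y))) \<le> K * L * (norm (y' - y))\<^sup>2"
    if "norm y \<le> R" "norm y' \<le> R" for y y'
    using *[OF K(3)[OF that]] by (simp add: T.diff)
  ultimately show "\<exists>K. \<forall>y y'. norm y \<le> R \<longrightarrow> norm y' \<le> R \<longrightarrow> norm (T (g y)) \<le> K \<and>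
     (\<forall>h. norm (T (D y h)) \<le> K * norm h) \<and> norm (T (g y') - T (g y) - T (D y (y' - y))) \<le> K * (norm (y' - y))\<^sup>2"
    using *[OF K(2)] by blast
qed

lemma nice_compose_linear:
  assumes T: "bounded_linear T" and "nice g D"
  shows "nice (\<lambda>y. g (T y)) (\<lambda>y h. D (T y) (T h))"
proof (rule niceI)
  interpret T: bounded_linear T by fact
  show "bounded_linear (\<lambda>h. D (T y) (T h))" for y
    using bounded_linear_compose[OF nice_bounded_linear_derivative[OF assms(2)] T] .
  fix R :: real assume R: "R \<ge> 0"
  obtain L where L: "L > 0" "\<And>h. norm (T h) \<le> norm h * L" using T.pos_bounded by blast
  obtain K where K: "K \<ge> 0" "\<And>y. norm y \<le> R * L \<Longrightarrow> norm (g y) \<le> K"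
    "\<And>y h. norm y \<le> R * L \<Longrightarrow> norm (D y h) \<le> K * norm h"
    "\<And>y y'. norm y \<le> R * L \<Longrightarrow> norm y' \<le> R * L \<Longrightarrow> norm (g y' - g y - D y (y' - y)) \<le> K * (norm (y' - y))\<^sup>2"
    by (rule niceE[OF assms(2), of "R * L"]) blast
  have TR: "norm (T y) \<le> R * L" if "norm y \<le> R" for y
    using L(2)[of y] mult_right_mono[OF that, of L] L(1) by linarith
  define M where "M = K * (1 + L + L\<^sup>2)"
  have M: "K \<le> M" "K * L \<le> M" "K * L\<^sup>2 \<le> M"
    using K(1) L(1) by (auto simp: M_def intro!: mult_left_mono mult_left_le)
      (auto simp: algebra_simps)
  have "norm (g (T y)) \<le> M" if "norm y \<le> R" for y
    using K(2)[OF TR[OF that]] M(1) by simp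
  moreover have "norm (D (T y) (T h)) \<le> M * norm h" if "norm y \<le> R" for y h
  proof -
    have "norm (D (T y) (T h)) \<le> K * (norm h * L)"
      using K(3)[OF TR[OF that], of "T h"] mult_left_mono[OF L(2)[of h] K(1)] by linarith
    also have "\<dots> \<le> M * norm h" using mult_right_mono[OF M(2), of "norm h"] by (simp add: mult_ac)
    finally show ?thesis .
  qed
  moreover have "norm (g (T y') - g (T y) - D (T y) (T (y' - y))) \<le> M * (norm (y' - y))\<^sup>2"
    if "norm y \<le> R" "norm y' \<le> R" for y y'
  proof -
    have "norm (g (T y') - g (T y) - D (T y) (T (y' - y))) \<le> K * (norm (T (y' - y)))\<^sup>2"
      using K(4)[OF TR[OF that(1)] TR[OF that(2)]] by (simp add: T.diff)
    also have "\<dots> \<le> K * (norm (y' - y) * L)\<^sup>2"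
      using K(1) L by (intro mult_left_mono power_mono) auto
    also have "\<dots> \<le> M * (norm (y' - y))\<^sup>2"
      using mult_right_mono[OF M(3), of "(norm (y' - y))\<^sup>2"] by (simp add: power_mult_distrib mult_ac)
    finally show ?thesis .
  qed
  ultimately show "\<exists>K. \<forall>y y'. norm y \<le> R \<longrightarrow> norm y' \<le> R \<longrightarrow> norm (g (T y)) \<le> K \<and>
     (\<forall>h. norm (D (T y) (T h)) \<le> K * norm h) \<and> norm (g (T y') - g (T y) - D (T y) (T (y' - y))) \<le> K * (norm (y' - y))\<^sup>2"
    by blast
qed

lemma nice_mult:
  fixes f g :: "'a::real_normed_vector \<Rightarrow> 'b::real_normed_algebra"
  assumes "nice f Df" "nice g Dg"
  shows "nice (\<lambda>y. f y * g y) (\<lambda>y h. f y * Dg y h + Df y h * g y)"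
proof (rule niceI)
  show "bounded_linear (\<lambda>h. f y * Dg y h + Df y h * g y)" for y
    by (intro bounded_linear_add bounded_linear_const_mult bounded_linear_mult_const
        nice_bounded_linear_derivative[OF assms(1)] nice_bounded_linear_derivative[OF assms(2)])
  fix R :: real
  obtain K where K: "K \<ge> 0" "\<And>y. norm y \<le> R \<Longrightarrow> norm (f y) \<le> K"
    "\<And>y h. norm y \<le> R \<Longrightarrow> norm (Df y h) \<le> K * norm h"
    "\<And>y y'. norm y \<le> R \<Longrightarrow> norm y' \<le> R \<Longrightarrow> norm (f y' - f y - Df y (y' - y)) \<le> K * (norm (y' - y))\<^sup>2"
    "\<And>y y'. norm y \<le> R \<Longrightarrow> norm y' \<le> R \<Longrightarrow> norm (f y' - f y) \<le> K * norm (y' - y)"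
    by (rule niceE[OF assms(1), of R]) blast
  obtain L where L: "L \<ge> 0" "\<And>y. norm y \<le> R \<Longrightarrow> norm (g y) \<le> L"
    "\<And>y h. norm y \<le> R \<Longrightarrow> norm (Dg y h) \<le> L * norm h"
    "\<And>y y'. norm y \<le> R \<Longrightarrow> norm y' \<le> R \<Longrightarrow> norm (g y' - g y - Dg y (y' - y)) \<le> L * (norm (y' - y))\<^sup>2"
    "\<And>y y'. norm y \<le> R \<Longrightarrow> norm y' \<le> R \<Longrightarrow> norm (g y' - g y) \<le> L * norm (y' - y)"
    by (rule niceE[OF assms(2), of R]) blast
  have m: "norm (a * b) \<le> c * d" if "norm a \<le> c" "norm b \<le> d" for a b :: 'b and c d
    using order_trans[OF norm_mult_ineq mult_mono[OF that]] that norm_ge_zero[of a] norm_ge_zero[of b]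
    by (meson norm_ge_zero order_trans)
  define M where "M = 3 * (K * L)"
  have KL: "0 \<le> K * L" using K(1) L(1) by simp
  have "norm (f y * g y) \<le> M" if "norm y \<le> R" for y
    using m[OF K(2)[OF that] L(2)[OF that]] KL by (simp add: M_def)
  moreover have "norm (f y * Dg y h + Df y h * g y) \<le> M * norm h" if y: "norm y \<le> R" for y h
  proof -
    have "norm (f y * Dg y h + Df y h * g y) \<le> K * (L * norm h) + (K * norm h) * L"
      by (intro order_trans[OF norm_triangle_ineq] add_mono m K L y)
    also have "\<dots> \<le> M * norm h" using mult_nonneg_nonneg[OF KL, of "norm h"] by (simp add: M_def algebra_simps)
    finally show ?thesis .
  qed
  moreover have "norm (f y' * g y' - f y * g y - (f y * Dg y (y' - y) + Df y (y' - y) * g y)) \<le> M * (norm (y' - y))\<^sup>2"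
    if y: "norm y \<le> R" "norm y' \<le> R" for y y'
  proof -
    have "f y' * g y' - f y * g y - (f y * Dg y (y' - y) + Df y (y' - y) * g y) =
        (f y * (g y' - g y - Dg y (y' - y)) + (f y' - f y - Df y (y' - y)) * g y) + (f y' - f y) * (g y' - g y)"
      by (simp add: algebra_simps)
    also have "norm \<dots> \<le> (K * (L * (norm (y' - y))\<^sup>2) + (K * (norm (y' - y))\<^sup>2) * L) + (K * norm (y' - y)) * (L * norm (y' - y))"
      by (intro order_trans[OF norm_triangle_ineq] add_mono m K L y)
    also have "\<dots> = M * (norm (y' - y))\<^sup>2" by (simp add: M_def algebra_simps power2_eq_square)
    finally show ?thesis .
  qed
  ultimately show "\<exists>K. \<forall>y y'. norm y \<le> R \<longrightarrow> norm y' \<le> R \<longrightarrow> norm (f y * g y) \<le> K \<and>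
     (\<forall>h. norm (f y * Dg y h + Df y h * g y) \<le> K * norm h) \<and>
     norm (f y' * g y' - f y * g y - (f y * Dg y (y' - y) + Df y (y' - y) * g y)) \<le> K * (norm (y' - y))\<^sup>2"
    by blast
qed

lemma nice_minus: "nice g D \<Longrightarrow> nice (\<lambda>y. - g y) (\<lambda>y h. - D y h)"
  by (rule nice_linear_compose[OF bounded_linear_minus[OF bounded_linear_ident]])

lemma nice_diff: "nice f Df \<Longrightarrow> nice g Dg \<Longrightarrow> nice (\<lambda>y. f y - g y) (\<lambda>y h. Df y h - Dg y h)"
  using nice_add[of f Df "\<lambda>y. - g y" "\<lambda>y h. - Dg y h"] nice_minus[of g Dg] by simp

lemma nice_Pair:
  assumes "nice f Df" "nice g Dg"
  shows "nice (\<lambda>y. (f y, g y)) (\<lambda>y h. (Df y h, Dg y h))"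
proof -
  have "bounded_linear (\<lambda>x::'b. (x, 0::'c))" "bounded_linear (\<lambda>x::'c. (0::'b, x))"
    by (intro bounded_linear_Pair bounded_linear_ident bounded_linear_zero)+
  from nice_add[OF nice_linear_compose[OF this(1) assms(1)] nice_linear_compose[OF this(2) assms(2)]]
  show ?thesis by simp
qed

lemmas nice_cnj = nice_linear_compose[OF bounded_linear_cnj]
  and nice_Im = nice_linear_compose[OF bounded_linear_Im]
  and nice_of_real = nice_linear_compose[OF bounded_linear_of_real]

lemma nice_sum:
  assumes "finite I" "\<And>i. i \<in> I \<Longrightarrow> nice (f i) (Df i)"
  shows "nice (\<lambda>y. \<Sum>i\<in>I. f i y) (\<lambda>y h. \<Sum>i\<in>I. Df i y h)"
  using assms by (induction I rule: finite_induct) (auto intro!: nice_const nice_add)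

text \<open>The difference \<open>y x - y x0 - (x - x0) A (y x0)\<close> is propagated by the linearisation of \<open>B\<close> up to
  a quadratic error, because \<open>A\<close> is a solution of the variational equation.\<close>

lemma commuting_flow:
  fixes A B :: "'a::real_normed_vector \<Rightarrow> 'a"
  assumes nA: "nice A dA" and nB: "nice B dB"
    and y: "\<And>x t. (y x has_vector_derivative B (y x t)) (at t)"
    and y0: "((\<lambda>x. y x 0) has_vector_derivative A (y x0 0)) (at x0)"
    and comm: "\<And>t. dA (y x0 t) (B (y x0 t)) = dB (y x0 t) (A (y x0 t))"
    and r: "r > 0" and bnd: "\<And>x s. \<bar>x - x0\<bar> < r \<Longrightarrow> \<bar>s\<bar> \<le> \<bar>t\<bar> \<Longrightarrow> norm (y x s) \<le> R"
  shows "((\<lambda>x. y x t) has_vector_derivative A (y x0 t)) (at x0)"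
proof -
  define T where "T = \<bar>t\<bar>"
  have T: "T \<ge> 0" by (simp add: T_def)
  obtain K0 where K0: "K0 \<ge> 0" "\<And>y h. norm y \<le> R \<Longrightarrow> norm (dB y h) \<le> K0 * norm h"
    "\<And>y y'. norm y \<le> R \<Longrightarrow> norm y' \<le> R \<Longrightarrow> norm (B y' - B y - dB y (y' - y)) \<le> K0 * (norm (y' - y))\<^sup>2"
    "\<And>y y'. norm y \<le> R \<Longrightarrow> norm y' \<le> R \<Longrightarrow> norm (B y' - B y) \<le> K0 * norm (y' - y)"
    by (rule niceE[OF nB, of R]) blast
  define K where "K = K0 + 1"
  have K: "K > 0" "K0 \<le> K" using K0(1) by (auto simp: K_def)
  define C where "C = 2 * exp (2 * K * T)"
  have C: "C > 0" by (simp add: C_def)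
  define M where "M = norm (A (y x0 0)) + 1"
  have M: "M > 0" by (simp add: M_def add_nonneg_pos)
  define Q where "Q = C * (K * (C * M)\<^sup>2 * T)"
  have Q: "Q \<ge> 0" using C K T M by (simp add: Q_def)
  have d0: "\<exists>d>0. \<forall>x. \<bar>x - x0\<bar> < d \<longrightarrow> norm (y x 0 - y x0 0 - (x - x0) *\<^sub>R A (y x0 0)) \<le> e * \<bar>x - x0\<bar>"
    if "e > 0" for e
    using y0 that unfolding has_vector_derivative_def has_derivative_at_alt by auto
  \<comment> \<open>The accuracy e = 1 only serves to make the initial distance at most M |x -
    x0|.\<close>
  obtain d1 where d1: "d1 > 0" "\<And>x. \<bar>x - x0\<bar> < d1 \<Longrightarrow> norm (y x 0 - y x0 0 - (x - x0) *\<^sub>R A (y x0 0)) \<le> 1 * \<bar>x - x0\<bar>"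
    using d0[of 1] by auto
  have x0R: "norm (y x0 s) \<le> R" if "\<bar>s\<bar> \<le> T" for s using bnd[of x0 s] r that by (simp add: T_def)
  have main: "norm (y x t - y x0 t - (x - x0) *\<^sub>R A (y x0 t)) \<le>
      C * norm (y x 0 - y x0 0 - (x - x0) *\<^sub>R A (y x0 0)) + Q * \<bar>x - x0\<bar>\<^sup>2"
    if x: "\<bar>x - x0\<bar> < r" "\<bar>x - x0\<bar> < d1" for x
  proof -
    have xR: "norm (y x s) \<le> R" if "\<bar>s\<bar> \<le> T" for s using bnd[OF x(1)] that by (simp add: T_def)
    have "norm (y x 0 - y x0 0) \<le> norm (y x 0 - y x0 0 - (x - x0) *\<^sub>R A (y x0 0)) + norm ((x - x0) *\<^sub>R A (y x0 0))"
      by (metis diff_add_cancel norm_triangle_ineq)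
    also have "\<dots> \<le> 1 * \<bar>x - x0\<bar> + \<bar>x - x0\<bar> * norm (A (y x0 0))" using d1(2)[OF x(2)] by simp
    also have "\<dots> = M * \<bar>x - x0\<bar>" by (simp add: M_def algebra_simps)
    finally have del0: "norm (y x 0 - y x0 0) \<le> M * \<bar>x - x0\<bar>" .
    have del: "norm (y x s - y x0 s) \<le> C * M * \<bar>x - x0\<bar>" if s: "\<bar>s\<bar> \<le> T" for s
    proof -
      have "norm (y x s - y x0 s) \<le> 2 * (norm (y x 0 - y x0 0) + 0 * T) * exp (2 * K * T)"
      proof (rule gronwall[OF K(1) _ s, where e' = "\<lambda>s. B (y x s) - B (y x0 s)"])
        fix s' assume s': "\<bar>s'\<bar> \<le> T"
        show "((\<lambda>s. y x s - y x0 s) has_vector_derivative B (y x s') - B (y x0 s')) (at s')"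
          by (intro has_vector_derivative_diff y)
        have "norm (B (y x s') - B (y x0 s')) \<le> K0 * norm (y x s' - y x0 s')"
          by (intro K0 xR x0R s')
        also have "\<dots> \<le> K * norm (y x s' - y x0 s')" using K by (intro mult_right_mono) auto
        finally show "norm (B (y x s') - B (y x0 s')) \<le> K * norm (y x s' - y x0 s') + 0" by simp
      qed simp
      also have "\<dots> = C * norm (y x 0 - y x0 0)" by (simp add: C_def)
      also have "\<dots> \<le> C * (M * \<bar>x - x0\<bar>)" using C del0 by (intro mult_left_mono) auto
      finally show ?thesis by simp
    qed
    define e where "e s = y x s - y x0 s - (x - x0) *\<^sub>R A (y x0 s)" for s
    have "norm (e t) \<le> 2 * (norm (e 0) + K * (C * M * \<bar>x - x0\<bar>)\<^sup>2 * T) * exp (2 * K * T)"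
    proof (rule gronwall[OF K(1), where e' = "\<lambda>s. B (y x s) - B (y x0 s) - (x - x0) *\<^sub>R dA (y x0 s) (B (y x0 s))"])
      show "0 \<le> K * (C * M * \<bar>x - x0\<bar>)\<^sup>2" using K by simp
      show "\<bar>t\<bar> \<le> T" by (simp add: T_def)
      fix s assume s: "\<bar>s\<bar> \<le> T"
      show "(e has_vector_derivative B (y x s) - B (y x0 s) - (x - x0) *\<^sub>R dA (y x0 s) (B (y x0 s))) (at s)"
        unfolding e_def
        by (intro has_vector_derivative_diff y bounded_linear.has_vector_derivative[OF bounded_linear_scaleR_right]
            nice_chain_vector_derivative[OF nA])
      interpret dB: bounded_linear "dB (y x0 s)" by (rule nice_bounded_linear_derivative[OF nB])
      \<comment> \<open>By commutativity dA(B) is replaced by dB(A), so the three terms of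
        \<open>e\<close> combine under one linear map.\<close>
      have "B (y x s) - B (y x0 s) - (x - x0) *\<^sub>R dA (y x0 s) (B (y x0 s)) =
          dB (y x0 s) (e s) + (B (y x s) - B (y x0 s) - dB (y x0 s) (y x s - y x0 s))"
        unfolding comm e_def by (simp add: dB.diff dB.scaleR)
      also have "norm \<dots> \<le> K0 * norm (e s) + K0 * (norm (y x s - y x0 s))\<^sup>2"
        by (intro order_trans[OF norm_triangle_ineq] add_mono K0 xR x0R s)
      also have "\<dots> \<le> K * norm (e s) + K * (C * M * \<bar>x - x0\<bar>)\<^sup>2"
        using del[OF s] K by (intro add_mono mult_mono power_mono) auto
      finally show "norm (B (y x s) - B (y x0 s) - (x - x0) *\<^sub>R dA (y x0 s) (B (y x0 s)))
          \<le> K * norm (e s) + K * (C * M * \<bar>x - x0\<bar>)\<^sup>2" .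
    qed
    then show ?thesis by (simp add: e_def C_def[symmetric] Q_def C_def power_mult_distrib algebra_simps)
  qed
  show ?thesis
    unfolding has_vector_derivative_def has_derivative_at_alt
  proof (intro conjI allI impI)
    show "bounded_linear (\<lambda>h. h *\<^sub>R A (y x0 t))" by (rule bounded_linear_scaleR_left)
    fix e :: real assume e: "e > 0"
    then have "e / (2 * C) > 0" using C by simp
    from d0[OF this] obtain d2 where d2: "d2 > 0"
      "\<And>x. \<bar>x - x0\<bar> < d2 \<Longrightarrow> norm (y x 0 - y x0 0 - (x - x0) *\<^sub>R A (y x0 0)) \<le> e / (2 * C) * \<bar>x - x0\<bar>" by blast
    define d where "d = min (min r d1) (min d2 (e / (2 * (Q + 1))))"
    have "norm (y x t - y x0 t - (x - x0) *\<^sub>R A (y x0 t)) \<le> e * \<bar>x - x0\<bar>" if x: "\<bar>x - x0\<bar> < d" for x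
    proof -
      have xd: "\<bar>x - x0\<bar> < r" "\<bar>x - x0\<bar> < d1" "\<bar>x - x0\<bar> < d2" "\<bar>x - x0\<bar> < e / (2 * (Q + 1))"
        using x by (auto simp: d_def)
      have "Q * \<bar>x - x0\<bar> \<le> (Q + 1) * (e / (2 * (Q + 1)))" using Q xd(4) by (intro mult_mono) auto
      also have "\<dots> = e / 2" using Q by (simp add: field_simps)
      finally have "Q * \<bar>x - x0\<bar> * \<bar>x - x0\<bar> \<le> e / 2 * \<bar>x - x0\<bar>" by (intro mult_right_mono) auto
      moreover have "C * norm (y x 0 - y x0 0 - (x - x0) *\<^sub>R A (y x0 0)) \<le> C * (e / (2 * C) * \<bar>x - x0\<bar>)"
        using C d2(2)[OF xd(3)] by (intro mult_left_mono) auto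
      moreover have "C * (e / (2 * C) * \<bar>x - x0\<bar>) = e / 2 * \<bar>x - x0\<bar>" using C by simp
      ultimately show ?thesis using main[OF xd(1,2)] unfolding power2_eq_square by argo
    qed
    moreover have "d > 0" using r d1 d2 e Q by (simp add: d_def)
    ultimately show "\<exists>d>0. \<forall>x. norm (x - x0) < d \<longrightarrow> norm (y x t - y x0 t - (x - x0) *\<^sub>R A (y x0 t)) \<le> e * norm (x - x0)"
      by auto
  qed
qed

section \<open>Truncated flows\<close>

text \<open>Equal to 1 up to \<open>R\<close>, to 0 from \<open>R + 1\<close> on, and Lipschitz. It
  makes a locally Lipschitz field globally Lipschitz; an a priori bound by \<open>R\<close> shows
  later that the truncation is never active.\<close>

definition cutoff :: "real \<Rightarrow> real \<Rightarrow> real" where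
  "cutoff R r = max 0 (min 1 (R + 1 - r))"

lemma cutoff_flow_exists:
  fixes B :: "'a::banach \<Rightarrow> 'a"
  assumes "nice B dB"
  shows "\<exists>y. y 0 = y0 \<and> (\<forall>t. (y has_vector_derivative cutoff R (norm (y t)) *\<^sub>R B (y t)) (at t))"
proof (rule picard_global[where G = "\<lambda>_ y. cutoff R (norm y) *\<^sub>R B y"])
  fix y :: "real \<Rightarrow> 'a" assume "continuous_on UNIV y"
  then show "continuous_on UNIV (\<lambda>t. cutoff R (norm (y t)) *\<^sub>R B (y t))"
    unfolding cutoff_def
    by (intro continuous_intros continuous_on_compose2[OF nice_continuous[OF assms]]) auto
next
  fix T :: real
  obtain K where K: "K \<ge> 0" "\<And>y. norm y \<le> R + 1 \<Longrightarrow> norm (B y) \<le> K"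
    "\<And>y y'. norm y \<le> R + 1 \<Longrightarrow> norm y' \<le> R + 1 \<Longrightarrow> norm (B y' - B y) \<le> K * norm (y' - y)"
    by (rule niceE[OF assms, of "R + 1"]) blast
  have c: "\<bar>cutoff R (norm x) - cutoff R (norm y)\<bar> \<le> norm (x - y)" for x y :: 'a
    using norm_triangle_ineq3[of x y] unfolding cutoff_def by linarith
  have c1: "\<bar>cutoff R r\<bar> \<le> 1" and c0: "r > R + 1 \<Longrightarrow> cutoff R r = 0" for r
    by (auto simp: cutoff_def)
  \<comment> \<open>Only one of the two points is assumed to lie in the ball of radius R + 1. If the
    other lies outside, its term vanishes and the Lipschitz bound of the cutoff alone
    suffices.\<close>
  have *: "norm (cutoff R (norm x) *\<^sub>R B x - cutoff R (norm y) *\<^sub>R B y) \<le> 2 * K * norm (x - y)"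
    if "norm x \<le> R + 1" for x y
  proof (cases "norm y \<le> R + 1")
    case True
    have "cutoff R (norm x) *\<^sub>R B x - cutoff R (norm y) *\<^sub>R B y =
        (cutoff R (norm x) - cutoff R (norm y)) *\<^sub>R B x + cutoff R (norm y) *\<^sub>R (B x - B y)"
      by (simp add: algebra_simps)
    also have "norm \<dots> \<le> \<bar>cutoff R (norm x) - cutoff R (norm y)\<bar> * norm (B x) + \<bar>cutoff R (norm y)\<bar> * norm (B x - B y)"
      by (rule order_trans[OF norm_triangle_ineq]) simp
    also have "\<dots> \<le> norm (x - y) * K + 1 * (K * norm (x - y))"
      using K that True by (intro add_mono mult_mono c c1) auto
    finally show ?thesis by simp
  next
    case False
    then have "norm (cutoff R (norm x) *\<^sub>R B x - cutoff R (norm y) *\<^sub>R B y) =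
        \<bar>cutoff R (norm x) - cutoff R (norm y)\<bar> * norm (B x)" by (simp add: c0)
    also have "\<dots> \<le> norm (x - y) * K" using K that by (intro mult_mono c) auto
    also have "\<dots> \<le> 2 * K * norm (x - y)" using K(1) by simp
    finally show ?thesis .
  qed
  have "norm (cutoff R (norm x) *\<^sub>R B x - cutoff R (norm y) *\<^sub>R B y) \<le> 2 * K * norm (x - y)" for x y
  proof (cases "norm x \<le> R + 1")
    case False
    show ?thesis
    proof (cases "norm y \<le> R + 1")
      case True
      then show ?thesis using *[of y x] by (simp add: norm_minus_commute)
    next
      case F2: False
      then show ?thesis using False K(1) by (simp add: c0)
    qed
  qed (rule *)
  then show "\<exists>K. \<forall>t x y. \<bar>t\<bar> \<le> T \<longrightarrow>
     norm (cutoff R (norm x) *\<^sub>R B x - cutoff R (norm y) *\<^sub>R B y) \<le> K * norm (x - y)" by blast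
qed

section \<open>The finite-gap flows on coefficient sequences\<close>

instance bcontfun :: (metric_space, banach) banach ..

text \<open>The Banach instance of \<open>bcontfun\<close> asks for a metric on the domain. The
  metric inherited from the reals induces the discrete topology, so continuity is no restriction on
  a bounded sequence.\<close>

instantiation nat :: metric_space
begin

definition dist_nat :: "nat \<Rightarrow> nat \<Rightarrow> real" where
  "dist_nat m n = \<bar>real m - real n\<bar>"

definition uniformity_nat :: "(nat \<times> nat) filter" where
  "uniformity_nat = (INF e\<in>{0 <..}. principal {(x, y). dist x y < e})"

instance
proof
  fix U :: "nat set"
  have eq: "x = y" if "dist x y < 1" for x y :: nat
  proof -
    have "\<bar>real x - real y\<bar> < 1" using that by (simp add: dist_nat_def)
    then have "\<not> x < y" "\<not> y < x" by linarith+
    then show ?thesis by simp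
  qed
  have "eventually (\<lambda>(x', y). x' = x \<longrightarrow> y \<in> U) uniformity" if "x \<in> U" for x :: nat
    unfolding uniformity_nat_def
  proof (rule eventually_INF1)
    show "eventually (\<lambda>(x', y). x' = x \<longrightarrow> y \<in> U) (principal {(x, y). dist x y < (1 :: real)})"
      using that by (auto simp: eventually_principal dest: eq)
  qed simp
  then show "open U \<longleftrightarrow> (\<forall>x\<in>U. \<forall>\<^sub>F (x', y) in uniformity. x' = x \<longrightarrow> y \<in> U)"
    by (auto simp: open_discrete)
qed (auto simp: dist_nat_def uniformity_nat_def)

end

text \<open>A state is the sequence of coefficients \<open>(f j, g j)\<close> of \<open>z ^ (N - j)\<close> in the entries
  \<open>F = \<Sum> f j z ^ (N - j)\<close>, \<open>G = \<Sum> g j z ^ (N - j)\<close> and \<open>H = - \<Sum> cnj (g j) z ^ (N - j)\<close>; the potential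
  is \<open>g 1\<close>. Sequences supported in \<open>{0..N}\<close> are embedded into one Banach space, so that the dimension
  need not be reflected in a type.\<close>

type_synonym state = "(nat, real \<times> complex) bcontfun"

definition cf :: "state \<Rightarrow> nat \<Rightarrow> real" where "cf y j = fst (apply_bcontfun y j)"
definition cg :: "state \<Rightarrow> nat \<Rightarrow> complex" where "cg y j = snd (apply_bcontfun y j)"

definition mk :: "nat set \<Rightarrow> (nat \<Rightarrow> real \<times> complex) \<Rightarrow> state" where
  "mk I s = Bcontfun (\<lambda>j. if j \<in> I then s j else 0)"

lemma apply_mk:
  assumes "finite I"
  shows "apply_bcontfun (mk I s) j = (if j \<in> I then s j else 0)"
proof -
  have "range (\<lambda>j. if j \<in> I then s j else 0) \<subseteq> insert 0 (s ` I)" by auto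
  then have "bounded (range (\<lambda>j. if j \<in> I then s j else 0))"
    using assms by (meson bounded_subset finite_imageI finite_imp_bounded finite_insert)
  then have "(\<lambda>j. if j \<in> I then s j else 0) \<in> bcontfun"
    by (simp add: bcontfun_def)
  then show ?thesis by (simp add: mk_def Bcontfun_inverse)
qed

lemma cf_mk: "finite I \<Longrightarrow> cf (mk I s) j = (if j \<in> I then fst (s j) else 0)"
  and cg_mk: "finite I \<Longrightarrow> cg (mk I s) j = (if j \<in> I then snd (s j) else 0)"
  by (simp_all add: cf_def cg_def apply_mk)

lemma state_eqI: "(\<And>j. cf x j = cf y j) \<Longrightarrow> (\<And>j. cg x j = cg y j) \<Longrightarrow> x = y"
  by (rule bcontfun_eqI) (simp add: cf_def cg_def prod_eq_iff)

lemma bounded_linear_apply_bcontfun: "bounded_linear (\<lambda>y :: state. apply_bcontfun y j)"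
  by (rule bounded_linear_intro[where K = 1])
    (simp_all add: plus_bcontfun.rep_eq scaleR_bcontfun.rep_eq norm_bounded)

lemma bounded_linear_cf: "bounded_linear (\<lambda>y. cf y j)"
  and bounded_linear_cg: "bounded_linear (\<lambda>y. cg y j)"
  unfolding cf_def cg_def
  by (intro bounded_linear_compose[OF bounded_linear_fst bounded_linear_apply_bcontfun]
      bounded_linear_compose[OF bounded_linear_snd bounded_linear_apply_bcontfun])+

lemma norm_cf: "\<bar>cf y j\<bar> \<le> norm y" and norm_cg: "norm (cg y j) \<le> norm y"
  using norm_fst_le[of "cf y j" "cg y j"] norm_snd_le[of "cg y j" "cf y j"] norm_bounded[of y j]
  by (simp_all add: cf_def cg_def)

lemma norm_state_bound:
  assumes "\<And>j. \<bar>cf y j\<bar> \<le> b" "\<And>j. norm (cg y j) \<le> b"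
  shows "norm y \<le> 2 * b"
proof (rule norm_bound)
  fix j
  have "norm (apply_bcontfun y j) \<le> \<bar>cf y j\<bar> + norm (cg y j)"
    using norm_Pair_sum[of "cf y j" "cg y j"] by (simp add: cf_def cg_def)
  then show "norm (apply_bcontfun y j) \<le> 2 * b" using assms(1)[of j] assms(2)[of j] by linarith
qed

lemma bounded_linear_mk_single: "bounded_linear (\<lambda>x. mk {j} (\<lambda>_. x))"
proof (rule bounded_linear_intro[where K = 1])
  show "mk {j} (\<lambda>_. x + y) = mk {j} (\<lambda>_. x) + mk {j} (\<lambda>_. y)" for x y
    by (rule bcontfun_eqI) (simp add: plus_bcontfun.rep_eq apply_mk)
  show "mk {j} (\<lambda>_. r *\<^sub>R x) = r *\<^sub>R mk {j} (\<lambda>_. x)" for r x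
    by (rule bcontfun_eqI) (simp add: scaleR_bcontfun.rep_eq apply_mk)
  show "norm (mk {j} (\<lambda>_. x)) \<le> norm x * 1" for x
    by (rule norm_bound) (simp add: apply_mk)
qed

text \<open>A finitely supported state is a finite sum of one-coordinate embeddings, each bounded
  linear. Derivatives of states thereby reduce to derivatives of coordinates.\<close>

lemma mk_eq_sum:
  assumes "finite I"
  shows "mk I s = (\<Sum>j\<in>I. mk {j} (\<lambda>_. s j))"
proof (rule bcontfun_eqI)
  fix i
  have "apply_bcontfun (\<Sum>j\<in>I. mk {j} (\<lambda>_. s j)) i = (\<Sum>j\<in>I. apply_bcontfun (mk {j} (\<lambda>_. s j)) i)"
    by (rule linear_sum[OF bounded_linear.linear[OF bounded_linear_apply_bcontfun]])
  also have "\<dots> = (\<Sum>j\<in>I. if j = i then s j else 0)" by (intro sum.cong) (auto simp: apply_mk)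
  also have "\<dots> = apply_bcontfun (mk I s) i" using assms by (simp add: apply_mk)
  finally show "apply_bcontfun (mk I s) i = apply_bcontfun (\<Sum>j\<in>I. mk {j} (\<lambda>_. s j)) i" by simp
qed

lemma nice_mk:
  assumes "finite I" "\<And>j. nice (g j) (D j)"
  shows "nice (\<lambda>y. mk I (\<lambda>j. g j y)) (\<lambda>y h. mk I (\<lambda>j. D j y h))"
  unfolding mk_eq_sum[OF assms(1)]
  by (intro nice_sum assms(1) nice_linear_compose[OF bounded_linear_mk_single] assms(2))

lemma has_vector_derivative_mk:
  assumes "finite I" "\<And>j. j \<in> I \<Longrightarrow> ((\<lambda>x. s x j) has_vector_derivative s' j) (at x)"
  shows "((\<lambda>x. mk I (s x)) has_vector_derivative mk I s') (at x)"
  unfolding mk_eq_sum[OF assms(1)]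
  by (intro has_vector_derivative_sum bounded_linear.has_vector_derivative[OF bounded_linear_mk_single] assms(2))

lemmas nice_cf = nice_bounded_linear[OF bounded_linear_cf]
  and nice_cg = nice_bounded_linear[OF bounded_linear_cg]

lemmas nice_intros = nice_const nice_cf nice_cg nice_add nice_diff nice_minus nice_mult nice_cnj nice_Im
  nice_of_real nice_Pair

text \<open>\<open>b0\<close> is \<open>- i\<close> times the space derivative of the potential.\<close>

definition b0 :: "state \<Rightarrow> complex" where
  "b0 y = - 2 * cg y 2 + 2 * cg y 1 * of_real (cf y 1)"
definition db0 :: "state \<Rightarrow> state \<Rightarrow> complex" where
  "db0 y h = - 2 * cg h 2 + 2 * (cg h 1 * of_real (cf y 1) + cg y 1 * of_real (cf h 1))"

text \<open>\<open>A_f\<close> and \<open>A_g\<close> are the coefficients of z^(N - j) in the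
  entries of [U, L], where U is the Zakharov--Shabat matrix with potential
  \<open>cg y 1\<close>.\<close>

definition A_f :: "state \<Rightarrow> nat \<Rightarrow> real" where
  "A_f y j = - 2 * Im (cnj (cg y 1) * cg y j)"
definition A_g :: "state \<Rightarrow> nat \<Rightarrow> complex" where
  "A_g y j = - 2 * \<i> * cg y (j + 1) + 2 * \<i> * cg y 1 * of_real (cf y j)"
text \<open>\<open>B_f\<close> and \<open>B_g\<close> play the same role for [V, L], with V the
  matrix of entries \<open>ta\<close>, \<open>tb\<close>, \<open>tc\<close> below. The shifts by 1
  and 2 come from the powers of z in V.\<close>

definition B_f :: "state \<Rightarrow> nat \<Rightarrow> real" where
  "B_f y j = - 4 * Im (cnj (cg y 1) * cg y (j + 1)) + 2 * Im (cnj (b0 y) * cg y j)"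
definition B_g :: "state \<Rightarrow> nat \<Rightarrow> complex" where
  "B_g y j = - 4 * \<i> * cg y (j + 2) + 2 * \<i> * (cg y 1 * cnj (cg y 1)) * cg y j
     + 4 * \<i> * cg y 1 * of_real (cf y (j + 1)) - 2 * \<i> * b0 y * of_real (cf y j)"

definition dA_f :: "state \<Rightarrow> state \<Rightarrow> nat \<Rightarrow> real" where
  "dA_f y h j = - 2 * Im (cnj (cg y 1) * cg h j + cnj (cg h 1) * cg y j)"
definition dA_g :: "state \<Rightarrow> state \<Rightarrow> nat \<Rightarrow> complex" where
  "dA_g y h j = - 2 * \<i> * cg h (j + 1) + 2 * \<i> * (cg y 1 * of_real (cf h j) + cg h 1 * of_real (cf y j))"
definition dB_f :: "state \<Rightarrow> state \<Rightarrow> nat \<Rightarrow> real" where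
  "dB_f y h j = - 4 * Im (cnj (cg y 1) * cg h (j + 1) + cnj (cg h 1) * cg y (j + 1))
     + 2 * Im (cnj (b0 y) * cg h j + cnj (db0 y h) * cg y j)"
definition dB_g :: "state \<Rightarrow> state \<Rightarrow> nat \<Rightarrow> complex" where
  "dB_g y h j = - 4 * \<i> * cg h (j + 2) + 2 * \<i> * ((cg y 1 * cnj (cg y 1)) * cg h j
       + (cg y 1 * cnj (cg h 1) + cg h 1 * cnj (cg y 1)) * cg y j)
     + 4 * \<i> * (cg y 1 * of_real (cf h (j + 1)) + cg h 1 * of_real (cf y (j + 1)))
     - 2 * \<i> * (b0 y * of_real (cf h j) + db0 y h * of_real (cf y j))"

lemma nice_b0: "nice b0 db0"
proof -
  have "nice (\<lambda>y. b0 y) db0"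
    unfolding b0_def by (rule nice_cong, (rule nice_intros)+) (simp add: db0_def algebra_simps)
  then show ?thesis by simp
qed

lemma nice_A_f: "nice (\<lambda>y. A_f y j) (\<lambda>y h. dA_f y h j)"
  unfolding A_f_def by (rule nice_cong, (rule nice_intros)+) (simp add: dA_f_def algebra_simps)

lemma nice_A_g: "nice (\<lambda>y. A_g y j) (\<lambda>y h. dA_g y h j)"
  unfolding A_g_def by (rule nice_cong, (rule nice_intros)+) (simp add: dA_g_def algebra_simps)

lemma nice_B_f: "nice (\<lambda>y. B_f y j) (\<lambda>y h. dB_f y h j)"
  unfolding B_f_def by (rule nice_cong, (rule nice_b0 nice_intros)+) (simp add: dB_f_def algebra_simps)

lemma nice_B_g: "nice (\<lambda>y. B_g y j) (\<lambda>y h. dB_g y h j)"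
  unfolding B_g_def by (rule nice_cong, (rule nice_b0 nice_intros)+) (simp add: dB_g_def algebra_simps)

text \<open>Truncation to {1..N} keeps the leading entries and the zeros beyond N fixed for every
  state, so admissibility is preserved automatically. On admissible states the truncated components
  vanish by the formulas as well.\<close>

definition fieldA :: "nat \<Rightarrow> state \<Rightarrow> state" where
  "fieldA N y = mk {1..N} (\<lambda>j. (A_f y j, A_g y j))"
definition fieldB :: "nat \<Rightarrow> state \<Rightarrow> state" where
  "fieldB N y = mk {1..N} (\<lambda>j. (B_f y j, B_g y j))"
definition dfieldA :: "nat \<Rightarrow> state \<Rightarrow> state \<Rightarrow> state" where
  "dfieldA N y h = mk {1..N} (\<lambda>j. (dA_f y h j, dA_g y h j))"
definition dfieldB :: "nat \<Rightarrow> state \<Rightarrow> state \<Rightarrow> state" where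
  "dfieldB N y h = mk {1..N} (\<lambda>j. (dB_f y h j, dB_g y h j))"

lemma nice_fieldA: "nice (fieldA N) (dfieldA N)"
  unfolding fieldA_def[abs_def] dfieldA_def[abs_def]
  by (intro nice_mk nice_Pair nice_A_f nice_A_g) simp

lemma nice_fieldB: "nice (fieldB N) (dfieldB N)"
  unfolding fieldB_def[abs_def] dfieldB_def[abs_def]
  by (intro nice_mk nice_Pair nice_B_f nice_B_g) simp

definition admissible :: "nat \<Rightarrow> state \<Rightarrow> bool" where
  "admissible N y \<longleftrightarrow> cf y 0 = 1 \<and> cg y 0 = 0 \<and> (\<forall>j>N. cf y j = 0 \<and> cg y j = 0)"

lemma field_entries:
  assumes y: "admissible N y" and j: "j \<ge> 1"
  shows "cf (fieldA N y) j = A_f y j" "cg (fieldA N y) j = A_g y j"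
    "cf (fieldB N y) j = B_f y j" "cg (fieldB N y) j = B_g y j"
  using assms by (auto simp: fieldA_def fieldB_def cf_mk cg_mk admissible_def A_f_def A_g_def B_f_def B_g_def)

lemma of_real_Im_simps:
  "complex_of_real (- 2 * Im w) = \<i> * (w - cnj w)"
  "complex_of_real (- 4 * Im w + 2 * Im w') = 2 * \<i> * (w - cnj w) - \<i> * (w' - cnj w')"
  by (simp_all add: complex_eq_iff)

lemma of_real_A_f: "complex_of_real (A_f y j) = \<i> * (cnj (cg y 1) * cg y j - cg y 1 * cnj (cg y j))"
  unfolding A_f_def of_real_Im_simps by simp

lemma of_real_B_f: "complex_of_real (B_f y j) = 2 * \<i> * (cnj (cg y 1) * cg y (j + 1) - cg y 1 * cnj (cg y (j + 1)))
    - \<i> * (cnj (b0 y) * cg y j - b0 y * cnj (cg y j))"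
  unfolding B_f_def of_real_Im_simps by simp

text \<open>An identity of polynomials in the coefficients and their conjugates, checked for each
  index. The real components are compared after embedding into the complex numbers, where imaginary
  parts become such polynomials.\<close>

lemma fields_commute:
  assumes y: "admissible N y"
  shows "dfieldA N y (fieldB N y) = dfieldB N y (fieldA N y)"
proof (rule state_eqI)
  note e = field_entries[OF y]
  have g: "dA_g y (fieldB N y) j = dB_g y (fieldA N y) j" if "j \<ge> 1" for j
    unfolding dA_g_def dB_g_def db0_def using that
    by (simp add: e A_g_def B_g_def b0_def of_real_A_f of_real_B_f algebra_simps numeral_2_eq_2)
  have "complex_of_real (dA_f y (fieldB N y) j) = complex_of_real (dB_f y (fieldA N y) j)" if "j \<ge> 1" for j
    unfolding dA_f_def dB_f_def db0_def of_real_Im_simps using that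
    by (simp add: e A_g_def B_g_def b0_def of_real_A_f of_real_B_f algebra_simps numeral_2_eq_2)
  then have f: "dA_f y (fieldB N y) j = dB_f y (fieldA N y) j" if "j \<ge> 1" for j
    using that of_real_eq_iff by blast
  show "cf (dfieldA N y (fieldB N y)) j = cf (dfieldB N y (fieldA N y)) j"
    "cg (dfieldA N y (fieldB N y)) j = cg (dfieldB N y (fieldA N y)) j" for j
    using f g by (auto simp: dfieldA_def dfieldB_def cf_mk cg_mk)
qed

text \<open>Entries of the matrix \<open>((ta, tb), (tc, - ta))\<close> of the time part of the zero-curvature pair.\<close>

definition ta :: "complex \<Rightarrow> state \<Rightarrow> complex" where
  "ta z y = - 2 * \<i> * z\<^sup>2 + \<i> * (cg y 1 * cnj (cg y 1))"
definition tb :: "complex \<Rightarrow> state \<Rightarrow> complex" where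
  "tb z y = - 2 * z * cg y 1 + b0 y"
definition tc :: "complex \<Rightarrow> state \<Rightarrow> complex" where
  "tc z y = 2 * z * cnj (cg y 1) - cnj (b0 y)"
definition dta :: "state \<Rightarrow> state \<Rightarrow> complex" where
  "dta y h = \<i> * (cg y 1 * cnj (cg h 1) + cg h 1 * cnj (cg y 1))"
definition dtb :: "complex \<Rightarrow> state \<Rightarrow> state \<Rightarrow> complex" where
  "dtb z y h = - 2 * z * cg h 1 + db0 y h"
definition dtc :: "complex \<Rightarrow> state \<Rightarrow> state \<Rightarrow> complex" where
  "dtc z y h = 2 * z * cnj (cg h 1) - cnj (db0 y h)"

lemma nice_ta: "nice (ta z) dta"
proof -
  have "nice (\<lambda>y. ta z y) dta"
    unfolding ta_def by (rule nice_cong, (rule nice_intros)+) (simp add: dta_def algebra_simps)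
  then show ?thesis by simp
qed

lemma nice_tb: "nice (tb z) (dtb z)"
proof -
  have "nice (\<lambda>y. tb z y) (dtb z)"
    unfolding tb_def by (rule nice_cong, (rule nice_b0 nice_intros)+) (simp add: dtb_def algebra_simps)
  then show ?thesis by simp
qed

lemma nice_tc: "nice (tc z) (dtc z)"
proof -
  have "nice (\<lambda>y. tc z y) (dtc z)"
    unfolding tc_def by (rule nice_cong, (rule nice_b0 nice_intros)+) (simp add: dtc_def algebra_simps)
  then show ?thesis by simp
qed

text \<open>The flows of the state together with a vector solution of the two linear problems.\<close>

definition extA :: "complex \<Rightarrow> nat \<Rightarrow> state \<times> complex \<times> complex \<Rightarrow> state \<times> complex \<times> complex" where
  "extA z N s = (fieldA N (fst s), - \<i> * z * fst (snd s) + - cg (fst s) 1 * snd (snd s),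
     cnj (cg (fst s) 1) * fst (snd s) - - \<i> * z * snd (snd s))"
definition extB :: "complex \<Rightarrow> nat \<Rightarrow> state \<times> complex \<times> complex \<Rightarrow> state \<times> complex \<times> complex" where
  "extB z N s = (fieldB N (fst s), ta z (fst s) * fst (snd s) + tb z (fst s) * snd (snd s),
     tc z (fst s) * fst (snd s) - ta z (fst s) * snd (snd s))"
definition dextA :: "complex \<Rightarrow> nat \<Rightarrow> state \<times> complex \<times> complex \<Rightarrow> state \<times> complex \<times> complex \<Rightarrow> state \<times> complex \<times> complex" where
  "dextA z N s h = (dfieldA N (fst s) (fst h),
     - \<i> * z * fst (snd h) - (cg (fst s) 1 * snd (snd h) + cg (fst h) 1 * snd (snd s)),
     cnj (cg (fst s) 1) * fst (snd h) + cnj (cg (fst h) 1) * fst (snd s) + \<i> * z * snd (snd h))"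
definition dextB :: "complex \<Rightarrow> nat \<Rightarrow> state \<times> complex \<times> complex \<Rightarrow> state \<times> complex \<times> complex \<Rightarrow> state \<times> complex \<times> complex" where
  "dextB z N s h = (dfieldB N (fst s) (fst h),
     ta z (fst s) * fst (snd h) + dta (fst s) (fst h) * fst (snd s)
       + (tb z (fst s) * snd (snd h) + dtb z (fst s) (fst h) * snd (snd s)),
     tc z (fst s) * fst (snd h) + dtc z (fst s) (fst h) * fst (snd s)
       - (ta z (fst s) * snd (snd h) + dta (fst s) (fst h) * snd (snd s)))"

lemmas nice_fst_compose = nice_compose_linear[OF bounded_linear_fst]
  and nice_fst_snd = nice_bounded_linear[OF bounded_linear_compose[OF bounded_linear_fst bounded_linear_snd]]
  and nice_snd_snd = nice_bounded_linear[OF bounded_linear_compose[OF bounded_linear_snd bounded_linear_snd]]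

lemma nice_extA: "nice (extA z N) (dextA z N)"
proof -
  have "nice (\<lambda>s. extA z N s) (dextA z N)"
    unfolding extA_def
    by (rule nice_cong, (rule nice_const nice_fst_compose[OF nice_fieldA] nice_fst_compose[OF nice_cg]
        nice_fst_snd nice_snd_snd nice_Pair nice_add nice_diff nice_minus nice_mult nice_cnj)+)
      (simp add: dextA_def algebra_simps)
  then show ?thesis by simp
qed

lemma nice_extB: "nice (extB z N) (dextB z N)"
proof -
  have "nice (\<lambda>s. extB z N s) (dextB z N)"
    unfolding extB_def
    by (rule nice_cong, (rule nice_fst_compose[OF nice_fieldB] nice_fst_compose[OF nice_ta]
        nice_fst_compose[OF nice_tb] nice_fst_compose[OF nice_tc]
        nice_fst_snd nice_snd_snd nice_Pair nice_add nice_diff nice_mult)+)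
      (simp add: dextB_def algebra_simps)
  then show ?thesis by simp
qed

text \<open>On the vector components this is the compatibility of the two linear problems, that is,
  the zero-curvature equation as an algebraic identity in the state.\<close>

lemma ext_fields_commute:
  assumes y: "admissible N (fst s)"
  shows "dextA z N s (extB z N s) = dextB z N s (extA z N s)"
proof -
  obtain y p q where s: "s = (y, p, q)" by (metis surj_pair)
  have y: "admissible N y" using assms by (simp add: s)
  note e = field_entries[OF y]
  have B1: "B_g y 1 = - 4 * \<i> * cg y 3 + 2 * \<i> * (cg y 1 * cnj (cg y 1)) * cg y 1
     + 4 * \<i> * cg y 1 * of_real (cf y 2) - 2 * \<i> * b0 y * of_real (cf y 1)"
    by (simp add: B_g_def numeral_3_eq_3 numeral_2_eq_2)
  have A1: "A_g y 1 = - 2 * \<i> * cg y 2 + 2 * \<i> * cg y 1 * of_real (cf y 1)"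
    and A2: "A_g y 2 = - 2 * \<i> * cg y 3 + 2 * \<i> * cg y 1 * of_real (cf y 2)"
    by (simp_all add: A_g_def numeral_3_eq_3 numeral_2_eq_2)
  have Af: "complex_of_real (A_f y 1) = 0" unfolding of_real_A_f by simp
  have e1: "cg (fieldB N y) 1 = B_g y 1" "cg (fieldA N y) 1 = A_g y 1" "cg (fieldA N y) 2 = A_g y 2"
    "cf (fieldA N y) 1 = A_f y 1"
    by (simp_all add: e)
  show ?thesis
    unfolding s dextA_def dextB_def extA_def extB_def fst_conv snd_conv dta_def dtb_def dtc_def db0_def
      ta_def tb_def tc_def e1 B1 A1 A2 Af fields_commute[OF y]
    by (simp add: b0_def algebra_simps power2_eq_square)
qed

section \<open>Invariants and global existence of the time flow\<close>

definition PF :: "nat \<Rightarrow> state \<Rightarrow> complex \<Rightarrow> complex" where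
  "PF N y z = (\<Sum>j\<le>N. of_real (cf y j) * z ^ (N - j))"
definition PG :: "nat \<Rightarrow> state \<Rightarrow> complex \<Rightarrow> complex" where
  "PG N y z = (\<Sum>j\<le>N. cg y j * z ^ (N - j))"
definition PH :: "nat \<Rightarrow> state \<Rightarrow> complex \<Rightarrow> complex" where
  "PH N y z = - (\<Sum>j\<le>N. cnj (cg y j) * z ^ (N - j))"

lemma bounded_linear_PF: "bounded_linear (\<lambda>y. PF N y z)"
  and bounded_linear_PG: "bounded_linear (\<lambda>y. PG N y z)"
  and bounded_linear_PH: "bounded_linear (\<lambda>y. PH N y z)"
  unfolding PF_def PG_def PH_def
  by (intro bounded_linear_minus bounded_linear_sum bounded_linear_mult_const
      bounded_linear_compose[OF bounded_linear_of_real bounded_linear_cf]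
      bounded_linear_compose[OF bounded_linear_cnj bounded_linear_cg] bounded_linear_cg)+

lemma PF_PG_cnj: "cnj (PF N y (cnj z)) = PF N y z" "cnj (PG N y (cnj z)) = - PH N y z"
  "cnj (PH N y (cnj z)) = - PG N y z"
  by (simp_all add: PF_def PG_def PH_def)

lemma shifted_sum:
  fixes c :: "nat \<Rightarrow> complex"
  assumes "c (N + 1) = 0"
  shows "(\<Sum>j\<le>N. c (j + 1) * z ^ (N - j)) = z * (\<Sum>j\<le>N. c j * z ^ (N - j)) - c 0 * z ^ (N + 1)"
proof -
  have e1: "(\<Sum>j\<le>Suc N. c j * z ^ (Suc N - j)) = c 0 * z ^ (N + 1) + (\<Sum>j\<le>N. c (j + 1) * z ^ (N - j))"
    by (simp add: sum.atMost_Suc_shift del: sum.atMost_Suc)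
  have e2: "(\<Sum>j\<le>Suc N. c j * z ^ (Suc N - j)) = z * (\<Sum>j\<le>N. c j * z ^ (N - j))"
    using assms by (simp add: sum_distrib_left Suc_diff_le mult_ac)
  show ?thesis using e1 unfolding e2 by (simp add: eq_diff_eq add.commute)
qed

text \<open>Reassembles the coefficients into an entry of [V, L]. The index shifts leave boundary
  terms in z^(N + 1), equal to 4 i \<open>cg y 1\<close> and its negative, because the leading
  coefficients are 1 and 0.\<close>

lemma PG_fieldB:
  assumes y: "admissible N y"
  shows "PG N (fieldB N y) z = 2 * ta z y * PG N y z - 2 * \<i> * tb z y * PF N y z"
proof -
  have g0: "cg y 0 = 0" "cf y 0 = 1" "cg y (N + 1) = 0" "cg y (N + 2) = 0" "cf y (N + 1) = 0"
    using y by (auto simp: admissible_def)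
  have "PG N (fieldB N y) z = (\<Sum>j\<le>N. B_g y j * z ^ (N - j))"
    unfolding PG_def
  proof (intro sum.cong refl)
    fix j
    have "cg (fieldB N y) 0 = B_g y 0"
      using g0 by (simp add: fieldB_def cg_mk B_g_def b0_def numeral_2_eq_2 algebra_simps)
    then show "cg (fieldB N y) j * z ^ (N - j) = B_g y j * z ^ (N - j)"
      using field_entries(4)[OF y, of j] by (cases "j = 0") auto
  qed
  also have "\<dots> = - 4 * \<i> * (\<Sum>j\<le>N. cg y (j + 2) * z ^ (N - j))
     + 2 * \<i> * (cg y 1 * cnj (cg y 1)) * (\<Sum>j\<le>N. cg y j * z ^ (N - j))
     + 4 * \<i> * cg y 1 * (\<Sum>j\<le>N. of_real (cf y (j + 1)) * z ^ (N - j))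
     - 2 * \<i> * b0 y * (\<Sum>j\<le>N. of_real (cf y j) * z ^ (N - j))"
    unfolding B_g_def sum_distrib_left sum.distrib[symmetric] sum_subtractf[symmetric]
    by (intro sum.cong refl) (simp add: algebra_simps)
  also have "(\<Sum>j\<le>N. of_real (cf y (j + 1)) * z ^ (N - j)) = z * PF N y z - z ^ (N + 1)"
    using shifted_sum[of "\<lambda>j. of_real (cf y j)" N z] g0 by (simp add: PF_def)
  also have "(\<Sum>j\<le>N. cg y (j + 2) * z ^ (N - j)) = z * (z * PG N y z) - cg y 1 * z ^ (N + 1)"
    using shifted_sum[of "\<lambda>j. cg y (j + 1)" N z] shifted_sum[of "\<lambda>j. cg y j" N z] g0
    by (simp add: PG_def numeral_2_eq_2)
  finally show ?thesis
    unfolding PF_def[symmetric] PG_def[symmetric] ta_def tb_def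
    by (simp add: algebra_simps power2_eq_square)
qed

lemma PH_fieldB:
  assumes y: "admissible N y"
  shows "PH N (fieldB N y) z = 2 * \<i> * tc z y * PF N y z - 2 * ta z y * PH N y z"
proof -
  have "PH N (fieldB N y) z = - cnj (PG N (fieldB N y) (cnj z))" by (simp add: PF_PG_cnj)
  also have "\<dots> = - (2 * cnj (ta (cnj z) y) * cnj (PG N y (cnj z)) + 2 * \<i> * cnj (tb (cnj z) y) * cnj (PF N y (cnj z)))"
    unfolding PG_fieldB[OF y] by simp
  also have "\<dots> = 2 * \<i> * tc z y * PF N y z - 2 * ta z y * PH N y z"
    unfolding PF_PG_cnj by (simp add: ta_def tb_def tc_def algebra_simps)
  finally show ?thesis .
qed

lemma PF_fieldB:
  assumes y: "admissible N y"
  shows "PF N (fieldB N y) z = - \<i> * (tb z y * PH N y z - tc z y * PG N y z)"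
proof -
  have g0: "cg y 0 = 0" "cf y 0 = 1" "cg y (N + 1) = 0"
    using y by (auto simp: admissible_def)
  have "PF N (fieldB N y) z = (\<Sum>j\<le>N. of_real (B_f y j) * z ^ (N - j))"
    unfolding PF_def
  proof (intro sum.cong refl)
    fix j
    have "complex_of_real (B_f y 0) = 0" unfolding of_real_B_f using g0 by simp
    then have "cf (fieldB N y) 0 = B_f y 0"
      by (simp add: fieldB_def cf_mk)
    then show "complex_of_real (cf (fieldB N y) j) * z ^ (N - j) = of_real (B_f y j) * z ^ (N - j)"
      using field_entries(3)[OF y, of j] by (cases "j = 0") auto
  qed
  also have "\<dots> = 2 * \<i> * (cnj (cg y 1) * (\<Sum>j\<le>N. cg y (j + 1) * z ^ (N - j))
        - cg y 1 * (\<Sum>j\<le>N. cnj (cg y (j + 1)) * z ^ (N - j)))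
      - \<i> * (cnj (b0 y) * (\<Sum>j\<le>N. cg y j * z ^ (N - j)) - b0 y * (\<Sum>j\<le>N. cnj (cg y j) * z ^ (N - j)))"
    unfolding of_real_B_f sum_distrib_left sum.distrib[symmetric] sum_subtractf[symmetric]
    by (intro sum.cong refl) (simp add: algebra_simps)
  also have "(\<Sum>j\<le>N. cg y (j + 1) * z ^ (N - j)) = z * PG N y z"
    using shifted_sum[of "\<lambda>j. cg y j" N z] g0 by (simp add: PG_def)
  also have "(\<Sum>j\<le>N. cnj (cg y (j + 1)) * z ^ (N - j)) = - z * PH N y z"
    using shifted_sum[of "\<lambda>j. cnj (cg y j)" N z] g0 by (simp add: PH_def)
  also have "(\<Sum>j\<le>N. cnj (cg y j) * z ^ (N - j)) = - PH N y z" by (simp add: PH_def)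
  finally show ?thesis
    unfolding PG_def[symmetric] tb_def tc_def by (simp add: algebra_simps)
qed

text \<open>By interpolation the norm of a state is controlled by the values of its polynomials at
  0, ..., N. These nodes are real, where the conserved quantity is a sum of squares.\<close>

lemma node_values_bound:
  "\<exists>\<Gamma>\<ge>0. \<forall>y M. admissible N y \<longrightarrow> (\<forall>m\<le>N. norm (PF N y (of_nat m)) \<le> M \<and> norm (PG N y (of_nat m)) \<le> M) \<longrightarrow>
     norm y \<le> \<Gamma> * M"
proof -
  obtain \<gamma> where \<gamma>: "\<And>c :: nat \<Rightarrow> complex. \<And>k. k \<le> N \<Longrightarrow> c k = (\<Sum>m\<le>N. \<gamma> k m * (\<Sum>i\<le>N. c i * of_nat m ^ i))"
    using coefficient_functional[of N] by blast
  define \<Gamma> where "\<Gamma> = (\<Sum>k\<le>N. \<Sum>m\<le>N. norm (\<gamma> k m))"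
  have \<Gamma>0: "\<Gamma> \<ge> 0" by (simp add: \<Gamma>_def sum_nonneg)
  have rev: "(\<Sum>i\<le>N. c (N - i) * z ^ i) = (\<Sum>j\<le>N. c j * z ^ (N - j))" for c :: "nat \<Rightarrow> complex" and z
    by (rule sum.reindex_bij_witness[of _ "\<lambda>j. N - j" "\<lambda>j. N - j"]) auto
  have b: "norm (c j) \<le> \<Gamma> * M" if j: "j \<le> N" and M: "\<And>m. m \<le> N \<Longrightarrow> norm (\<Sum>j\<le>N. c j * of_nat m ^ (N - j)) \<le> M"
    for c :: "nat \<Rightarrow> complex" and j M
  proof -
    have M0: "M \<ge> 0" using order_trans[OF norm_ge_zero M[of 0]] by simp
    have "c j = (\<Sum>m\<le>N. \<gamma> (N - j) m * (\<Sum>j\<le>N. c j * of_nat m ^ (N - j)))"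
      using \<gamma>[of "N - j" "\<lambda>i. c (N - i)"] j by (simp add: rev)
    also have "norm \<dots> \<le> (\<Sum>m\<le>N. norm (\<gamma> (N - j) m) * M)"
      by (rule sum_norm_le) (auto simp: norm_mult intro!: mult_left_mono M)
    also have "\<dots> = (\<Sum>m\<le>N. norm (\<gamma> (N - j) m)) * M" by (simp add: sum_distrib_right)
    also have "\<dots> \<le> \<Gamma> * M"
      unfolding \<Gamma>_def using j M0
      by (intro mult_right_mono member_le_sum[of "N - j" _ "\<lambda>k. \<Sum>m\<le>N. norm (\<gamma> k m)"]) (auto intro: sum_nonneg)
    finally show ?thesis .
  qed
  have "norm y \<le> 2 * (\<Gamma> * M)" if y: "admissible N y"
    and M: "\<forall>m\<le>N. norm (PF N y (of_nat m)) \<le> M \<and> norm (PG N y (of_nat m)) \<le> M" for y M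
  proof (rule norm_state_bound)
    fix j
    have M0: "M \<ge> 0" using M norm_ge_zero order_trans by (metis le0)
    have z: "j > N \<Longrightarrow> cf y j = 0 \<and> cg y j = 0" using y by (simp add: admissible_def)
    show "\<bar>cf y j\<bar> \<le> \<Gamma> * M"
      using b[of j "\<lambda>j. complex_of_real (cf y j)" M] M z \<Gamma>0 M0 by (cases "j \<le> N") (auto simp: PF_def)
    show "norm (cg y j) \<le> \<Gamma> * M"
      using b[of j "\<lambda>j. cg y j" M] M z \<Gamma>0 M0 by (cases "j \<le> N") (auto simp: PG_def)
  qed
  then show ?thesis using \<Gamma>0 by (intro exI[of _ "2 * \<Gamma>"]) (auto simp: mult.assoc)
qed

lemma node_values_le:
  "\<exists>\<Gamma>\<ge>0. \<forall>y. \<forall>m\<le>N. norm (PF N y (of_nat m)) \<le> \<Gamma> * norm y \<and> norm (PG N y (of_nat m)) \<le> \<Gamma> * norm y"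
proof -
  define \<Gamma> where "\<Gamma> = (\<Sum>j\<le>N. real N ^ (N - j))"
  have *: "norm (\<Sum>j\<le>N. c j * of_nat m ^ (N - j)) \<le> \<Gamma> * norm y"
    if "\<And>j. norm (c j) \<le> norm y" "m \<le> N" for c :: "nat \<Rightarrow> complex" and m and y :: state
  proof -
    have "norm (\<Sum>j\<le>N. c j * of_nat m ^ (N - j)) \<le> (\<Sum>j\<le>N. norm y * real N ^ (N - j))"
      using that by (intro sum_norm_le) (auto simp: norm_mult norm_power intro!: mult_mono power_mono)
    then show ?thesis by (simp add: \<Gamma>_def sum_distrib_left mult.commute)
  qed
  have "\<Gamma> \<ge> 0" by (simp add: \<Gamma>_def sum_nonneg)
  then show ?thesis
    by (intro exI[of _ \<Gamma>]) (auto simp: PF_def PG_def norm_cf norm_cg intro!: *)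
qed

lemma real_node_invariant:
  "PF N y (of_nat m) * PF N y (of_nat m) - PG N y (of_nat m) * PH N y (of_nat m) =
     complex_of_real ((norm (PF N y (of_nat m)))\<^sup>2 + (norm (PG N y (of_nat m)))\<^sup>2)"
proof -
  have "PF N y (of_nat m) = cnj (PF N y (of_nat m))" "PH N y (of_nat m) = - cnj (PG N y (of_nat m))"
    using PF_PG_cnj(1,2)[of N y "of_nat m"] by simp_all
  then have "PF N y (of_nat m) * PF N y (of_nat m) - PG N y (of_nat m) * PH N y (of_nat m) =
      PF N y (of_nat m) * cnj (PF N y (of_nat m)) + PG N y (of_nat m) * cnj (PG N y (of_nat m))"
    by (metis diff_minus_eq_add mult_minus_right)
  then show ?thesis by (simp only: complex_norm_square[symmetric] of_real_add)
qed

text \<open>\<open>R\<close> depends only on \<open>R0\<close> and \<open>N\<close>. It must be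
  fixed in advance, being the level of the cutoff, and its uniformity in the initial state later
  bounds the orbits for all \<open>x\<close> at once.\<close>

lemma state_flow_exists:
  "\<exists>R. \<forall>y0. admissible N y0 \<longrightarrow> norm y0 \<le> R0 \<longrightarrow>
     (\<exists>y. y 0 = y0 \<and> (\<forall>t. admissible N (y t) \<and> norm (y t) \<le> R \<and> (y has_vector_derivative fieldB N (y t)) (at t)))"
proof -
  obtain \<Gamma> where \<Gamma>: "\<Gamma> \<ge> 0" "\<And>y M. admissible N y \<Longrightarrow>
      (\<forall>m\<le>N. norm (PF N y (of_nat m)) \<le> M \<and> norm (PG N y (of_nat m)) \<le> M) \<Longrightarrow> norm y \<le> \<Gamma> * M"
    using node_values_bound[of N] by blast
  obtain \<Gamma>' where \<Gamma>': "\<Gamma>' \<ge> 0" "\<And>y m. m \<le> N \<Longrightarrow> norm (PF N y (of_nat m)) \<le> \<Gamma>' * norm y \<and> norm (PG N y (of_nat m)) \<le> \<Gamma>' * norm y"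
    using node_values_le[of N] by blast
  \<comment> \<open>The factor 2 is a crude bound for sqrt 2: the sum of two squares of size Gamma'
    R0 is at most the square of \<open>M\<close>.\<close>
  define M where "M = 2 * (\<Gamma>' * R0)"
  define R where "R = \<Gamma> * M"
  have "\<exists>y. y 0 = y0 \<and> (\<forall>t. admissible N (y t) \<and> norm (y t) \<le> R \<and> (y has_vector_derivative fieldB N (y t)) (at t))"
    if y0: "admissible N y0" "norm y0 \<le> R0" for y0
  proof -
    obtain y where y: "y 0 = y0" "\<And>t. (y has_vector_derivative cutoff R (norm (y t)) *\<^sub>R fieldB N (y t)) (at t)"
      using cutoff_flow_exists[OF nice_fieldB] by blast
    define k where "k t = cutoff R (norm (y t))" for t
    have lin: "((\<lambda>t. T (y t)) has_vector_derivative k t *\<^sub>R T (fieldB N (y t))) (at t)" if "bounded_linear T" for T :: "state \<Rightarrow> 'b::real_normed_vector" and t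
      using bounded_linear.has_vector_derivative[OF that y(2)[of t]] bounded_linear.linear[OF that]
      by (simp add: k_def linear_cmul)
    have adm: "admissible N (y t)" for t
    proof -
      have "cf (y t) j = cf (y 0) j \<and> cg (y t) j = cg (y 0) j" if j: "j = 0 \<or> j > N" for j
      proof -
        have "cf (fieldB N x) j = 0" "cg (fieldB N x) j = 0" for x
          using j by (auto simp: fieldB_def cf_mk cg_mk)
        then show ?thesis
          using lin[OF bounded_linear_cf[of j]] lin[OF bounded_linear_cg[of j]]
          by (auto intro!: const_of_zero_vector_derivative[of "\<lambda>t. cf (y t) j"] const_of_zero_vector_derivative[of "\<lambda>t. cg (y t) j"])
      qed
      then show ?thesis using y0(1) unfolding admissible_def y(1) by auto
    qed
    \<comment> \<open>The cutoff only multiplies the speed by the scalar \<open>k t\<close>, so the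
      truncated flow conserves the same quantity; this is what makes the a priori bound available
      before the truncation is removed.\<close>
    have inv: "PF N (y t) z * PF N (y t) z - PG N (y t) z * PH N (y t) z =
        PF N (y 0) z * PF N (y 0) z - PG N (y 0) z * PH N (y 0) z" for t z
    proof (rule const_of_zero_vector_derivative[of "\<lambda>t. PF N (y t) z * PF N (y t) z - PG N (y t) z * PH N (y t) z"])
      fix t
      note d = lin[OF bounded_linear_PF[of N z], of t] lin[OF bounded_linear_PG[of N z], of t] lin[OF bounded_linear_PH[of N z], of t]
      have "((\<lambda>t. PF N (y t) z * PF N (y t) z - PG N (y t) z * PH N (y t) z) has_vector_derivative
          (PF N (y t) z * (k t *\<^sub>R PF N (fieldB N (y t)) z) + (k t *\<^sub>R PF N (fieldB N (y t)) z) * PF N (y t) z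
           - (PG N (y t) z * (k t *\<^sub>R PH N (fieldB N (y t)) z) + (k t *\<^sub>R PG N (fieldB N (y t)) z) * PH N (y t) z))) (at t)"
        by (intro has_vector_derivative_diff has_vector_derivative_mult d)
      also have "PF N (y t) z * (k t *\<^sub>R PF N (fieldB N (y t)) z) + (k t *\<^sub>R PF N (fieldB N (y t)) z) * PF N (y t) z
           - (PG N (y t) z * (k t *\<^sub>R PH N (fieldB N (y t)) z) + (k t *\<^sub>R PG N (fieldB N (y t)) z) * PH N (y t) z) = 0"
        unfolding PF_fieldB[OF adm] PG_fieldB[OF adm] PH_fieldB[OF adm] scaleR_conv_of_real
        by (simp add: algebra_simps)
      finally show "((\<lambda>t. PF N (y t) z * PF N (y t) z - PG N (y t) z * PH N (y t) z) has_vector_derivative 0) (at t)" .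
    qed
    have nb: "norm (y t) \<le> R" for t
      unfolding R_def
    proof (rule \<Gamma>(2)[OF adm], intro allI impI)
      fix m assume m: "m \<le> N"
      have R0: "R0 \<ge> 0" using y0(2) norm_ge_zero order_trans by blast
      have "complex_of_real ((norm (PF N (y t) (of_nat m)))\<^sup>2 + (norm (PG N (y t) (of_nat m)))\<^sup>2) =
          complex_of_real ((norm (PF N y0 (of_nat m)))\<^sup>2 + (norm (PG N y0 (of_nat m)))\<^sup>2)"
        using inv[of t "of_nat m"] unfolding real_node_invariant y(1) .
      then have eq: "(norm (PF N (y t) (of_nat m)))\<^sup>2 + (norm (PG N (y t) (of_nat m)))\<^sup>2 =
          (norm (PF N y0 (of_nat m)))\<^sup>2 + (norm (PG N y0 (of_nat m)))\<^sup>2" using of_real_eq_iff by blast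
      have "\<Gamma>' * norm y0 \<le> \<Gamma>' * R0" using \<Gamma>' y0 by (intro mult_left_mono) auto
      then have le: "norm (PF N y0 (of_nat m)) \<le> \<Gamma>' * R0" "norm (PG N y0 (of_nat m)) \<le> \<Gamma>' * R0"
        using \<Gamma>'(2)[OF m, of y0] by linarith+
      have "(norm (PF N (y t) (of_nat m)))\<^sup>2 + (norm (PG N (y t) (of_nat m)))\<^sup>2 \<le> (\<Gamma>' * R0)\<^sup>2 + (\<Gamma>' * R0)\<^sup>2"
        unfolding eq using le by (intro add_mono power_mono) auto
      also have "\<dots> \<le> M\<^sup>2" by (simp add: M_def power_mult_distrib)
      finally have "(norm (PF N (y t) (of_nat m)))\<^sup>2 \<le> M\<^sup>2" "(norm (PG N (y t) (of_nat m)))\<^sup>2 \<le> M\<^sup>2"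
        by (smt (verit) zero_le_power2)+
      moreover have "M \<ge> 0" using \<Gamma>'(1) R0 by (simp add: M_def)
      ultimately show "norm (PF N (y t) (of_nat m)) \<le> M \<and> norm (PG N (y t) (of_nat m)) \<le> M"
        using power2_le_imp_le by blast
    qed
    have "cutoff R (norm (y t)) = 1" for t using nb[of t] by (simp add: cutoff_def)
    then have "(y has_vector_derivative fieldB N (y t)) (at t)" for t using y(2)[of t] by simp
    then show ?thesis using y(1) adm nb by blast
  qed
  then show ?thesis by blast
qed

section \<open>The solution of the nonlinear Schroedinger equation\<close>

lemma periodic_norm_le:
  fixes w :: "real \<Rightarrow> 'a::real_normed_vector"
  assumes "l > 0" and per: "\<And>x. w (x + l) = w x" and B: "\<And>x. 0 \<le> x \<Longrightarrow> x \<le> l \<Longrightarrow> norm (w x) \<le> B"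
  shows "norm (w x) \<le> B"
proof -
  have nat: "w (x + real k * l) = w x" for x k
  proof (induction k)
    case (Suc k)
    have "w (x + real (Suc k) * l) = w ((x + real k * l) + l)" by (simp add: algebra_simps)
    then show ?case using Suc by (simp add: per)
  qed simp
  have int: "w (x + of_int k * l) = w x" for x k
  proof (cases "k \<ge> 0")
    case True
    then show ?thesis using nat[of x "nat k"] by simp
  next
    case False
    then show ?thesis using nat[of "x + of_int k * l" "nat (- k)"] by simp
  qed
  define k where "k = \<lfloor>x / l\<rfloor>"
  have "of_int k \<le> x / l" "x / l < of_int k + 1" unfolding k_def by linarith+
  then have "of_int k * l \<le> x" "x \<le> of_int k * l + l" using assms(1) by (auto simp: field_simps)
  then have "norm (w (x - of_int k * l)) \<le> B" by (intro B) auto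
  then show ?thesis using int[of "x - of_int k * l" k] by simp
qed

lemma periodic_continuous_bounded:
  fixes w :: "real \<Rightarrow> 'a::real_normed_vector"
  assumes "l > 0" "continuous_on UNIV w" "\<And>x. w (x + l) = w x"
  shows "\<exists>B. \<forall>x. norm (w x) \<le> B"
proof -
  obtain B where B: "\<And>x. \<bar>x\<bar> \<le> l \<Longrightarrow> norm (w x) \<le> B"
    using continuous_bounded_abs[OF assms(2), of l] by blast
  have "norm (w x) \<le> B" for x by (rule periodic_norm_le[of l w, OF assms(1,3)]) (auto intro: B)
  then show ?thesis by blast
qed

lemma continuous_eq_at_point:
  fixes f g :: "complex \<Rightarrow> complex"
  assumes "continuous_on UNIV f" "continuous_on UNIV g" "\<And>z. z \<noteq> a \<Longrightarrow> f z = g z"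
  shows "f a = g a"
proof (rule tendsto_unique[of "at a"])
  show "(f \<longlongrightarrow> f a) (at a)" using assms(1) by (auto simp: continuous_on_def)
  have "(g \<longlongrightarrow> g a) (at a)" using assms(2) by (auto simp: continuous_on_def)
  then show "(f \<longlongrightarrow> g a) (at a)"
    by (rule Lim_transform_eventually) (auto simp: eventually_at_filter assms(3))
qed simp

section \<open>Division by the auxiliary polynomial\<close>

text \<open>Used to divide the auxiliary factor out of the evolved \<open>L\<close>. A root of
  \<open>q\<close> is a root of \<open>p\<close>; after cancelling the linear factor, the identity
  is recovered at the root itself by continuity of \<open>K\<close>, and the degree of
  \<open>q\<close> has dropped.\<close>

lemma poly_quotient_of_continuous:
  fixes p q :: "complex poly"
  assumes "q \<noteq> 0" "continuous_on UNIV K" "\<And>z. poly q z * K z = poly p z"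
  shows "\<exists>r. p = q * r \<and> (\<forall>z. poly r z = K z)"
  using assms
proof (induction "degree q" arbitrary: p q)
  case 0
  then obtain c where c: "q = [:c:]" by (metis degree_eq_zeroE)
  then have "c \<noteq> 0" using 0 by auto
  then have "p = q * smult (inverse c) p" by (simp add: c)
  moreover have "poly (smult (inverse c) p) z = K z" for z
    using 0(4)[of z] \<open>c \<noteq> 0\<close> by (simp add: c field_simps)
  ultimately show ?case by blast
next
  case (Suc d)
  then have "\<exists>i\<in>{1..degree q}. coeff q i \<noteq> 0" by (intro bexI[of _ "degree q"]) auto
  then obtain a where "(\<Sum>i\<le>degree q. coeff q i * a ^ i) = 0"
    using fundamental_theorem_of_algebra[of "coeff q" "degree q"] by blast
  then have "poly q a = 0" by (simp add: poly_altdef)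
  then obtain q1 where q1: "q = [:- a, 1:] * q1" by (metis dvdE poly_eq_0_iff_dvd)
  have "poly p a = 0" using Suc(5)[of a] \<open>poly q a = 0\<close> by simp
  then obtain p1 where p1: "p = [:- a, 1:] * p1" by (metis dvdE poly_eq_0_iff_dvd)
  have "q1 \<noteq> 0" using Suc(3) q1 by auto
  have *: "poly q1 z * K z = poly p1 z" for z
  proof (cases "z = a")
    case True
    have "poly q1 a * K a = poly p1 a"
    proof (rule continuous_eq_at_point[where f = "\<lambda>z. poly q1 z * K z"])
      fix z assume "z \<noteq> a"
      have "(z - a) * (poly q1 z * K z) = (z - a) * poly p1 z"
        using Suc(5)[of z] by (simp add: q1 p1 algebra_simps)
      then show "poly q1 z * K z = poly p1 z" using \<open>z \<noteq> a\<close> by simp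
    qed (intro continuous_intros Suc(4))+
    then show ?thesis using True by simp
  next
    case False
    have "(z - a) * (poly q1 z * K z) = (z - a) * poly p1 z"
      using Suc(5)[of z] by (simp add: q1 p1 algebra_simps)
    then show ?thesis using False by simp
  qed
  have "degree q = Suc (degree q1)" using \<open>q1 \<noteq> 0\<close> unfolding q1 by (subst degree_mult_eq) auto
  then have "d = degree q1" using Suc(2) by simp
  from Suc(1)[OF this \<open>q1 \<noteq> 0\<close> Suc(4) *] obtain r where r: "p1 = q1 * r" "\<forall>z. poly r z = K z" by blast
  have "p = q * r" unfolding p1 q1 r(1) by (simp only: mult.assoc)
  then show ?case using r(2) by blast
qed

text \<open>Supplies the continuity in \<open>z\<close> needed for that division. The difference of
  two solutions obeys a linear system whose forcing is O(norm (z - z0)).\<close>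

lemma sol2_parameter_continuous:
  fixes a b c p q :: "complex \<Rightarrow> real \<Rightarrow> complex"
  assumes s: "\<And>z. sol2 (a z) (b z) (c z) (p z) (q z)"
    and ini: "\<And>z. p z 0 = p z0 0" "\<And>z. q z 0 = q z0 0"
    and M: "M > 0" "\<And>z s. norm (z - z0) \<le> 1 \<Longrightarrow> \<bar>s\<bar> \<le> \<bar>t\<bar> \<Longrightarrow> norm (a z s) \<le> M \<and> norm (b z s) \<le> M \<and> norm (c z s) \<le> M"
    and L: "L \<ge> 0" "\<And>z s. norm (z - z0) \<le> 1 \<Longrightarrow> \<bar>s\<bar> \<le> \<bar>t\<bar> \<Longrightarrow> norm (a z s - a z0 s) \<le> L * norm (z - z0) \<and>
      norm (b z s - b z0 s) \<le> L * norm (z - z0) \<and> norm (c z s - c z0 s) \<le> L * norm (z - z0)"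
  shows "isCont (\<lambda>z. p z t) z0" "isCont (\<lambda>z. q z t) z0"
proof -
  define T where "T = \<bar>t\<bar>"
  have d: "((\<lambda>t. (p z t, q z t)) has_vector_derivative field2 (a z t) (b z t) (c z t) (p z t, q z t)) (at t)" for z t
    using s[of z] unfolding sol2_iff_field2 by blast
  have "continuous_on UNIV (\<lambda>t. (p z0 t, q z0 t))"
    using has_vector_derivative_continuous[OF d] by (simp add: continuous_on_eq_continuous_at)
  then obtain B0 where "\<And>s. \<bar>s\<bar> \<le> T \<Longrightarrow> norm (p z0 s, q z0 s) \<le> B0"
    using continuous_bounded_abs[of "\<lambda>t. (p z0 t, q z0 t)" T] by blast
  then have B: "\<bar>s\<bar> \<le> T \<Longrightarrow> norm (p z0 s, q z0 s) \<le> \<bar>B0\<bar>" for s by (meson abs_ge_self order_trans)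
  define C where "C = 2 * (4 * L * \<bar>B0\<bar> * T) * exp (2 * (4 * M) * T)"
  have est: "norm (p z t - p z0 t, q z t - q z0 t) \<le> C * norm (z - z0)" if z: "norm (z - z0) \<le> 1" for z
  proof -
    define D where "D t = (p z t, q z t) - (p z0 t, q z0 t)" for t
    define k where "k = 4 * (L * norm (z - z0)) * \<bar>B0\<bar>"
    have "norm (D t) \<le> 2 * (norm (D 0) + k * T) * exp (2 * (4 * M) * T)"
    proof (rule gronwall)
      show "4 * M > 0" using M by simp
      show "k \<ge> 0" using L(1) by (simp add: k_def)
      show "\<bar>t\<bar> \<le> T" by (simp add: T_def)
      fix s assume s: "\<bar>s\<bar> \<le> T"
      then have s': "\<bar>s\<bar> \<le> \<bar>t\<bar>" by (simp add: T_def)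
      let ?D' = "field2 (a z s) (b z s) (c z s) (D s) + field2 (a z s - a z0 s) (b z s - b z0 s) (c z s - c z0 s) (p z0 s, q z0 s)"
      have "(D has_vector_derivative field2 (a z s) (b z s) (c z s) (p z s, q z s) - field2 (a z0 s) (b z0 s) (c z0 s) (p z0 s, q z0 s)) (at s)"
        unfolding D_def by (intro has_vector_derivative_diff d)
      then show "(D has_vector_derivative ?D') (at s)"
        by (rule has_vector_derivative_eq_rhs) (simp add: D_def field2_def algebra_simps)
      have "norm ?D' \<le> 4 * M * norm (D s) + 4 * (L * norm (z - z0)) * norm (p z0 s, q z0 s)"
        using M(2)[OF z s'] L(2)[OF z s'] by (intro order_trans[OF norm_triangle_ineq] add_mono norm_field2) auto
      also have "\<dots> \<le> 4 * M * norm (D s) + k"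
        unfolding k_def using B[OF s] L(1) by (intro add_left_mono mult_left_mono) auto
      finally show "norm ?D' \<le> 4 * M * norm (D s) + k" .
    qed
    moreover have "D 0 = 0" using ini[of z] by (simp add: D_def)
    ultimately show ?thesis by (simp add: D_def k_def C_def mult_ac)
  qed
  have lim: "((\<lambda>z. C * norm (z - z0)) \<longlongrightarrow> 0) (at z0)"
  proof -
    have "((\<lambda>z. C * norm (z - z0)) \<longlongrightarrow> C * norm (z0 - z0)) (at z0)" by (intro tendsto_intros)
    then show ?thesis by simp
  qed
  have ev: "eventually (\<lambda>z. norm (z - z0) \<le> 1) (at z0)"
    by (auto simp: eventually_at dist_norm intro!: exI[of _ 1])
  have "((\<lambda>z. p z t - p z0 t) \<longlongrightarrow> 0) (at z0)" "((\<lambda>z. q z t - q z0 t) \<longlongrightarrow> 0) (at z0)"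
    using ev by (auto intro!: Lim_null_comparison[OF _ lim] elim!: eventually_mono
        intro: order_trans[OF norm_fst_le est] order_trans[OF norm_snd_le est])
  then show "isCont (\<lambda>z. p z t) z0" "isCont (\<lambda>z. q z t) z0"
    by (simp_all add: isCont_def LIM_zero_iff)
qed

text \<open>A family of time orbits labelled by \<open>x\<close>. The x-equation and the periodicity
  are assumed at time 0 only and are propagated below; a single bound for all \<open>x\<close> and
  \<open>t\<close> supplies the uniform constants.\<close>

locale finite_gap_flow =
  fixes N :: nat and l R :: real and y :: "real \<Rightarrow> real \<Rightarrow> state"
  assumes l_pos: "l > 0"
    and adm: "admissible N (y x t)"
    and bound: "norm (y x t) \<le> R"
    and flow_t: "(y x has_vector_derivative fieldB N (y x t)) (at t)"
    and initial_x: "((\<lambda>x. y x 0) has_vector_derivative fieldA N (y x 0)) (at x)"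
    and initial_periodic: "y (x + l) 0 = y x 0"
begin

definition v :: "real \<Rightarrow> real \<Rightarrow> complex" where "v x t = cg (y x t) 1"

lemma flow_x: "((\<lambda>x. y x t) has_vector_derivative fieldA N (y x t)) (at x)"
proof (rule commuting_flow[where y = y and r = 1 and R = R])
  show "nice (fieldA N) (dfieldA N)" "nice (fieldB N) (dfieldB N)" by (rule nice_fieldA nice_fieldB)+
qed (simp_all add: bound flow_t initial_x fields_commute adm)

lemma periodic: "y (x + l) t = y x t"
proof (rule lipschitz_ode_unique[where G = "\<lambda>_. fieldB N"])
  fix T :: real
  obtain K where "\<And>a b. norm a \<le> R \<Longrightarrow> norm b \<le> R \<Longrightarrow> norm (fieldB N b - fieldB N a) \<le> K * norm (b - a)"
    by (rule niceE[OF nice_fieldB, of R N]) blast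
  then show "\<exists>K. \<forall>t. \<bar>t\<bar> \<le> T \<longrightarrow> norm (fieldB N (y (x + l) t) - fieldB N (y x t)) \<le> K * norm (y (x + l) t - y x t)"
    using bound by blast
qed (intro flow_t initial_periodic)+

lemma continuous_y: "continuous_on UNIV (\<lambda>(x, t). y x t)"
proof -
  obtain KA where KA: "KA \<ge> 0" "\<And>a. norm a \<le> R \<Longrightarrow> norm (fieldA N a) \<le> KA"
    by (rule niceE[OF nice_fieldA, of R N]) blast
  obtain KB where KB: "KB \<ge> 0" "\<And>a. norm a \<le> R \<Longrightarrow> norm (fieldB N a) \<le> KB"
    by (rule niceE[OF nice_fieldB, of R N]) blast
  have lip: "norm (w s - w s') \<le> K * \<bar>s - s'\<bar>"
    if "\<And>s. (w has_vector_derivative w' s) (at s)" "\<And>s. norm (w' s) \<le> K" for w w' :: "real \<Rightarrow> state" and K s s'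
  proof -
    have "((\<lambda>r. r + s') has_vector_derivative 1) (at r)" for r
      by (auto intro!: derivative_eq_intros)
    from vector_diff_chain_at[OF this that(1)]
    have d: "((\<lambda>r. w (r + s')) has_vector_derivative w' (r + s')) (at r)" for r by (simp add: o_def)
    have "norm (w (s - s' + s') - w (0 + s')) \<le> K * \<bar>s - s'\<bar> - K * 0"
      by (rule vector_derivative_bound_abs[where w = "\<lambda>r. w (r + s')" and w' = "\<lambda>r. w' (r + s')" and \<phi>' = "\<lambda>_. K", OF order_refl])
        (use d that(2) in \<open>auto intro!: derivative_eq_intros\<close>)
    then show ?thesis by simp
  qed
  have le: "norm (y x t - y x' t') \<le> KA * \<bar>x - x'\<bar> + KB * \<bar>t - t'\<bar>" for x t x' t'
  proof -
    have "norm (y x t - y x' t) \<le> KA * \<bar>x - x'\<bar>"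
      by (rule lip[of "\<lambda>x. y x t", OF flow_x]) (rule KA(2)[OF bound])
    moreover have "norm (y x' t - y x' t') \<le> KB * \<bar>t - t'\<bar>"
      by (rule lip[of "y x'", OF flow_t]) (rule KB(2)[OF bound])
    ultimately show ?thesis using norm_triangle_ineq[of "y x t - y x' t" "y x' t - y x' t'"] by simp
  qed
  have "isCont (\<lambda>(x, t). y x t) s" for s
  proof -
    have "((\<lambda>r. KA * \<bar>fst r - fst s\<bar> + KB * \<bar>snd r - snd s\<bar>) \<longlongrightarrow> KA * \<bar>fst s - fst s\<bar> + KB * \<bar>snd s - snd s\<bar>) (at s)"
      by (intro tendsto_intros)
    then have lim: "((\<lambda>r. KA * \<bar>fst r - fst s\<bar> + KB * \<bar>snd r - snd s\<bar>) \<longlongrightarrow> 0) (at s)" by simp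
    have "((\<lambda>r. y (fst r) (snd r) - y (fst s) (snd s)) \<longlongrightarrow> 0) (at s)"
      by (rule Lim_null_comparison[OF _ lim]) (simp add: le)
    then show ?thesis by (simp add: isCont_def LIM_zero_iff case_prod_unfold)
  qed
  then show ?thesis by (simp add: continuous_on_eq_continuous_at)
qed

lemma v_t: "((\<lambda>t. v x t) has_vector_derivative B_g (y x t) 1) (at t)"
  using bounded_linear.has_vector_derivative[OF bounded_linear_cg[of 1] flow_t[of x t]] field_entries(4)[OF adm, of 1 x t]
  by (simp add: v_def)

lemma v_x: "((\<lambda>x. v x t) has_vector_derivative A_g (y x t) 1) (at x)"
  using bounded_linear.has_vector_derivative[OF bounded_linear_cg[of 1] flow_x[of t x]] field_entries(2)[OF adm, of 1 x t]
  by (simp add: v_def)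

text \<open>Here \<open>A_g (y x t) 1\<close> is v_x and \<open>B_g (y x t) 1\<close> is v_t, so
  this is the nonlinear Schroedinger equation. It uses that the first real coefficient does not
  change along the x-flow.\<close>

lemma v_xx: "((\<lambda>x. A_g (y x t) 1) has_vector_derivative
    - \<i> * B_g (y x t) 1 - 2 * (of_real (cmod (v x t)))\<^sup>2 * v x t) (at x)"
proof (rule has_vector_derivative_eq_rhs[OF nice_chain_vector_derivative[OF nice_A_g flow_x]])
  have Af: "complex_of_real (A_f (y x t) 1) = 0" unfolding of_real_A_f by simp
  have "(of_real (cmod (v x t)) :: complex)\<^sup>2 = v x t * cnj (v x t)" 
    by (simp only: complex_norm_square[symmetric] of_real_power)
  then show "dA_g (y x t) (fieldA N (y x t)) 1 =
      - \<i> * B_g (y x t) 1 - 2 * (of_real (cmod (v x t)))\<^sup>2 * v x t"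
    using Af unfolding v_def
    by (simp add: dA_g_def field_entries[OF adm] A_g_def B_g_def b0_def algebra_simps numeral_2_eq_2 numeral_3_eq_3)
qed

lemma continuous_y_component:
  assumes "nice g D"
  shows "continuous_on UNIV (\<lambda>(x, t). g (y x t))"
  using continuous_on_compose2[OF nice_continuous[OF assms] continuous_y] by (simp add: case_prod_unfold)

lemma continuous_v: "continuous_on UNIV (\<lambda>(x, t). v x t)"
  unfolding v_def by (rule continuous_y_component[OF nice_cg])

lemma continuous_slices:
  assumes "continuous_on UNIV (\<lambda>(x::real, t::real). w x t :: 'b::topological_space)"
  shows "continuous_on UNIV (\<lambda>x. w x t)" "continuous_on UNIV (\<lambda>t. w x t)"
proof -
  have "continuous_on UNIV (\<lambda>x. (\<lambda>(x, t). w x t) (x, t))"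
    by (rule continuous_on_compose2[OF assms]) (auto intro!: continuous_intros)
  moreover have "continuous_on UNIV (\<lambda>t. (\<lambda>(x, t). w x t) (x, t))"
    by (rule continuous_on_compose2[OF assms]) (auto intro!: continuous_intros)
  ultimately show "continuous_on UNIV (\<lambda>x. w x t)" "continuous_on UNIV (\<lambda>t. w x t)" by simp_all
qed

lemma continuous_v_x: "continuous_on UNIV (\<lambda>x. v x t)"
  by (rule continuous_slices(1)[OF continuous_v])

lemma nls: "nls_solution l (\<lambda>x. v x 0) v"
proof -
  define vxx where "vxx x t = - \<i> * B_g (y x t) 1 - 2 * (of_real (cmod (v x t)))\<^sup>2 * v x t" for x t
  have c: "continuous_on UNIV (\<lambda>(x, t). A_g (y x t) 1)" "continuous_on UNIV (\<lambda>(x, t). B_g (y x t) 1)"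
    by (rule continuous_y_component[OF nice_A_g] continuous_y_component[OF nice_B_g])+
  have c': "continuous_on UNIV (\<lambda>(x, t). vxx x t)"
    unfolding vxx_def using c(2) continuous_v by (auto simp: case_prod_unfold intro!: continuous_intros)
  have d: "((\<lambda>x. A_g (y x t) 1) has_vector_derivative vxx x t) (at x)" for x t
    using v_xx by (simp add: vxx_def)
  have e: "\<i> * B_g (y x t) 1 + vxx x t + 2 * (of_real (cmod (v x t)))\<^sup>2 * v x t = 0" for x t
    by (simp add: vxx_def)
  have p: "v (x + l) t = v x t" for x t by (simp add: v_def periodic)
  show ?thesis
    unfolding nls_solution_def
    by (intro conjI allI exI[of _ "\<lambda>x t. A_g (y x t) 1"] exI[of _ vxx] exI[of _ "\<lambda>x t. B_g (y x t) 1"] p refl v_x d v_t e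
        continuous_v c c')
qed

lemma periodic_C2_v: "periodic_C2 l (\<lambda>x. v x t)"
proof -
  have c: "continuous_on UNIV (\<lambda>x. B_g (y x t) 1)"
    by (rule continuous_slices(1)[OF continuous_y_component[OF nice_B_g]])
  have "continuous_on UNIV (\<lambda>x. - \<i> * B_g (y x t) 1 - 2 * (of_real (cmod (v x t)))\<^sup>2 * v x t)"
    by (intro continuous_intros c continuous_v_x)
  then show ?thesis
    unfolding periodic_C2_def
    by (intro conjI allI exI[of _ "\<lambda>x. A_g (y x t) 1"] exI[of _ "\<lambda>x. - \<i> * B_g (y x t) 1 - 2 * (of_real (cmod (v x t)))\<^sup>2 * v x t"]
        v_x v_xx) (simp_all add: v_def periodic)
qed

lemma time_coefficients_continuous:
  "continuous_on UNIV (\<lambda>t. ta z (y x t))" "continuous_on UNIV (\<lambda>t. tb z (y x t))" "continuous_on UNIV (\<lambda>t. tc z (y x t))"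
  by (rule continuous_slices(2)[OF continuous_y_component[OF nice_ta]]
      continuous_slices(2)[OF continuous_y_component[OF nice_tb]]
      continuous_slices(2)[OF continuous_y_component[OF nice_tc]])+

abbreviation time_sol :: "complex \<Rightarrow> real \<Rightarrow> (real \<Rightarrow> complex) \<Rightarrow> (real \<Rightarrow> complex) \<Rightarrow> bool" where
  "time_sol z x \<equiv> sol2 (\<lambda>t. ta z (y x t)) (\<lambda>t. tb z (y x t)) (\<lambda>t. tc z (y x t))"

text \<open>For each \<open>x\<close> the time problem is solved starting from a solution of the
  x-problem at t = 0. Commutation of the enlarged fields keeps the x-problem satisfied at all
  times.\<close>

lemma joint_column_exists:
  assumes ini: "zs (\<lambda>x. v x 0) z p0 q0"
  shows "\<exists>p q. (\<forall>x. p x 0 = p0 x \<and> q x 0 = q0 x) \<and> (\<forall>x. time_sol z x (p x) (q x)) \<and>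
    (\<forall>t. zs (\<lambda>x. v x t) z (\<lambda>x. p x t) (\<lambda>x. q x t))"
proof -
  have "\<exists>p q. time_sol z x p q \<and> p 0 = p0 x \<and> q 0 = q0 x" for x
    by (rule sol2_exists) (rule time_coefficients_continuous)+
  then obtain p q where pq: "\<And>x. time_sol z x (p x) (q x)" "\<And>x. p x 0 = p0 x" "\<And>x. q x 0 = q0 x"
    by metis
  define s where "s x t = (y x t, p x t, q x t)" for x t
  obtain Ma where Ma: "\<And>a. norm a \<le> R \<Longrightarrow> norm (ta z a) \<le> Ma" by (rule niceE[OF nice_ta, of R z]) blast
  obtain Mb where Mb: "\<And>a. norm a \<le> R \<Longrightarrow> norm (tb z a) \<le> Mb" by (rule niceE[OF nice_tb, of R z]) blast
  obtain Mc where Mc: "\<And>a. norm a \<le> R \<Longrightarrow> norm (tc z a) \<le> Mc" by (rule niceE[OF nice_tc, of R z]) blast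
  define M where "M = max 1 (max Ma (max Mb Mc))"
  have M: "norm (ta z (y x t)) \<le> M" "norm (tb z (y x t)) \<le> M" "norm (tc z (y x t)) \<le> M" for x t
    using Ma[OF bound] Mb[OF bound] Mc[OF bound] by (auto simp: M_def le_max_iff_disj)
  have M1: "M > 0" by (simp add: M_def)
  have "((\<lambda>x. s x t) has_vector_derivative extA z N (s x0 t)) (at x0)" for x0 t
  proof -
    have "continuous_on UNIV p0" "continuous_on UNIV q0"
      using ini has_vector_derivative_continuous unfolding zs_def sol2_def
      by (meson continuous_at_imp_continuous_on)+
    then have "continuous_on UNIV (\<lambda>x. (p0 x, q0 x))" by (intro continuous_intros)
    then obtain B where B: "\<And>x. \<bar>x\<bar> \<le> \<bar>x0\<bar> + 1 \<Longrightarrow> norm (p0 x, q0 x) \<le> B"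
      using continuous_bounded_abs[of "\<lambda>x. (p0 x, q0 x)" "\<bar>x0\<bar> + 1"] by blast
    \<comment> \<open>The form of the Gronwall bound with c = 0. The coefficients of the time
      problem are bounded by \<open>M\<close> for all \<open>x\<close>, so one constant serves all
      columns with |x - x0| < 1.\<close>
    define B' where "B' = 2 * (B + 0 * \<bar>t\<bar>) * exp (2 * (4 * M) * \<bar>t\<bar>)"
    show ?thesis
    proof (rule commuting_flow[where y = s and r = 1 and R = "R + B'"])
      show "nice (extA z N) (dextA z N)" "nice (extB z N) (dextB z N)" by (rule nice_extA nice_extB)+
      show "(s x has_vector_derivative extB z N (s x t)) (at t)" for x t
        using pq(1)[of x] unfolding s_def extB_def fst_conv snd_conv sol2_def
        by (intro has_vector_derivative_Pair flow_t) blast+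
      have "((\<lambda>x. (y x 0, p0 x, q0 x)) has_vector_derivative extA z N (y x0 0, p0 x0, q0 x0)) (at x0)"
        using ini unfolding extA_def fst_conv snd_conv zs_def sol2_def v_def
        by (intro has_vector_derivative_Pair initial_x) blast+
      then show "((\<lambda>x. s x 0) has_vector_derivative extA z N (s x0 0)) (at x0)"
        by (simp add: s_def pq)
      show "dextA z N (s x0 t) (extB z N (s x0 t)) = dextB z N (s x0 t) (extA z N (s x0 t))" for t
        by (rule ext_fields_commute) (simp add: s_def adm)
      fix x r assume x: "\<bar>x - x0\<bar> < 1" and r: "\<bar>r\<bar> \<le> \<bar>t\<bar>"
      have "norm (p x r, q x r) \<le> 2 * (norm (p x 0, q x 0) + 0 * \<bar>t\<bar>) * exp (2 * (4 * M) * \<bar>t\<bar>)"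
      proof (rule gronwall[OF _ _ r, where e' = "\<lambda>r. field2 (ta z (y x r)) (tb z (y x r)) (tc z (y x r)) (p x r, q x r)"])
        show "((\<lambda>r. (p x r, q x r)) has_vector_derivative field2 (ta z (y x r)) (tb z (y x r)) (tc z (y x r)) (p x r, q x r)) (at r)" for r
          using pq(1)[of x] unfolding sol2_iff_field2 by blast
        show "norm (field2 (ta z (y x r)) (tb z (y x r)) (tc z (y x r)) (p x r, q x r)) \<le> 4 * M * norm (p x r, q x r) + 0" for r
          using norm_field2[OF M] by simp
      qed (use M1 in auto)
      also have "\<dots> \<le> B'"
        unfolding B'_def pq using x by (intro mult_right_mono mult_left_mono add_right_mono B) auto
      finally have "norm (p x r, q x r) \<le> B'" .
      then show "norm (s x r) \<le> R + B'"
        unfolding s_def using bound[of x r] norm_Pair_sum[of "y x r" "(p x r, q x r)"] by linarith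
    qed simp
  qed
  note d = this
  have "zs (\<lambda>x. v x t) z (\<lambda>x. p x t) (\<lambda>x. q x t)" for t
    using bounded_linear.has_vector_derivative[OF bounded_linear_compose[OF bounded_linear_fst bounded_linear_snd] d[of t]]
      bounded_linear.has_vector_derivative[OF bounded_linear_compose[OF bounded_linear_snd bounded_linear_snd] d[of t]]
    by (simp add: zs_def sol2_def extA_def s_def v_def)
  with pq show ?thesis by blast
qed

text \<open>Let Psi(x, t) be the joint solution, T(t) = Psi(0, t), and let M(t) be the monodromy
  matrix at time t. Periodicity of the state gives Psi(l, t) = T(t) M(0), while the x-problem gives
  Psi(l, t) = M(t) T(t). Hence M(t) = T(t) M(0) T(t)^(-1).\<close>

lemma monodromy_conjugation:
  "\<exists>p1 q1 p2 q2. time_sol z 0 p1 q1 \<and> time_sol z 0 p2 q2 \<and> p1 0 = 1 \<and> q1 0 = 0 \<and> p2 0 = 0 \<and> q2 0 = 1 \<and>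
    (\<forall>t. f_fun l (\<lambda>x. v x t) z = conjF (p1 t) (q1 t) (p2 t) (q2 t)
           (f_fun l (\<lambda>x. v x 0) z) (psi_fun l (\<lambda>x. v x 0) z) (phi_fun l (\<lambda>x. v x 0) z) \<and>
         psi_fun l (\<lambda>x. v x t) z = conjG (p1 t) (q1 t) (p2 t) (q2 t)
           (f_fun l (\<lambda>x. v x 0) z) (psi_fun l (\<lambda>x. v x 0) z) (phi_fun l (\<lambda>x. v x 0) z) \<and>
         phi_fun l (\<lambda>x. v x t) z = conjH (p1 t) (q1 t) (p2 t) (q2 t)
           (f_fun l (\<lambda>x. v x 0) z) (psi_fun l (\<lambda>x. v x 0) z) (phi_fun l (\<lambda>x. v x 0) z))"
proof -
  let ?u = "\<lambda>x. v x 0"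
  note cu = continuous_v_x
  obtain P1 Q1 where c1: "\<And>x. P1 x 0 = y11 ?u z x" "\<And>x. Q1 x 0 = y21 ?u z x" "\<And>x. time_sol z x (P1 x) (Q1 x)"
      "\<And>t. zs (\<lambda>x. v x t) z (\<lambda>x. P1 x t) (\<lambda>x. Q1 x t)"
    using joint_column_exists[OF zs_column1(1)[OF cu]] by blast
  obtain P2 Q2 where c2: "\<And>x. P2 x 0 = y12 ?u z x" "\<And>x. Q2 x 0 = y22 ?u z x" "\<And>x. time_sol z x (P2 x) (Q2 x)"
      "\<And>t. zs (\<lambda>x. v x t) z (\<lambda>x. P2 x t) (\<lambda>x. Q2 x t)"
    using joint_column_exists[OF zs_column2(1)[OF cu]] by blast
  have i0: "P1 0 0 = 1" "Q1 0 0 = 0" "P2 0 0 = 0" "Q2 0 0 = 1"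
    using zs_column1[OF cu] zs_column2[OF cu] by (simp_all add: c1 c2)
  have det: "P1 0 t * Q2 0 t - P2 0 t * Q1 0 t = 1" for t
    using sol2_wronskian[OF c1(3) c2(3), of 0 t 0] by (simp add: i0)
  have yl: "y l t = y 0 t" for t using periodic[of 0 t] by simp
  have l1: "time_sol z 0 (P1 l) (Q1 l)" and l2: "time_sol z 0 (P2 l) (Q2 l)"
    using c1(3)[of l] c2(3)[of l] by (simp_all add: yl)
  \<comment> \<open>The time problems at x = l and x = 0 have the same coefficients by
    \<open>yl\<close>, so the solution at l is a combination of those at 0, determined by its value
    at t = 0.\<close>
  have L1: "P1 l t = y11 ?u z l * P1 0 t + y21 ?u z l * P2 0 t \<and> Q1 l t = y11 ?u z l * Q1 0 t + y21 ?u z l * Q2 0 t" for t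
    using sol2_unique[OF time_coefficients_continuous l1 sol2_combine[OF c1(3) c2(3), where d = "y11 ?u z l" and e = "y21 ?u z l"], of t]
    by (simp add: c1 c2 zs_column1(2,3)[OF cu] zs_column2(2,3)[OF cu])
  have L2: "P2 l t = y12 ?u z l * P1 0 t + y22 ?u z l * P2 0 t \<and> Q2 l t = y12 ?u z l * Q1 0 t + y22 ?u z l * Q2 0 t" for t
    using sol2_unique[OF time_coefficients_continuous l2 sol2_combine[OF c1(3) c2(3), where d = "y12 ?u z l" and e = "y22 ?u z l"], of t]
    by (simp add: c1 c2 zs_column1(2,3)[OF cu] zs_column2(2,3)[OF cu])
  have Y: "y11 (\<lambda>x. v x t) z l = P1 l t * Q2 0 t - P2 l t * Q1 0 t"
    "y12 (\<lambda>x. v x t) z l = P2 l t * P1 0 t - P1 l t * P2 0 t"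
    "y21 (\<lambda>x. v x t) z l = Q1 l t * Q2 0 t - Q2 l t * Q1 0 t"
    "y22 (\<lambda>x. v x t) z l = Q2 l t * P1 0 t - Q1 l t * P2 0 t" for t
  proof -
    have u1: "P1 l t = P1 0 t * y11 (\<lambda>x. v x t) z l + Q1 0 t * y12 (\<lambda>x. v x t) z l"
      "Q1 l t = P1 0 t * y21 (\<lambda>x. v x t) z l + Q1 0 t * y22 (\<lambda>x. v x t) z l"
      using zs_unique[OF cu c1(4)[of t]] by blast+
    have u2: "P2 l t = P2 0 t * y11 (\<lambda>x. v x t) z l + Q2 0 t * y12 (\<lambda>x. v x t) z l"
      "Q2 l t = P2 0 t * y21 (\<lambda>x. v x t) z l + Q2 0 t * y22 (\<lambda>x. v x t) z l"
      using zs_unique[OF cu c2(4)[of t]] by blast+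
    have "P1 l t * Q2 0 t - P2 l t * Q1 0 t = (P1 0 t * Q2 0 t - P2 0 t * Q1 0 t) * y11 (\<lambda>x. v x t) z l"
      "P2 l t * P1 0 t - P1 l t * P2 0 t = (P1 0 t * Q2 0 t - P2 0 t * Q1 0 t) * y12 (\<lambda>x. v x t) z l"
      "Q1 l t * Q2 0 t - Q2 l t * Q1 0 t = (P1 0 t * Q2 0 t - P2 0 t * Q1 0 t) * y21 (\<lambda>x. v x t) z l"
      "Q2 l t * P1 0 t - Q1 l t * P2 0 t = (P1 0 t * Q2 0 t - P2 0 t * Q1 0 t) * y22 (\<lambda>x. v x t) z l"
      unfolding u1 u2 by (simp_all add: algebra_simps)
    then show "y11 (\<lambda>x. v x t) z l = P1 l t * Q2 0 t - P2 l t * Q1 0 t"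
      "y12 (\<lambda>x. v x t) z l = P2 l t * P1 0 t - P1 l t * P2 0 t"
      "y21 (\<lambda>x. v x t) z l = Q1 l t * Q2 0 t - Q2 l t * Q1 0 t"
      "y22 (\<lambda>x. v x t) z l = Q2 l t * P1 0 t - Q1 l t * P2 0 t" unfolding det by simp_all
  qed
  have "f_fun l (\<lambda>x. v x t) z = conjF (P1 0 t) (Q1 0 t) (P2 0 t) (Q2 0 t) (f_fun l ?u z) (psi_fun l ?u z) (phi_fun l ?u z) \<and>
     psi_fun l (\<lambda>x. v x t) z = conjG (P1 0 t) (Q1 0 t) (P2 0 t) (Q2 0 t) (f_fun l ?u z) (psi_fun l ?u z) (phi_fun l ?u z) \<and>
     phi_fun l (\<lambda>x. v x t) z = conjH (P1 0 t) (Q1 0 t) (P2 0 t) (Q2 0 t) (f_fun l ?u z) (psi_fun l ?u z) (phi_fun l ?u z)" for t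
  proof -
    \<comment> \<open>The scalar part \<open>k\<close> of the monodromy matrix is invariant under
      conjugation and drops out of the traceless entries.\<close>
    define f k where "f = f_fun l ?u z" and "k = (y11 ?u z l + y22 ?u z l) / 2"
    have y: "y11 ?u z l = k + \<i> * f" "y22 ?u z l = k - \<i> * f"
      by (simp_all add: f_def k_def gap_functions[OF cu] field_simps)
    have "y11 (\<lambda>x. v x t) z l - y22 (\<lambda>x. v x t) z l =
        2 * \<i> * conjF (P1 0 t) (Q1 0 t) (P2 0 t) (Q2 0 t) f (y12 ?u z l) (y21 ?u z l)"
      unfolding Y[of t] conj_defs conjunct1[OF L1[of t]] conjunct2[OF L1[of t]] conjunct1[OF L2[of t]] conjunct2[OF L2[of t]] y
      by (simp add: algebra_simps)
    moreover have "y12 (\<lambda>x. v x t) z l = conjG (P1 0 t) (Q1 0 t) (P2 0 t) (Q2 0 t) f (y12 ?u z l) (y21 ?u z l)"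
      "y21 (\<lambda>x. v x t) z l = conjH (P1 0 t) (Q1 0 t) (P2 0 t) (Q2 0 t) f (y12 ?u z l) (y21 ?u z l)"
      unfolding Y[of t] conj_defs conjunct1[OF L1[of t]] conjunct2[OF L1[of t]] conjunct1[OF L2[of t]] conjunct2[OF L2[of t]] y
      by (simp_all add: algebra_simps)
    ultimately show ?thesis
      unfolding f_def[symmetric] gap_functions(1)[OF cu, of l t] gap_functions(2,3)[OF cu] by simp
  qed
  then show ?thesis using c1(3)[of 0] c2(3)[of 0] i0 by blast
qed

lemma lax_time: "sol3 (\<lambda>t. ta z (y x t)) (\<lambda>t. tb z (y x t)) (\<lambda>t. tc z (y x t))
    (\<lambda>t. PF N (y x t) z) (\<lambda>t. PG N (y x t) z) (\<lambda>t. PH N (y x t) z)"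
  unfolding sol3_def
  using bounded_linear.has_vector_derivative[OF bounded_linear_PF[of N z] flow_t[of x]]
    bounded_linear.has_vector_derivative[OF bounded_linear_PG[of N z] flow_t[of x]]
    bounded_linear.has_vector_derivative[OF bounded_linear_PH[of N z] flow_t[of x]]
  by (simp add: PF_fieldB[OF adm] PG_fieldB[OF adm] PH_fieldB[OF adm])

lemma time_sol_continuous_parameter:
  assumes s: "\<And>z. time_sol z 0 (p z) (q z)" and ini: "\<And>z z'. p z 0 = p z' 0" "\<And>z z'. q z 0 = q z' 0"
  shows "continuous_on UNIV (\<lambda>z. p z t)" "continuous_on UNIV (\<lambda>z. q z t)"
proof -
  obtain Kb where Kb: "\<And>a. norm a \<le> R \<Longrightarrow> norm (b0 a) \<le> Kb" by (rule niceE[OF nice_b0, of R]) blast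
  have R0: "R \<ge> 0" using bound[of 0 0] norm_ge_zero[of "y 0 0"] by linarith
  have cg: "norm (cg (y 0 s) 1) \<le> R" and b0: "norm (b0 (y 0 s)) \<le> Kb" for s
    using norm_cg[of "y 0 s" 1] bound[of 0 s] Kb[OF bound[of 0 s]] by auto
  have "isCont (\<lambda>z. p z t) z0 \<and> isCont (\<lambda>z. q z t) z0" for z0
  proof -
    define r where "r = norm z0 + 1"
    have r: "norm z \<le> r" if "norm (z - z0) \<le> 1" for z
      using norm_triangle_sub[of z z0] that by (simp add: r_def)
    have r0: "r > 0" by (simp add: r_def add_nonneg_pos)
    \<comment> \<open>\<open>M\<close> dominates the entries on the unit disc around
      \<open>z0\<close>. In \<open>L\<close>, 4 r bounds 2 |z + z0| from the quadratic entry
      \<open>ta\<close>, and 2 R comes from the linear entries.\<close>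
    define M where "M = 2 * r\<^sup>2 + R * R + (2 * r * R + Kb) + 1"
    define L where "L = 4 * r + 2 * R"
    have Kb0: "Kb \<ge> 0" using b0[of 0] norm_ge_zero order_trans by blast
    have vv: "norm (\<i> * (cg (y 0 s) 1 * cnj (cg (y 0 s) 1))) \<le> R * R" for s
      using cg[of s] R0 by (simp add: norm_mult mult_mono)
    have M1: "norm (ta z (y 0 s)) \<le> 2 * r\<^sup>2 + R * R" if "norm (z - z0) \<le> 1" for z s
      unfolding ta_def using r[OF that]
      by (intro order_trans[OF norm_triangle_ineq] add_mono vv) (auto simp: norm_mult norm_power intro!: power_mono)
    have M2: "norm (tb z (y 0 s)) \<le> 2 * r * R + Kb" if "norm (z - z0) \<le> 1" for z s
      unfolding tb_def using r[OF that] cg[of s] r0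
      by (intro order_trans[OF norm_triangle_ineq] add_mono b0) (auto simp: norm_mult intro!: mult_mono)
    have M3: "norm (tc z (y 0 s)) \<le> 2 * r * R + Kb" if "norm (z - z0) \<le> 1" for z s
      unfolding tc_def using r[OF that] cg[of s] r0 b0[of s]
      by (intro order_trans[OF norm_triangle_ineq4] add_mono) (auto simp: norm_mult intro!: mult_mono)
    have M: "norm (ta z (y 0 s)) \<le> M \<and> norm (tb z (y 0 s)) \<le> M \<and> norm (tc z (y 0 s)) \<le> M"
      if "norm (z - z0) \<le> 1" for z s
    proof -
      have "2 * r\<^sup>2 + R * R \<ge> 0" "2 * r * R + Kb \<ge> 0" using r0 R0 Kb0 by simp_all
      then have "2 * r\<^sup>2 + R * R \<le> M" "2 * r * R + Kb \<le> M" by (simp_all add: M_def)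
      then show ?thesis using M1[OF that, of s] M2[OF that, of s] M3[OF that, of s] by linarith
    qed
    have L: "norm (ta z (y 0 s) - ta z0 (y 0 s)) \<le> L * norm (z - z0) \<and>
        norm (tb z (y 0 s) - tb z0 (y 0 s)) \<le> L * norm (z - z0) \<and> norm (tc z (y 0 s) - tc z0 (y 0 s)) \<le> L * norm (z - z0)"
      if z: "norm (z - z0) \<le> 1" for z s
    proof (intro conjI)
      have "ta z (y 0 s) - ta z0 (y 0 s) = - 2 * \<i> * (z + z0) * (z - z0)"
        by (simp add: ta_def algebra_simps power2_eq_square)
      then have "norm (ta z (y 0 s) - ta z0 (y 0 s)) = 2 * norm (z + z0) * norm (z - z0)" by (simp add: norm_mult)
      also have "\<dots> \<le> L * norm (z - z0)"
        using norm_triangle_ineq[of z z0] r[OF z] R0 by (intro mult_right_mono) (auto simp: L_def r_def)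
      finally show "norm (ta z (y 0 s) - ta z0 (y 0 s)) \<le> L * norm (z - z0)" .
      have "tb z (y 0 s) - tb z0 (y 0 s) = - 2 * cg (y 0 s) 1 * (z - z0)"
        "tc z (y 0 s) - tc z0 (y 0 s) = 2 * cnj (cg (y 0 s) 1) * (z - z0)"
        by (simp_all add: tb_def tc_def algebra_simps)
      then have "norm (tb z (y 0 s) - tb z0 (y 0 s)) = 2 * norm (cg (y 0 s) 1) * norm (z - z0)"
        "norm (tc z (y 0 s) - tc z0 (y 0 s)) = 2 * norm (cg (y 0 s) 1) * norm (z - z0)" by (simp_all add: norm_mult)
      moreover have "2 * norm (cg (y 0 s) 1) * norm (z - z0) \<le> L * norm (z - z0)"
        using cg[of s] r0 by (intro mult_right_mono) (auto simp: L_def)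
      ultimately show "norm (tb z (y 0 s) - tb z0 (y 0 s)) \<le> L * norm (z - z0)"
        "norm (tc z (y 0 s) - tc z0 (y 0 s)) \<le> L * norm (z - z0)" by simp_all
    qed
    have "M > 0" using r0 R0 Kb0 by (simp add: M_def add_nonneg_pos)
    moreover have "L \<ge> 0" using r0 R0 by (simp add: L_def)
    ultimately show ?thesis
      by (intro conjI sol2_parameter_continuous[of "\<lambda>z t. ta z (y 0 t)" "\<lambda>z t. tb z (y 0 t)" "\<lambda>z t. tc z (y 0 t)" p q z0 M t L] s ini M L)
  qed
  then show "continuous_on UNIV (\<lambda>z. p z t)" "continuous_on UNIV (\<lambda>z. q z t)"
    by (simp_all add: continuous_on_eq_continuous_at)
qed

text \<open>The polynomial part at time t is the conjugate K of the initial one, and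
  \<open>h\<close> stays as it is. It remains to see that K is polynomial in z: \<open>r\<close> K
  is the evolved \<open>L\<close>, which is polynomial by construction, and K is continuous.\<close>

lemma n_gap_v:
  assumes h: "h holomorphic_on UNIV" and f0: "lead_coeff f0 = 1" "degree f0 = n + 1"
    and gap: "\<And>z. f_fun l (\<lambda>x. v x 0) z = poly f0 z * h z" "\<And>z. psi_fun l (\<lambda>x. v x 0) z = poly psi0 z * h z"
      "\<And>z. phi_fun l (\<lambda>x. v x 0) z = poly phi0 z * h z"
    and q: "lead_coeff r = 1" "degree r = n + 1" and N: "N = 2 * n + 2"
    and ini: "\<And>z. PF N (y 0 0) z = poly r z * poly f0 z" "\<And>z. PG N (y 0 0) z = poly r z * poly psi0 z"
      "\<And>z. PH N (y 0 0) z = poly r z * poly phi0 z"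
  shows "n_gap l n (\<lambda>x. v x t)"
proof -
  have "\<forall>z. \<exists>p1 q1 p2 q2. time_sol z 0 p1 q1 \<and> time_sol z 0 p2 q2 \<and> p1 0 = 1 \<and> q1 0 = 0 \<and> p2 0 = 0 \<and> q2 0 = 1 \<and>
    (\<forall>t. f_fun l (\<lambda>x. v x t) z = conjF (p1 t) (q1 t) (p2 t) (q2 t) (poly f0 z * h z) (poly psi0 z * h z) (poly phi0 z * h z) \<and>
         psi_fun l (\<lambda>x. v x t) z = conjG (p1 t) (q1 t) (p2 t) (q2 t) (poly f0 z * h z) (poly psi0 z * h z) (poly phi0 z * h z) \<and>
         phi_fun l (\<lambda>x. v x t) z = conjH (p1 t) (q1 t) (p2 t) (q2 t) (poly f0 z * h z) (poly psi0 z * h z) (poly phi0 z * h z))"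
    using monodromy_conjugation unfolding gap by blast
  then obtain p1 q1 p2 q2 where c: "\<And>z. time_sol z 0 (p1 z) (q1 z)" "\<And>z. time_sol z 0 (p2 z) (q2 z)"
      "\<And>z. p1 z 0 = 1" "\<And>z. q1 z 0 = 0" "\<And>z. p2 z 0 = 0" "\<And>z. q2 z 0 = 1"
    and T: "\<And>z t. f_fun l (\<lambda>x. v x t) z = conjF (p1 z t) (q1 z t) (p2 z t) (q2 z t) (poly f0 z * h z) (poly psi0 z * h z) (poly phi0 z * h z)"
      "\<And>z t. psi_fun l (\<lambda>x. v x t) z = conjG (p1 z t) (q1 z t) (p2 z t) (q2 z t) (poly f0 z * h z) (poly psi0 z * h z) (poly phi0 z * h z)"
      "\<And>z t. phi_fun l (\<lambda>x. v x t) z = conjH (p1 z t) (q1 z t) (p2 z t) (q2 z t) (poly f0 z * h z) (poly psi0 z * h z) (poly phi0 z * h z)"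
    by metis
  define KF where "KF z = conjF (p1 z t) (q1 z t) (p2 z t) (q2 z t) (poly f0 z) (poly psi0 z) (poly phi0 z)" for z
  define KG where "KG z = conjG (p1 z t) (q1 z t) (p2 z t) (q2 z t) (poly f0 z) (poly psi0 z) (poly phi0 z)" for z
  define KH where "KH z = conjH (p1 z t) (q1 z t) (p2 z t) (q2 z t) (poly f0 z) (poly psi0 z) (poly phi0 z)" for z
  have TK: "f_fun l (\<lambda>x. v x t) z = KF z * h z" "psi_fun l (\<lambda>x. v x t) z = KG z * h z" "phi_fun l (\<lambda>x. v x t) z = KH z * h z" for z
    unfolding T KF_def KG_def KH_def by (simp_all add: conj_scale[of _ _ _ _ "h z"] mult.commute)
  \<comment> \<open>Both sides solve the Lax equation in time with the same coefficients and, by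
    \<open>ini\<close>, the same value at t = 0.\<close>
  have LK: "poly r z * KF z = PF N (y 0 t) z \<and> poly r z * KG z = PG N (y 0 t) z \<and> poly r z * KH z = PH N (y 0 t) z" for z
    unfolding KF_def KG_def KH_def conj_scale[symmetric]
    by (rule sol3_unique[OF time_coefficients_continuous sol3_conj[OF c(1,2)] lax_time])
      (simp_all add: c ini conj_defs)
  have cont: "continuous_on UNIV (\<lambda>z. p1 z t)" "continuous_on UNIV (\<lambda>z. q1 z t)" "continuous_on UNIV (\<lambda>z. p2 z t)" "continuous_on UNIV (\<lambda>z. q2 z t)"
    using time_sol_continuous_parameter[OF c(1)] time_sol_continuous_parameter[OF c(2)] by (simp_all add: c)
  have contK: "continuous_on UNIV KF" "continuous_on UNIV KG" "continuous_on UNIV KH"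
    unfolding KF_def[abs_def] KG_def[abs_def] KH_def[abs_def] conj_defs by (intro continuous_intros cont)+
  have rev: "(\<Sum>j\<le>N. c j * z ^ (N - j)) = poly (\<Sum>i\<le>N. monom (c (N - i)) i) z" for c :: "nat \<Rightarrow> complex" and z
    unfolding poly_eq_sum_monom
    by (rule sum.reindex_bij_witness[of _ "\<lambda>j. N - j" "\<lambda>j. N - j"]) auto
  define aF where "aF = (\<Sum>i\<le>N. monom (complex_of_real (cf (y 0 t) (N - i))) i)"
  define aG where "aG = (\<Sum>i\<le>N. monom (cg (y 0 t) (N - i)) i)"
  define aH where "aH = - (\<Sum>i\<le>N. monom (cnj (cg (y 0 t) (N - i))) i)"
  have a: "PF N (y 0 t) z = poly aF z" "PG N (y 0 t) z = poly aG z" "PH N (y 0 t) z = poly aH z" for z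
    by (simp_all add: PF_def PG_def PH_def aF_def aG_def aH_def rev)
  have r0: "r \<noteq> 0" using q by auto
  obtain bF where bF: "aF = r * bF" "\<And>z. poly bF z = KF z"
    using poly_quotient_of_continuous[OF r0 contK(1)] LK a by metis
  obtain bG where bG: "\<And>z. poly bG z = KG z"
    using poly_quotient_of_continuous[OF r0 contK(2)] LK a by metis
  obtain bH where bH: "\<And>z. poly bH z = KH z"
    using poly_quotient_of_continuous[OF r0 contK(3)] LK a by metis
  \<comment> \<open>Admissibility keeps the leading coefficient of \<open>PF\<close> equal to 1,
    which fixes both the degree n + 1 and the leading coefficient of the quotient.\<close>
  have aN: "coeff aF N = 1"
    unfolding aF_def using adm[of 0 t] by (subst poly_eq_sum_monom(2)) (auto simp: admissible_def)
  have daF: "degree aF = N"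
  proof (rule antisym)
    show "degree aF \<le> N" unfolding aF_def by (rule poly_eq_sum_monom)
    show "N \<le> degree aF" using aN by (intro le_degree) simp
  qed
  have bF0: "bF \<noteq> 0" using aN bF(1) by auto
  have "degree aF = degree r + degree bF" unfolding bF(1) using r0 bF0 by (rule degree_mult_eq)
  then have db: "degree bF = n + 1" using daF q N by simp
  have "lead_coeff aF = lead_coeff r * lead_coeff bF" unfolding bF(1) by (rule lead_coeff_mult)
  then have lb: "lead_coeff bF = 1" using daF aN q(1) by simp
  show ?thesis
    unfolding n_gap_def
    by (intro conjI allI periodic_C2_v exI[of _ h] exI[of _ bF] exI[of _ bG] exI[of _ bH] h lb db)
      (simp_all only: TK bF(2) bG bH)
qed

end

section \<open>Existence\<close>

lemma finite_gap_solution_exists: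
  assumes l: "l > 0" and gap: "n_gap l n u"
  shows "\<exists>v. nls_solution l u v \<and> (\<forall>t. n_gap l n (\<lambda>x. v x t))"
proof -
  obtain h f0 psi0 phi0 where per: "periodic_C2 l u" and h: "h holomorphic_on UNIV"
    and f0: "lead_coeff f0 = 1" "degree f0 = n + 1"
    and g: "\<And>z. f_fun l u z = poly f0 z * h z" "\<And>z. psi_fun l u z = poly psi0 z * h z"
      "\<And>z. phi_fun l u z = poly phi0 z * h z"
    using gap unfolding n_gap_def by blast
  define N where "N = 2 * n + 2"
  obtain F :: "nat \<Rightarrow> real \<Rightarrow> real" and G :: "nat \<Rightarrow> real \<Rightarrow> complex" where
    FG: "\<And>x. F 0 x = 1" "\<And>x. G 0 x = 0" "\<And>x. G 1 x = u x" "\<And>j x. j > N \<Longrightarrow> F j x = 0" "\<And>j x. j > N \<Longrightarrow> G j x = 0"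
    and FGper: "\<And>j x. F j (x + l) = F j x" "\<And>j x. G j (x + l) = G j x"
    and FGd: "\<And>j x. (F j has_vector_derivative - 2 * Im (cnj (u x) * G j x)) (at x)"
      "\<And>j x. (G j has_vector_derivative - 2 * \<i> * G (j + 1) x + 2 * \<i> * u x * F j x) (at x)"
    and FG0: "\<And>z :: complex. (\<Sum>j\<le>N. F j 0 * z ^ (N - j)) = poly (map_poly cnj f0) z * poly f0 z"
      "\<And>z. (\<Sum>j\<le>N. G j 0 * z ^ (N - j)) = poly (map_poly cnj f0) z * poly psi0 z"
      "\<And>z. - (\<Sum>j\<le>N. cnj (G j 0) * z ^ (N - j)) = poly (map_poly cnj f0) z * poly phi0 z"
    by (rule gap_lax_coefficients[OF l per h f0 g N_def]) blast
  define y0 where "y0 x = mk {..N} (\<lambda>j. (F j x, G j x))" for x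
  have c0: "cf (y0 x) j = F j x" "cg (y0 x) j = G j x" for x j
    using FG by (auto simp: y0_def cf_mk cg_mk not_le)
  have adm0: "admissible N (y0 x)" for x
    using FG by (simp add: admissible_def c0)
  have d0: "(y0 has_vector_derivative fieldA N (y0 x)) (at x)" for x
  proof (rule has_vector_derivative_eq_rhs)
    show "(y0 has_vector_derivative mk {..N} (\<lambda>j. (- 2 * Im (cnj (u x) * G j x), - 2 * \<i> * G (j + 1) x + 2 * \<i> * u x * F j x))) (at x)"
      unfolding y0_def[abs_def] by (intro has_vector_derivative_mk has_vector_derivative_Pair FGd) simp
    \<comment> \<open>The two index sets differ at 0, where both derivative formulas give zero
      because F 0 = 1, G 0 = 0 and G 1 = u.\<close>
    show "mk {..N} (\<lambda>j. (- 2 * Im (cnj (u x) * G j x), - 2 * \<i> * G (j + 1) x + 2 * \<i> * u x * F j x)) = fieldA N (y0 x)"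
    proof (rule state_eqI)
      fix j
      show "cf (mk {..N} (\<lambda>j. (- 2 * Im (cnj (u x) * G j x), - 2 * \<i> * G (j + 1) x + 2 * \<i> * u x * F j x))) j = cf (fieldA N (y0 x)) j"
        using FG(2,3) by (cases "j = 0") (auto simp: fieldA_def cf_mk A_f_def c0)
      show "cg (mk {..N} (\<lambda>j. (- 2 * Im (cnj (u x) * G j x), - 2 * \<i> * G (j + 1) x + 2 * \<i> * u x * F j x))) j = cg (fieldA N (y0 x)) j"
        using FG(1,3) by (cases "j = 0") (auto simp: fieldA_def cg_mk A_g_def c0)
    qed
  qed
  have per0: "y0 (x + l) = y0 x" for x by (simp add: y0_def FGper)
  have "continuous_on UNIV y0"
    using has_vector_derivative_continuous[OF d0] by (simp add: continuous_on_eq_continuous_at)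
  then obtain R0 where R0: "\<And>x. norm (y0 x) \<le> R0"
    using periodic_continuous_bounded[of l y0, OF l _ per0] by blast
  obtain R where R: "\<And>a. admissible N a \<Longrightarrow> norm a \<le> R0 \<Longrightarrow>
     \<exists>y. y 0 = a \<and> (\<forall>t. admissible N (y t) \<and> norm (y t) \<le> R \<and> (y has_vector_derivative fieldB N (y t)) (at t))"
    using state_flow_exists[of N R0] by blast
  have "\<forall>x. \<exists>y. y 0 = y0 x \<and> (\<forall>t. admissible N (y t) \<and> norm (y t) \<le> R \<and> (y has_vector_derivative fieldB N (y t)) (at t))"
    using R[OF adm0 R0] by blast
  then obtain y where y: "\<And>x. y x 0 = y0 x" "\<And>x t. admissible N (y x t)" "\<And>x t. norm (y x t) \<le> R"
    "\<And>x t. (y x has_vector_derivative fieldB N (y x t)) (at t)"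
    by metis
  interpret finite_gap_flow N l R y
  proof
    show "l > 0" by (rule l)
    show "admissible N (y x t)" "norm (y x t) \<le> R" "(y x has_vector_derivative fieldB N (y x t)) (at t)" for x t
      by (rule y)+
    show "((\<lambda>x. y x 0) has_vector_derivative fieldA N (y x 0)) (at x)" "y (x + l) 0 = y x 0" for x
      unfolding y(1) by (rule d0 per0)+
  qed
  have v0: "(\<lambda>x. v x 0) = u" 
  proof
    show "v x 0 = u x" for x unfolding v_def y(1) c0 by (rule FG(3))
  qed
  have "n_gap l n (\<lambda>x. v x t)" for t
  proof (rule n_gap_v[OF h f0 _ _ _ _ _ N_def, where r = "map_poly cnj f0"])
    show "lead_coeff (map_poly cnj f0) = 1"
      by (simp only: lead_coeff_map_poly_cnj f0(1) complex_cnj_one)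
    show "degree (map_poly cnj f0) = n + 1" by (simp only: degree_map_poly_cnj f0(2))
    show "PF N (y 0 0) z = poly (map_poly cnj f0) z * poly f0 z" for z
      using FG0(1)[of z] by (simp add: PF_def y(1) c0)
    show "PG N (y 0 0) z = poly (map_poly cnj f0) z * poly psi0 z" for z
      using FG0(2)[of z] by (simp add: PG_def y(1) c0)
    show "PH N (y 0 0) z = poly (map_poly cnj f0) z * poly phi0 z" for z
      using FG0(3)[of z] by (simp add: PH_def y(1) c0)
  qed (simp_all add: v0 g)
  then show ?thesis using nls unfolding v0 by blast
qed

section \<open>Uniqueness\<close>

text \<open>Writing |a|^2 a as a product of three factors and replacing them one at a time gives
  three terms, whence the constant 3.\<close>

lemma cubic_difference_bound:
  fixes a b :: complex
  assumes "norm a \<le> m" "norm b \<le> m"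
  shows "norm ((of_real (norm a))\<^sup>2 * a - (of_real (norm b))\<^sup>2 * b) \<le> 3 * m\<^sup>2 * norm (a - b)"
proof -
  have sq: "(of_real (norm c))\<^sup>2 = c * cnj c" for c :: complex
    by (simp only: complex_norm_square[symmetric] of_real_power)
  have m: "0 \<le> m" using assms(1) norm_ge_zero order_trans by blast
  have "(of_real (norm a))\<^sup>2 * a - (of_real (norm b))\<^sup>2 * b = (a - b) * (cnj a * a) + b * a * cnj (a - b) + b * cnj b * (a - b)"
    unfolding sq by (simp add: algebra_simps)
  also have "norm \<dots> \<le> norm (a - b) * (m * m) + (m * m) * norm (a - b) + (m * m) * norm (a - b)"
    using assms m by (intro order_trans[OF norm_triangle_ineq] add_mono)
      (auto simp: norm_mult simp del: complex_cnj_diff intro!: mult_mono mult_left_mono mult_right_mono)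
  finally show ?thesis by (simp add: power2_eq_square algebra_simps)
qed

lemma periodic_vector_derivative:
  fixes w :: "real \<Rightarrow> 'a::real_normed_vector"
  assumes "\<And>x. w (x + l) = w x" "\<And>x. (w has_vector_derivative w' x) (at x)"
  shows "w' (x + l) = w' x"
proof -
  have "((\<lambda>x. x + l) has_vector_derivative 1) (at x)" by (auto intro!: derivative_eq_intros)
  from vector_diff_chain_at[OF this assms(2)] have "(w has_vector_derivative w' (x + l)) (at x)"
    by (simp add: o_def assms(1))
  then show ?thesis using assms(2) by (rule vector_derivative_unique_at)
qed

lemma nls_unique:
  assumes l: "l > 0" and v: "nls_solution l u v" and w: "nls_solution l u w"
  shows "v = w"
proof -
  obtain vx vxx vt where v: "\<And>x t. v (x + l) t = v x t" "\<And>x. v x 0 = u x"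
    "\<And>x t. ((\<lambda>x. v x t) has_vector_derivative vx x t) (at x)"
    "\<And>x t. ((\<lambda>x. vx x t) has_vector_derivative vxx x t) (at x)"
    "\<And>x t. ((\<lambda>t. v x t) has_vector_derivative vt x t) (at t)"
    "\<And>x t. \<i> * vt x t + vxx x t + 2 * (of_real (cmod (v x t)))\<^sup>2 * v x t = 0"
    "continuous_on UNIV (\<lambda>(x, t). v x t)" "continuous_on UNIV (\<lambda>(x, t). vxx x t)" "continuous_on UNIV (\<lambda>(x, t). vt x t)"
    using v unfolding nls_solution_def by blast
  obtain wx wxx wt where w: "\<And>x t. w (x + l) t = w x t" "\<And>x. w x 0 = u x"
    "\<And>x t. ((\<lambda>x. w x t) has_vector_derivative wx x t) (at x)"
    "\<And>x t. ((\<lambda>x. wx x t) has_vector_derivative wxx x t) (at x)"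
    "\<And>x t. ((\<lambda>t. w x t) has_vector_derivative wt x t) (at t)"
    "\<And>x t. \<i> * wt x t + wxx x t + 2 * (of_real (cmod (w x t)))\<^sup>2 * w x t = 0"
    "continuous_on UNIV (\<lambda>(x, t). w x t)" "continuous_on UNIV (\<lambda>(x, t). wxx x t)" "continuous_on UNIV (\<lambda>(x, t). wt x t)"
    using w unfolding nls_solution_def by blast
  define d where "d x t = v x t - w x t" for x t
  define dx where "dx x t = vx x t - wx x t" for x t
  define dxx where "dxx x t = vxx x t - wxx x t" for x t
  define dt where "dt x t = vt x t - wt x t" for x t
  define nl where "nl x t = (of_real (cmod (v x t)))\<^sup>2 * v x t - (of_real (cmod (w x t)))\<^sup>2 * w x t" for x t
  have dd: "((\<lambda>x. d x t) has_vector_derivative dx x t) (at x)" "((\<lambda>x. dx x t) has_vector_derivative dxx x t) (at x)"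
    "((\<lambda>t. d x t) has_vector_derivative dt x t) (at t)" for x t
    unfolding d_def dx_def dxx_def dt_def by (intro has_vector_derivative_diff v w)+
  have eq: "dt x t = \<i> * dxx x t + 2 * \<i> * nl x t" for x t
  proof -
    have "\<i> * (\<i> * vt x t + vxx x t + 2 * (of_real (cmod (v x t)))\<^sup>2 * v x t)
        - \<i> * (\<i> * wt x t + wxx x t + 2 * (of_real (cmod (w x t)))\<^sup>2 * w x t) = 0"
      unfolding v(6) w(6) by simp
    then show ?thesis by (simp add: dt_def dxx_def nl_def algebra_simps)
  qed
  have per: "d (x + l) t = d x t" "dx (x + l) t = dx x t" for x t
    using v(1) w(1) periodic_vector_derivative[of "\<lambda>x. d x t" l "\<lambda>x. dx x t", OF _ dd(1)] by (simp_all add: d_def)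
  have cont: "continuous_on UNIV (\<lambda>(x, t). d x t)" "continuous_on UNIV (\<lambda>(x, t). dt x t)" "continuous_on UNIV (\<lambda>(x, t). dxx x t)"
    using v(7-9) w(7-9) unfolding d_def dt_def dxx_def by (auto simp: case_prod_unfold intro!: continuous_intros)
  have cnl: "continuous_on UNIV (\<lambda>(x, t). nl x t)"
    using v(7) w(7) unfolding nl_def by (auto simp: case_prod_unfold intro!: continuous_intros)
  have slice: "continuous_on S (\<lambda>x. g x t)" if "continuous_on UNIV (\<lambda>(x, t). g x t)" for g :: "real \<Rightarrow> real \<Rightarrow> complex" and t S
  proof -
    have "continuous_on S (\<lambda>x. (\<lambda>(x, t). g x t) (x, t))"
      by (rule continuous_on_compose2[OF that]) (auto intro!: continuous_intros)
    then show ?thesis by simp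
  qed
  define E where "E t = integral {0..l} (\<lambda>x. inner (d x t) (d x t))" for t
  define E' where "E' t = integral {0..l} (\<lambda>x. 2 * inner (d x t) (dt x t))" for t
  have dE: "(E has_vector_derivative E' t) (at t)" for t
  proof -
    have swap: "continuous_on (UNIV \<times> cbox 0 l) (\<lambda>(t, x). 2 * inner (d x t) (dt x t))"
    proof -
      have "continuous_on (UNIV \<times> cbox 0 l) (\<lambda>r. g (snd r) (fst r))"
        if "continuous_on UNIV (\<lambda>(x, t). g x t)" for g :: "real \<Rightarrow> real \<Rightarrow> complex"
      proof -
        have "continuous_on (UNIV \<times> cbox 0 l) (\<lambda>r. (\<lambda>(x, t). g x t) (snd r, fst r))"
          by (rule continuous_on_compose2[OF that]) (auto intro!: continuous_intros)
        then show ?thesis by simp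
      qed
      from this[OF cont(1)] this[OF cont(2)] show ?thesis
        by (auto simp: case_prod_unfold intro!: continuous_intros)
    qed
    have "((\<lambda>t. integral (cbox 0 l) (\<lambda>x. inner (d x t) (d x t))) has_vector_derivative
        integral (cbox 0 l) (\<lambda>x. 2 * inner (d x t) (dt x t))) (at t within UNIV)"
    proof (rule leibniz_rule_vector_derivative[where U = UNIV and f = "\<lambda>t x. inner (d x t) (d x t)" and fx = "\<lambda>t x. 2 * inner (d x t) (dt x t)"])
      fix t x
      have "((\<lambda>t. inner (d x t) (d x t)) has_vector_derivative inner (d x t) (dt x t) + inner (dt x t) (d x t)) (at t)"
        by (rule bounded_bilinear.has_vector_derivative[OF bounded_bilinear_inner dd(3) dd(3)])
      then show "((\<lambda>t. inner (d x t) (d x t)) has_vector_derivative 2 * inner (d x t) (dt x t)) (at t within UNIV)"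
        by (simp add: inner_commute)
    next
      fix t
      show "(\<lambda>x. inner (d x t) (d x t)) integrable_on cbox 0 l"
        by (intro integrable_continuous continuous_intros slice cont)
    qed (use swap in auto)
    then show ?thesis by (simp add: E_def[abs_def] E'_def)
  qed
  have E0: "E 0 = 0" by (simp add: E_def d_def v(2) w(2))
  have "E t = 0" for t
  proof -
    define T where "T = \<bar>t\<bar>"
    have "compact ((\<lambda>(x, t). v x t) ` ({0..l} \<times> {-T..T}))" "compact ((\<lambda>(x, t). w x t) ` ({0..l} \<times> {-T..T}))"
      using v(7) w(7) by (auto intro!: compact_continuous_image compact_Times intro: continuous_on_subset)
    then obtain m1 m2 where m12: "\<forall>c\<in>(\<lambda>(x, t). v x t) ` ({0..l} \<times> {-T..T}). norm c \<le> m1"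
        "\<forall>c\<in>(\<lambda>(x, t). w x t) ` ({0..l} \<times> {-T..T}). norm c \<le> m2"
      using compact_imp_bounded bounded_iff by metis
    define m where "m = max m1 m2"
    have m: "norm (v x s) \<le> m" "norm (w x s) \<le> m" if "x \<in> {0..l}" "\<bar>s\<bar> \<le> T" for x s
      using m12 that by (force simp: m_def le_max_iff_disj abs_le_iff)+
    \<comment> \<open>12 = 2 * 2 * 3: the derivative of the square, the factor 2 of the nonlinearity
      and the cubic bound. The added 1 makes \<open>K\<close> positive for
      \<open>gronwall\<close>.\<close>
    define K where "K = 12 * m\<^sup>2 + 1"
    have Eb: "\<bar>E' s\<bar> \<le> K * \<bar>E s\<bar> + 0" if s: "\<bar>s\<bar> \<le> T" for s
    proof -
      \<comment> \<open>The dispersive term does not contribute: its integrand is the derivative of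
        \<open>inner d (i * dx)\<close>, since dx is orthogonal to i dx in the real inner product,
        and the boundary values cancel by periodicity.\<close>
      have "((\<lambda>x. inner (d x s) (\<i> * dxx x s)) has_integral inner (d l s) (\<i> * dx l s) - inner (d 0 s) (\<i> * dx 0 s)) {0..l}"
      proof (rule fundamental_theorem_of_calculus)
        fix x
        have "((\<lambda>x. \<i> * dx x s) has_vector_derivative \<i> * dxx x s) (at x)"
          by (intro has_vector_derivative_mult_right dd)
        from bounded_bilinear.has_vector_derivative[OF bounded_bilinear_inner dd(1) this]
        have "((\<lambda>x. inner (d x s) (\<i> * dx x s)) has_vector_derivative
            inner (d x s) (\<i> * dxx x s) + inner (dx x s) (\<i> * dx x s)) (at x)" .
        moreover have "inner (dx x s) (\<i> * dx x s) = 0" by (simp add: inner_complex_def)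
        ultimately show "((\<lambda>x. inner (d x s) (\<i> * dx x s)) has_vector_derivative inner (d x s) (\<i> * dxx x s)) (at x within {0..l})"
          by (simp add: has_vector_derivative_at_within)
      qed (use l in simp)
      then have I1: "((\<lambda>x. inner (d x s) (\<i> * dxx x s)) has_integral 0) {0..l}"
        using per(1)[of 0 s] per(2)[of 0 s] by simp
      have I2: "(\<lambda>x. 4 * inner (d x s) (\<i> * nl x s)) integrable_on {0..l}"
        by (intro integrable_continuous_real continuous_intros slice cont cnl)
      have "E' s = integral {0..l} (\<lambda>x. 2 * inner (d x s) (\<i> * dxx x s) + 4 * inner (d x s) (\<i> * nl x s))"
        unfolding E'_def by (intro integral_cong) (simp add: eq inner_add_right inner_complex_def algebra_simps)
      also have "\<dots> = integral {0..l} (\<lambda>x. 2 * inner (d x s) (\<i> * dxx x s)) + integral {0..l} (\<lambda>x. 4 * inner (d x s) (\<i> * nl x s))"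
        using I1 by (intro Henstock_Kurzweil_Integration.integral_add I2 integrable_on_mult_right has_integral_integrable)
      also have "integral {0..l} (\<lambda>x. 2 * inner (d x s) (\<i> * dxx x s)) = 0"
        using I1 by (simp add: integral_unique)
      finally have "E' s = integral {0..l} (\<lambda>x. 4 * inner (d x s) (\<i> * nl x s))" by simp
      moreover have "norm (integral {0..l} (\<lambda>x. 4 * inner (d x s) (\<i> * nl x s))) \<le> integral {0..l} (\<lambda>x. 12 * m\<^sup>2 * inner (d x s) (d x s))"
      proof (rule integral_norm_bound_integral[OF I2])
        show "(\<lambda>x. 12 * m\<^sup>2 * inner (d x s) (d x s)) integrable_on {0..l}"
          by (intro integrable_continuous_real continuous_intros slice cont)
        fix x assume x: "x \<in> {0..l}"
        have "\<bar>inner (d x s) (\<i> * nl x s)\<bar> \<le> norm (d x s) * norm (\<i> * nl x s)" by (rule Cauchy_Schwarz_ineq2)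
        also have "\<dots> \<le> norm (d x s) * (3 * m\<^sup>2 * norm (d x s))"
          using cubic_difference_bound[OF m[OF x s]] by (intro mult_left_mono) (auto simp: norm_mult nl_def d_def)
        also have "\<dots> = 3 * m\<^sup>2 * inner (d x s) (d x s)" by (simp add: dot_square_norm power2_eq_square)
        finally show "norm (4 * inner (d x s) (\<i> * nl x s)) \<le> 12 * m\<^sup>2 * inner (d x s) (d x s)" by simp
      qed
      moreover have "integral {0..l} (\<lambda>x. 12 * m\<^sup>2 * inner (d x s) (d x s)) = 12 * m\<^sup>2 * E s" by (simp add: E_def)
      ultimately have "\<bar>E' s\<bar> \<le> 12 * m\<^sup>2 * E s" by (simp only: real_norm_def)
      also have "\<dots> \<le> 12 * m\<^sup>2 * \<bar>E s\<bar>" by (intro mult_left_mono) auto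
      also have "\<dots> \<le> K * \<bar>E s\<bar> + 0" by (simp add: K_def algebra_simps)
      finally show ?thesis .
    qed
    have "norm (E t) \<le> 2 * (norm (E 0) + 0 * T) * exp (2 * K * T)"
      by (rule gronwall[where e' = E'])
        (use dE Eb in \<open>auto simp: K_def T_def intro!: add_nonneg_pos\<close>)
    then show ?thesis by (simp add: E0)
  qed
  have "d x t = 0" for x t
  proof -
    have "integral {0..l} (\<lambda>x. inner (d x t) (d x t)) = 0" using \<open>E t = 0\<close> by (simp add: E_def)
    moreover have "continuous_on {0..l} (\<lambda>x. inner (d x t) (d x t))" by (intro continuous_intros slice cont)
    ultimately have "\<forall>x\<in>{0..l}. inner (d x t) (d x t) = 0"
      using integral_eq_0_iff[of 0 l "\<lambda>x. inner (d x t) (d x t)"] l by simp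
    then have "norm (d x t) \<le> 0" if "0 \<le> x" "x \<le> l" for x using that by simp
    then have "norm (d x t) \<le> 0" by (rule periodic_norm_le[of l "\<lambda>x. d x t", OF l per(1)])
    then show ?thesis by simp
  qed
  then show ?thesis by (simp add: d_def fun_eq_iff)
qed

theorem theorem2:
  fixes l :: real and n :: nat and u :: "real \<Rightarrow> complex"
  assumes "l > 0" and "n_gap l n u"
  shows "(\<exists>!v. nls_solution l u v) \<and>
         (\<forall>v t. nls_solution l u v \<longrightarrow> n_gap l n (\<lambda>x. v x t))"
proof -
  obtain v where v: "nls_solution l u v" "\<And>t. n_gap l n (\<lambda>x. v x t)"
    using finite_gap_solution_exists[OF assms] by blast
  have "w = v" if "nls_solution l u w" for w
    using nls_unique[OF assms(1) that v(1)] .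
  then show ?thesis using v by blast
qed

end
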